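(* Let $\mathcal T$ be a regular rooted tree with generation levels $t_0,\dots,t_{N_{\mathcal T}}$ and branching numbers $b_0,\dots,b_{N_{\mathcal T}}$, and let $\mathcal A^{\mathrm D},\mathcal A^{\mathrm N}$ be the Dirichlet and Neumann realisations of the Ornstein–Uhlenbeck operator on $L^2_\mu(\mathcal T)$ and $\mathfrak A_k^{\mathrm D},\mathfrak A_k^{\mathrm N}$ the reduced operators on $L^2_\nu([t_k,\infty))$ (see context). The operator $\mathcal A^{\mathrm D}$ is unitarily equivalent to $$\mathfrak A_0^{\mathrm D}\oplus\bigoplus_{k=0}^{N_{\mathcal T}}\big(\mathfrak A_k^{\mathrm D}\big)^{[m_k(b_k-1)]},$$ whereas the operator $\mathcal A^{\mathrm N}$ is unitarily equivalent to $$\mathfrak A_0^{\mathrm N}\oplus\bigoplus_{k=0}^{N_{\mathcal T}}\big(\mathfrak A_k^{\mathrm D}\big)^{[m_k(b_k-1)]}.$$ Here $m_0=1$, $m_k=b_0b_1\cdots b_{k-1}$ for $k\ge1$, and $A^{[r]}$ denotes the orthogonal sum of $r$ copies of a self-adjoint operator $A$ (with $A^{[0]}$ omitted).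
   Context: Regular rooted tree. Let $\widetilde{\mathcal T}$ be a compact rooted metric tree (finite tree, edges of finite positive length) with vertex set $\mathsf V$, root $\mathsf o$, and nonempty set $\mathsf L\subset\mathsf V\setminus\{\mathsf o\}$ of leaves (degree-one vertices other than the root); $\mathcal T$ is obtained by attaching to each vertex of $\mathsf L$ a finite non-zero number of half-lines. $|x|$ is the path distance of $x\in\mathcal T$ to $\mathsf o$; edges are oriented and parametrised by arc length away from the root, with $f'$ the weak derivative in this coordinate. $\mathcal T$ is regular if there are $N_{\mathcal T}\in\mathbb N$, levels $0=t_0<t_1<\dots<t_{N_{\mathcal T}}$ and positive integers $b_0,\dots,b_{N_{\mathcal T}}$ such that: $\mathsf V=\bigsqcup_{k=0}^{N_{\mathcal T}}\mathsf V_k$ with $\mathsf V_k=\{\mathsf v\in\mathsf V:|\mathsf v|=t_k\}$; every $\mathsf v\in\mathsf V_k$ has exactly $b_k$ outgoing edges (edges emanating away from the root); and $\mathsf V_{N_{\mathcal T}}=\mathsf L$ (so each such vertex carries $b_{N_{\mathcal T}}$ half-lines). Let $g_{\mathcal T}(t)=\#\{x\in\mathcal T:|x|=t\}$. Operators on the tree. $G(t)=\frac2{\sqrt\pi}e^{-t^2}$, $\mu(\mathrm dx)=G(|x|)\,\mathrm dx$ on $\mathcal T$. $H^1_\mu(\mathcal T)$: continuous functions on $\mathcal T$ lying in $H^1_\mu(\mathsf e)$ on each edge $\mathsf e$; $H^1_{0,\mu}(\mathcal T)$: those vanishing at $\mathsf o$. $\mathcal A^{\mathrm D}$ (resp. $\mathcal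 A^{\mathrm N}$) is the self-adjoint operator on the complex Hilbert space $L^2_\mu(\mathcal T)$ associated with the closed form $\frac12\int_{\mathcal T}f'\,\overline{h'}\,\mathrm d\mu$ on $H^1_{0,\mu}(\mathcal T)$ (resp. $H^1_\mu(\mathcal T)$). Equivalently: $-\frac12f''+|x|f'$ on edges with $f$ edgewise in $H^2_\mu$, continuous at vertices, zero sum of derivatives pointing away from the vertex at every vertex $\ne\mathsf o$, and at $\mathsf o$ the condition $f(\mathsf o)=0$ (resp. the same zero-sum condition). Reduced operators. $\nu(\mathrm dt)=g_{\mathcal T}(t)G(t)\,\mathrm dt$ on $[0,\infty)$. For $k\in\{0,\dots,N_{\mathcal T}\}$, $\mathfrak A_k^{\mathrm D}$ (resp. $\mathfrak A_k^{\mathrm N}$) is the self-adjoint operator on $L^2_\nu([t_k,\infty))$ associated with the closed form $\mathfrak a_k(\varphi,\psi)=\frac12\int_{t_k}^\infty\varphi'\,\overline{\psi'}\,\mathrm d\nu$ on $H^1_{0,\nu}([t_k,\infty))=\{\varphi\in H^1_\nu([t_k,\infty)):\varphi(t_k)=0\}$ (resp. $H^1_\nu([t_k,\infty))$).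
   Formalization: Regularity additionally requires that every edge leaving a vertex of V_k (k<N) ends in V_{k+1}; the listed conditions let edges skip levels, and then #V_k can differ from m_k and the claim fails (e.g. b=(2,2,1) with only three half-lines). *)

theory Defs
  imports "HOL-Analysis.Analysis" "Graph_Theory.Graph_Theory"
begin

section \<open>Complex Hilbert spaces and (unbounded) operators\<close>

record 'h hspace =
  hcarrier :: "'h set"
  hadd :: "'h \<Rightarrow> 'h \<Rightarrow> 'h"
  hscale :: "complex \<Rightarrow> 'h \<Rightarrow> 'h"
  hinner :: "'h \<Rightarrow> 'h \<Rightarrow> complex"

text \<open>An operator is given by its ambient space together with its graph.\<close>

type_synonym 'h hoperator = "'h hspace \<times> ('h \<times> 'h) set"

definition unitary :: "'h hspace \<Rightarrow> 'k hspace \<Rightarrow> ('h \<Rightarrow> 'k) \<Rightarrow> bool" where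
  "unitary H K U \<longleftrightarrow>
     bij_betw U (hcarrier H) (hcarrier K) \<and>
     (\<forall>x\<in>hcarrier H. \<forall>y\<in>hcarrier H. U (hadd H x y) = hadd K (U x) (U y)) \<and>
     (\<forall>c. \<forall>x\<in>hcarrier H. U (hscale H c x) = hscale K c (U x)) \<and>
     (\<forall>x\<in>hcarrier H. \<forall>y\<in>hcarrier H. hinner K (U x) (U y) = hinner H x y)"

text \<open>The graph of \<open>U A U\<inverse>\<close> is the image of the graph of \<open>A\<close> under \<open>(x, y) \<mapsto> (U x, U y)\<close>;
  this includes the equality of the operator domains.\<close>

definition unitarily_equivalent :: "'h hoperator \<Rightarrow> 'k hoperator \<Rightarrow> bool" where
  "unitarily_equivalent A B \<longleftrightarrow>
     (\<exists>U. unitary (fst A) (fst B) U \<and> snd B = map_prod U U ` snd A)"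

definition op_sum :: "'h hoperator \<Rightarrow> 'k hoperator \<Rightarrow> ('h \<times> 'k) hoperator" where
  "op_sum A B =
     (let H = fst A; K = fst B in
       (\<lparr>hcarrier = hcarrier H \<times> hcarrier K,
         hadd = (\<lambda>x y. (hadd H (fst x) (fst y), hadd K (snd x) (snd y))),
         hscale = (\<lambda>c x. (hscale H c (fst x), hscale K c (snd x))),
         hinner = (\<lambda>x y. hinner H (fst x) (fst y) + hinner K (snd x) (snd y))\<rparr>,
        {(x, y). (fst x, fst y) \<in> snd A \<and> (snd x, snd y) \<in> snd B}))"

text \<open>Orthogonal sum of a family over a finite index set. For \<open>I = {}\<close> this is the operator
  on the zero space.\<close>

definition op_dsum :: "'i set \<Rightarrow> ('i \<Rightarrow> 'h hoperator) \<Rightarrow> ('i \<Rightarrow> 'h) hoperator" where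
  "op_dsum I A =
     (let H = (\<lambda>i. fst (A i)) in
       (\<lparr>hcarrier = (\<Pi>\<^sub>E i\<in>I. hcarrier (H i)),
         hadd = (\<lambda>x y. \<lambda>i\<in>I. hadd (H i) (x i) (y i)),
         hscale = (\<lambda>c x. \<lambda>i\<in>I. hscale (H i) c (x i)),
         hinner = (\<lambda>x y. \<Sum>i\<in>I. hinner (H i) (x i) (y i))\<rparr>,
        {(x, y). x \<in> extensional I \<and> y \<in> extensional I \<and> (\<forall>i\<in>I. (x i, y i) \<in> snd (A i))}))"

definition op_copies :: "'h hoperator \<Rightarrow> nat \<Rightarrow> (nat \<Rightarrow> 'h) hoperator" where
  "op_copies A r = op_dsum {..<r} (\<lambda>_. A)"


section \<open>Lebesgue spaces and operators associated with forms\<close>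

definition L2_functions :: "'a measure \<Rightarrow> ('a \<Rightarrow> complex) set" where
  "L2_functions M = {f \<in> borel_measurable M. integrable M (\<lambda>x. (cmod (f x))\<^sup>2)}"

definition ae_class :: "'a measure \<Rightarrow> ('a \<Rightarrow> complex) \<Rightarrow> ('a \<Rightarrow> complex) set" where
  "ae_class M f = {g \<in> borel_measurable M. AE x in M. g x = f x}"

definition ae_rep :: "('a \<Rightarrow> complex) set \<Rightarrow> 'a \<Rightarrow> complex" where
  "ae_rep X = (SOME f. f \<in> X)"

text \<open>The elements of \<open>L2 M\<close> are classes modulo equality almost everywhere. The operations
  do not depend on the representatives chosen by \<^const>\<open>ae_rep\<close>.\<close>

definition L2 :: "'a measure \<Rightarrow> ('a \<Rightarrow> complex) set hspace" where
  "L2 M =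
     \<lparr>hcarrier = ae_class M ` L2_functions M,
      hadd = (\<lambda>X Y. ae_class M (\<lambda>x. ae_rep X x + ae_rep Y x)),
      hscale = (\<lambda>c X. ae_class M (\<lambda>x. c * ae_rep X x)),
      hinner = (\<lambda>X Y. LINT x|M. ae_rep X x * cnj (ae_rep Y x))\<rparr>"

text \<open>The operator associated with a form \<open>a\<close> with domain \<open>D\<close>: \<open>u\<close> is in its domain and is
  mapped to \<open>w\<close> iff \<open>u\<close> lies in the form domain and \<open>a(u,h) = \<langle>w,h\<rangle>\<close> for all \<open>h\<close> in the form
  domain. The form is given on functions.\<close>

definition form_operator ::
  "'a measure \<Rightarrow> ('a \<Rightarrow> complex) set \<Rightarrow> (('a \<Rightarrow> complex) \<Rightarrow> ('a \<Rightarrow> complex) \<Rightarrow> complex)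
     \<Rightarrow> ('a \<Rightarrow> complex) set hoperator" where
  "form_operator M D a =
     (L2 M,
      {(ae_class M u, ae_class M w) | u w.
         u \<in> D \<and> w \<in> L2_functions M \<and> (\<forall>h\<in>D. a u h = (LINT x|M. w x * cnj (h x)))})"


section \<open>Weak derivatives and weighted Sobolev spaces on intervals\<close>

definition test_functions :: "real set \<Rightarrow> (real \<Rightarrow> real) set" where
  "test_functions S =
     {\<phi>. (\<forall>n x. (deriv ^^ n) \<phi> differentiable (at x)) \<and>
         compact (closure {x. \<phi> x \<noteq> 0}) \<and> closure {x. \<phi> x \<noteq> 0} \<subseteq> S}"

definition locally_integrable_on :: "(real \<Rightarrow> complex) \<Rightarrow> real set \<Rightarrow> bool" where
  "locally_integrable_on f S \<longleftrightarrow> (\<forall>K. compact K \<and> K \<subseteq> S \<longrightarrow> set_integrable lborel K f)"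

definition has_weak_derivative ::
  "real set \<Rightarrow> (real \<Rightarrow> complex) \<Rightarrow> (real \<Rightarrow> complex) \<Rightarrow> bool" where
  "has_weak_derivative S f g \<longleftrightarrow>
     locally_integrable_on f S \<and> locally_integrable_on g S \<and>
     (\<forall>\<phi>\<in>test_functions S.
        (LINT t:S|lborel. deriv \<phi> t *\<^sub>R f t) = - (LINT t:S|lborel. \<phi> t *\<^sub>R g t))"

definition weak_deriv :: "real set \<Rightarrow> (real \<Rightarrow> complex) \<Rightarrow> real \<Rightarrow> complex" where
  "weak_deriv S f = (SOME g. has_weak_derivative S f g)"

definition weighted :: "real set \<Rightarrow> (real \<Rightarrow> real) \<Rightarrow> real measure" where
  "weighted I w = density (restrict_space lborel I) (\<lambda>t. ennreal (w t))"

definition H1 :: "real set \<Rightarrow> (real \<Rightarrow> real) \<Rightarrow> (real \<Rightarrow> complex) set" where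
  "H1 I w =
     {f \<in> L2_functions (weighted I w).
        \<exists>g\<in>L2_functions (weighted I w). has_weak_derivative (interior I) f g}"

definition gauss :: "real \<Rightarrow> real" where
  "gauss t = 2 / sqrt pi * exp (- t\<^sup>2)"


section \<open>Rooted metric trees with half-lines\<close>

text \<open>The arcs of the digraph are the edges of the compact tree, oriented away from the root;
  \<open>half_lines v\<close> is the number of half-lines attached at \<open>v\<close> (only relevant for leaves).\<close>

record ('v, 'e) metric_tree =
  tree_graph :: "('v, 'e) pre_digraph"
  tree_root :: 'v
  edge_length :: "'e \<Rightarrow> real"
  half_lines :: "'v \<Rightarrow> nat"

definition leaves :: "('v, 'e) metric_tree \<Rightarrow> 'v set" where
  "leaves T =
     {v \<in> verts (tree_graph T).
        v \<noteq> tree_root T \<and> in_degree (tree_graph T) v + out_degree (tree_graph T) v = 1}"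

text \<open>A finite digraph in which every vertex is reached from the root by exactly one directed
  walk is a tree oriented away from the root.\<close>

definition rooted_metric_tree :: "('v, 'e) metric_tree \<Rightarrow> bool" where
  "rooted_metric_tree T \<longleftrightarrow>
     fin_digraph (tree_graph T) \<and>
     tree_root T \<in> verts (tree_graph T) \<and>
     (\<forall>v\<in>verts (tree_graph T). \<exists>!p. pre_digraph.awalk (tree_graph T) (tree_root T) p v) \<and>
     (\<forall>a\<in>arcs (tree_graph T). 0 < edge_length T a) \<and>
     leaves T \<noteq> {} \<and>
     (\<forall>v\<in>leaves T. 0 < half_lines T v)"

definition depth :: "('v, 'e) metric_tree \<Rightarrow> 'v \<Rightarrow> real" where
  "depth T v =
     sum_list (map (edge_length T) (THE p. pre_digraph.awalk (tree_graph T) (tree_root T) p v))"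

datatype ('v, 'e) tree_edge = Bounded 'e | Half_Line 'v nat

definition tree_edges :: "('v, 'e) metric_tree \<Rightarrow> ('v, 'e) tree_edge set" where
  "tree_edges T =
     Bounded ` arcs (tree_graph T) \<union> {Half_Line v i | v i. v \<in> leaves T \<and> i < half_lines T v}"

fun edge_start :: "('v, 'e) metric_tree \<Rightarrow> ('v, 'e) tree_edge \<Rightarrow> 'v" where
  "edge_start T (Bounded a) = tail (tree_graph T) a"
| "edge_start T (Half_Line v i) = v"

text \<open>The arc length parameter on an edge is normalised so that it equals the distance to the
  root.\<close>

fun edge_interval :: "('v, 'e) metric_tree \<Rightarrow> ('v, 'e) tree_edge \<Rightarrow> real set" where
  "edge_interval T (Bounded a) =
     {depth T (tail (tree_graph T) a) .. depth T (tail (tree_graph T) a) + edge_length T a}"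
| "edge_interval T (Half_Line v i) = {depth T v ..}"

datatype ('v, 'e) tree_point = Vertex 'v | Inner "('v, 'e) tree_edge" real

definition tree_points :: "('v, 'e) metric_tree \<Rightarrow> ('v, 'e) tree_point set" where
  "tree_points T =
     Vertex ` verts (tree_graph T) \<union>
     {Inner e s | e s. e \<in> tree_edges T \<and> s \<in> interior (edge_interval T e)}"

fun dist_root :: "('v, 'e) metric_tree \<Rightarrow> ('v, 'e) tree_point \<Rightarrow> real" where
  "dist_root T (Vertex v) = depth T v"
| "dist_root T (Inner e s) = s"

text \<open>The parametrisation of the closed edge, identifying its ends with vertices.\<close>

fun edge_point :: "('v, 'e) metric_tree \<Rightarrow> ('v, 'e) tree_edge \<Rightarrow> real \<Rightarrow> ('v, 'e) tree_point" where
  "edge_point T (Bounded a) s =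
     (if s = depth T (tail (tree_graph T) a) then Vertex (tail (tree_graph T) a)
      else if s = depth T (tail (tree_graph T) a) + edge_length T a
        then Vertex (head (tree_graph T) a)
      else Inner (Bounded a) s)"
| "edge_point T (Half_Line v i) s =
     (if s = depth T v then Vertex v else Inner (Half_Line v i) s)"

definition edge_function ::
  "('v, 'e) metric_tree \<Rightarrow> (('v, 'e) tree_point \<Rightarrow> complex) \<Rightarrow> ('v, 'e) tree_edge \<Rightarrow> real \<Rightarrow> complex"
where
  "edge_function T f e = (\<lambda>s. f (edge_point T e s))"

definition branching_function :: "('v, 'e) metric_tree \<Rightarrow> real \<Rightarrow> nat" where
  "branching_function T s = card {x \<in> tree_points T. dist_root T x = s}"

text \<open>The measure \<open>\<mu>(dx) = G(|x|) dx\<close> on the Borel sets of the tree. As the tree is glued from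
  finitely many closed edges, a set is Borel iff its trace on every edge is.\<close>

definition tree_measure :: "('v, 'e) metric_tree \<Rightarrow> ('v, 'e) tree_point measure" where
  "tree_measure T =
     measure_of (tree_points T)
       {A. A \<subseteq> tree_points T \<and>
           (\<forall>e\<in>tree_edges T. {s \<in> edge_interval T e. edge_point T e s \<in> A} \<in> sets borel)}
       (\<lambda>A. \<Sum>e\<in>tree_edges T.
          emeasure (weighted (edge_interval T e) gauss)
            {s \<in> edge_interval T e. edge_point T e s \<in> A})"

text \<open>Continuity on the tree: in the topology of the tree, a function is continuous iff its
  composition with the parametrisation of every closed edge is.\<close>

definition H1_tree :: "('v, 'e) metric_tree \<Rightarrow> (('v, 'e) tree_point \<Rightarrow> complex) set" where
  "H1_tree T =
     {f. \<forall>e\<in>tree_edges T.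
           continuous_on (edge_interval T e) (edge_function T f e) \<and>
           edge_function T f e \<in> H1 (edge_interval T e) gauss}"

definition H1_0_tree :: "('v, 'e) metric_tree \<Rightarrow> (('v, 'e) tree_point \<Rightarrow> complex) set" where
  "H1_0_tree T = {f \<in> H1_tree T. f (Vertex (tree_root T)) = 0}"

text \<open>The value at the (finitely many) vertices is irrelevant.\<close>

fun tree_deriv ::
  "('v, 'e) metric_tree \<Rightarrow> (('v, 'e) tree_point \<Rightarrow> complex) \<Rightarrow> ('v, 'e) tree_point \<Rightarrow> complex"
where
  "tree_deriv T f (Vertex v) = 0"
| "tree_deriv T f (Inner e s) = weak_deriv (interior (edge_interval T e)) (edge_function T f e) s"

definition tree_form ::
  "('v, 'e) metric_tree \<Rightarrow> (('v, 'e) tree_point \<Rightarrow> complex) \<Rightarrow> (('v, 'e) tree_point \<Rightarrow> complex)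
     \<Rightarrow> complex" where
  "tree_form T f h = 1/2 * (LINT x|tree_measure T. tree_deriv T f x * cnj (tree_deriv T h x))"

definition OU_Dirichlet ::
  "('v, 'e) metric_tree \<Rightarrow> (('v, 'e) tree_point \<Rightarrow> complex) set hoperator" where
  "OU_Dirichlet T = form_operator (tree_measure T) (H1_0_tree T) (tree_form T)"

definition OU_Neumann ::
  "('v, 'e) metric_tree \<Rightarrow> (('v, 'e) tree_point \<Rightarrow> complex) set hoperator" where
  "OU_Neumann T = form_operator (tree_measure T) (H1_tree T) (tree_form T)"


section \<open>Reduced operators\<close>

definition reduced_weight :: "('v, 'e) metric_tree \<Rightarrow> real \<Rightarrow> real" where
  "reduced_weight T s = real (branching_function T s) * gauss s"

definition reduced_measure :: "('v, 'e) metric_tree \<Rightarrow> real \<Rightarrow> real measure" where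
  "reduced_measure T c = weighted {c..} (reduced_weight T)"

definition reduced_form ::
  "('v, 'e) metric_tree \<Rightarrow> real \<Rightarrow> (real \<Rightarrow> complex) \<Rightarrow> (real \<Rightarrow> complex) \<Rightarrow> complex" where
  "reduced_form T c f h =
     1/2 * (LINT s|reduced_measure T c. weak_deriv {c<..} f s * cnj (weak_deriv {c<..} h s))"

text \<open>The boundary value of an element of \<open>H\<^sup>1\<close> is that of its continuous representative.\<close>

definition H1_0_half_line :: "real \<Rightarrow> (real \<Rightarrow> real) \<Rightarrow> (real \<Rightarrow> complex) set" where
  "H1_0_half_line c w = {f \<in> H1 {c..} w. continuous_on {c..} f \<and> f c = 0}"

definition reduced_Dirichlet ::
  "('v, 'e) metric_tree \<Rightarrow> real \<Rightarrow> (real \<Rightarrow> complex) set hoperator" where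
  "reduced_Dirichlet T c =
     form_operator (reduced_measure T c) (H1_0_half_line c (reduced_weight T)) (reduced_form T c)"

definition reduced_Neumann ::
  "('v, 'e) metric_tree \<Rightarrow> real \<Rightarrow> (real \<Rightarrow> complex) set hoperator" where
  "reduced_Neumann T c =
     form_operator (reduced_measure T c) (H1 {c..} (reduced_weight T)) (reduced_form T c)"


section \<open>Regular trees\<close>

definition level :: "('v, 'e) metric_tree \<Rightarrow> real \<Rightarrow> 'v set" where
  "level T s = {v \<in> verts (tree_graph T). depth T v = s}"

text \<open>The levels are the generations: an edge leaving level \<open>k\<close> ends on level \<open>k + 1\<close>, so that no
  level is skipped. The remaining conditions do not imply this.\<close>

definition regular_tree ::
  "('v, 'e) metric_tree \<Rightarrow> nat \<Rightarrow> (nat \<Rightarrow> real) \<Rightarrow> (nat \<Rightarrow> nat) \<Rightarrow> bool" where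
  "regular_tree T N t b \<longleftrightarrow>
     rooted_metric_tree T \<and>
     t 0 = 0 \<and> (\<forall>k<N. t k < t (Suc k)) \<and> (\<forall>k\<le>N. 0 < b k) \<and>
     verts (tree_graph T) = (\<Union>k\<le>N. level T (t k)) \<and>
     (\<forall>a\<in>arcs (tree_graph T). \<forall>k<N.
        tail (tree_graph T) a \<in> level T (t k) \<longrightarrow> head (tree_graph T) a \<in> level T (t (Suc k))) \<and>
     (\<forall>k\<le>N. \<forall>v\<in>level T (t k). card {e \<in> tree_edges T. edge_start T e = v} = b k) \<and>
     level T (t N) = leaves T"

definition generation_size :: "(nat \<Rightarrow> nat) \<Rightarrow> nat \<Rightarrow> nat" where
  "generation_size b k = (\<Prod>i<k. b i)"

end

theory Submission
  imports Defs
begin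

text \<open>A word \<open>w\<close> with letters \<open>w k < b k\<close>, \<open>k \<le> N\<close>, describes a ray, i.e. a path from the root to infinity,
  and functions on the tree are identified with the families \<open>F w = f \<circ> ray w\<close> of functions on the half-line
  for which \<open>F w s\<close> depends only on the letters \<open>w i\<close> with \<open>t i < s\<close>. In this picture \<open>\<mu>\<close> is the average over all
  words of \<open>\<nu>\<close>. The space of functions on the words has an orthonormal basis consisting of the constant \<open>1\<close>
  and, for each \<open>k\<close> and each prefix \<open>v\<close> of length \<open>k\<close>, the \<open>b k - 1\<close> nontrivial characters of the letter \<open>k\<close>
  supported on the words that extend \<open>v\<close>. Expanding \<open>F\<close> in this basis is the unitary map. The
  coefficients of generation \<open>k\<close> vanish on \<open>[0, t k]\<close>, since there \<open>F\<close> does not depend on the letter \<open>k\<close>; this is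
  where the Dirichlet conditions at \<open>t k\<close> come from, and continuity of \<open>f\<close> at the vertices is equivalent to
  continuity of the coefficients. The forms correspond because weak derivatives on the intervals are
  derivatives in the sense of the fundamental theorem of calculus and can therefore be glued.\<close>

section \<open>Operators associated with abstract forms\<close>

text \<open>Only forms are ever compared: a form operator is determined by its Hilbert space, its
  form domain and the values of its form, so a unitary map that matches these three matches the
  graphs. The Kirchhoff conditions, being natural, never have to be written down. The uniform
  average over words is the right measure because of regularity: an edge of generation
  \<open>k\<close> lies on the fraction \<open>1 / generation_size b (Suc k)\<close> of all rays,
  while the weight of \<nu> over it is \<open>generation_size b (Suc k)\<close> times the Gaussian,
  and the two factors cancel. Two features of the definitions shape the rest. Weak derivatives are
  chosen by \<open>SOME\<close>, hence known only almost everywhere and arbitrary at the end points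
  of an interval; so their uniqueness has to be proved, and this takes smooth cut-off functions. And
  forms live on functions while operators live on classes: \<open>H1_tree\<close> consists of
  continuous functions, the Neumann domain \<open>H1 {0..}\<close> does not, so surjectivity on form
  domains holds only up to a change of representative.\<close>

definition abstract_form_operator ::
  "'h hspace \<Rightarrow> 'h set \<Rightarrow> ('h \<Rightarrow> 'h \<Rightarrow> complex) \<Rightarrow> 'h hoperator" where
  "abstract_form_operator H Q q =
     (H, {(u, w). u \<in> Q \<and> w \<in> hcarrier H \<and> (\<forall>h\<in>Q. q u h = hinner H w h)})"

text \<open>The graph is expressed through the inner product, the form domain and the form alone, so
  it is transported together with them.\<close>

lemma unitarily_equivalent_abstract_form_operator:
  assumes U: "unitary H K U" and Q: "Q \<subseteq> hcarrier H" and UQ: "U ` Q = P"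
    and pq: "\<And>x y. x \<in> Q \<Longrightarrow> y \<in> Q \<Longrightarrow> p (U x) (U y) = q x y"
  shows "unitarily_equivalent (abstract_form_operator H Q q) (abstract_form_operator K P p)"
proof -
  have bij: "bij_betw U (hcarrier H) (hcarrier K)"
    and inner: "\<And>x y. x \<in> hcarrier H \<Longrightarrow> y \<in> hcarrier H \<Longrightarrow> hinner K (U x) (U y) = hinner H x y"
    using U by (auto simp: unitary_def)
  have "(x, y) \<in> snd (abstract_form_operator K P p) \<longleftrightarrow>
        (x, y) \<in> map_prod U U ` snd (abstract_form_operator H Q q)" for x y
  proof
    assume "(x, y) \<in> snd (abstract_form_operator K P p)"
    then have x: "x \<in> P" and y: "y \<in> hcarrier K" and eq: "\<And>h. h \<in> P \<Longrightarrow> p x h = hinner K y h"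
      by (auto simp: abstract_form_operator_def)
    from x UQ obtain u where u: "u \<in> Q" "x = U u" by blast
    from y bij obtain w where w: "w \<in> hcarrier H" "y = U w" by (auto simp: bij_betw_def)
    have "q u h = hinner H w h" if "h \<in> Q" for h
      using eq[of "U h"] pq[OF u(1) that] inner[OF w(1), of h] that Q UQ u w by auto
    then show "(x, y) \<in> map_prod U U ` snd (abstract_form_operator H Q q)"
      using u w by (auto simp: abstract_form_operator_def intro!: image_eqI[where x="(u, w)"])
  next
    assume "(x, y) \<in> map_prod U U ` snd (abstract_form_operator H Q q)"
    then obtain u w where uw: "x = U u" "y = U w" "u \<in> Q" "w \<in> hcarrier H"
      "\<And>h. h \<in> Q \<Longrightarrow> q u h = hinner H w h"
      by (auto simp: abstract_form_operator_def)
    have "p x h = hinner K y h" if h: "h \<in> P" for h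
    proof -
      obtain h' where h': "h' \<in> Q" "h = U h'" using h UQ by blast
      then show ?thesis using pq[OF uw(3) h'(1)] uw inner[OF uw(4), of h'] Q by auto
    qed
    then show "(x, y) \<in> snd (abstract_form_operator K P p)"
      using uw UQ bij by (auto simp: abstract_form_operator_def bij_betw_def)
  qed
  then have "snd (abstract_form_operator K P p) =
      map_prod U U ` snd (abstract_form_operator H Q q)" by auto
  then show ?thesis
    using U unfolding unitarily_equivalent_def by (auto simp: abstract_form_operator_def)
qed

text \<open>Acts as the zero vector in the only respects that matter below: inserted into the other
  components of a test vector, it isolates the equation of a single summand.\<close>

definition form_null :: "'h hspace \<Rightarrow> 'h set \<Rightarrow> ('h \<Rightarrow> 'h \<Rightarrow> complex) \<Rightarrow> 'h \<Rightarrow> bool" where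
  "form_null H Q q z \<longleftrightarrow>
     z \<in> Q \<and> (\<forall>u\<in>Q. q u z = 0) \<and> (\<forall>w\<in>hcarrier H. hinner H w z = 0)"

text \<open>The sum is again of abstract form type. The nontrivial inclusion splits the joint
  equation by testing with \<open>(h, z')\<close> and with \<open>(z, h)\<close>.\<close>

lemma op_sum_abstract_form_operator:
  assumes z: "form_null H Q q z" and z': "form_null H' Q' q' z'"
  shows "op_sum (abstract_form_operator H Q q) (abstract_form_operator H' Q' q') =
    abstract_form_operator
      (fst (op_sum (abstract_form_operator H Q q) (abstract_form_operator H' Q' q')))
      (Q \<times> Q') (\<lambda>x y. q (fst x) (fst y) + q' (snd x) (snd y))"
    (is "?S = ?F")
proof -
  have "(x, y) \<in> snd ?S \<longleftrightarrow> (x, y) \<in> snd ?F" for x y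
  proof
    assume "(x, y) \<in> snd ?F"
    then have x: "fst x \<in> Q" "snd x \<in> Q'" and y: "fst y \<in> hcarrier H" "snd y \<in> hcarrier H'"
      and eq: "\<And>h h'. h \<in> Q \<Longrightarrow> h' \<in> Q' \<Longrightarrow>
        q (fst x) h + q' (snd x) h' = hinner H (fst y) h + hinner H' (snd y) h'"
      by (auto simp: abstract_form_operator_def op_sum_def Let_def)
    have "q (fst x) h = hinner H (fst y) h" if "h \<in> Q" for h
      using eq[OF that, of z'] z' x y by (auto simp: form_null_def)
    moreover have "q' (snd x) h = hinner H' (snd y) h" if "h \<in> Q'" for h
      using eq[OF _ that, of z] z x y by (auto simp: form_null_def)
    ultimately show "(x, y) \<in> snd ?S"
      using x y by (auto simp: abstract_form_operator_def op_sum_def Let_def)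
  qed (auto simp: abstract_form_operator_def op_sum_def Let_def mem_Times_iff)
  then have "snd ?S = snd ?F" by auto
  then show ?thesis
    by (intro prod_eqI) (simp_all add: abstract_form_operator_def)
qed

text \<open>As for two summands: the test family that is \<open>h\<close> at position
  \<open>i\<close> and \<open>z j\<close> elsewhere turns the summed equation into the equation of
  component \<open>i\<close>.\<close>

lemma op_dsum_abstract_form_operator:
  assumes I: "finite I" and z: "\<And>i. i \<in> I \<Longrightarrow> form_null (H i) (Q i) (q i) (z i)"
  shows "op_dsum I (\<lambda>i. abstract_form_operator (H i) (Q i) (q i)) =
    abstract_form_operator (fst (op_dsum I (\<lambda>i. abstract_form_operator (H i) (Q i) (q i))))
      (\<Pi>\<^sub>E i\<in>I. Q i) (\<lambda>x y. \<Sum>i\<in>I. q i (x i) (y i))"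
    (is "?S = ?F")
proof -
  have "(x, y) \<in> snd ?S \<longleftrightarrow> (x, y) \<in> snd ?F" for x y
  proof
    assume "(x, y) \<in> snd ?F"
    then have x: "x \<in> (\<Pi>\<^sub>E i\<in>I. Q i)" and y: "y \<in> (\<Pi>\<^sub>E i\<in>I. hcarrier (H i))"
      and eq: "\<And>h. h \<in> (\<Pi>\<^sub>E i\<in>I. Q i) \<Longrightarrow>
        (\<Sum>i\<in>I. q i (x i) (h i)) = (\<Sum>i\<in>I. hinner (H i) (y i) (h i))"
      by (auto simp: abstract_form_operator_def op_dsum_def Let_def)
    have "q i (x i) h = hinner (H i) (y i) h" if i: "i \<in> I" and h: "h \<in> Q i" for i h
    proof -
      let ?h = "\<lambda>j\<in>I. if j = i then h else z j"
      have "(\<Sum>j\<in>I. q j (x j) (?h j)) = q i (x i) h"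
        using I i x z by (subst sum.remove[OF I i]) (auto intro!: sum.neutral simp: form_null_def PiE_iff)
      moreover have "(\<Sum>j\<in>I. hinner (H j) (y j) (?h j)) = hinner (H i) (y i) h"
        using I i y z by (subst sum.remove[OF I i]) (auto intro!: sum.neutral simp: form_null_def PiE_iff)
      moreover have "?h \<in> (\<Pi>\<^sub>E i\<in>I. Q i)"
        using h z by (auto simp: form_null_def)
      ultimately show ?thesis using eq[of ?h] by simp
    qed
    then show "(x, y) \<in> snd ?S"
      using x y by (auto simp: abstract_form_operator_def op_dsum_def Let_def PiE_iff)
  qed (auto simp: abstract_form_operator_def op_dsum_def Let_def PiE_iff intro!: sum.cong)
  then have "snd ?S = snd ?F" by auto
  then show ?thesis
    by (intro prod_eqI) (simp_all add: abstract_form_operator_def)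
qed

text \<open>Makes the previous two lemmas applicable to nested sums, i.e. to copies inside a sum
  over generations inside a binary sum.\<close>

lemma form_null_op_dsum:
  assumes I: "finite I" and z: "\<And>i. i \<in> I \<Longrightarrow> form_null (H i) (Q i) (q i) (z i)"
  shows "form_null (fst (op_dsum I (\<lambda>i. abstract_form_operator (H i) (Q i) (q i))))
      (\<Pi>\<^sub>E i\<in>I. Q i) (\<lambda>x y. \<Sum>i\<in>I. q i (x i) (y i)) (\<lambda>i\<in>I. z i)"
  using z by (auto simp: form_null_def op_dsum_def abstract_form_operator_def Let_def PiE_iff)


section \<open>Square-integrable functions\<close>

lemma borel_measurable_cnj [measurable]: "cnj \<in> borel_measurable borel"
  by (intro borel_measurable_continuous_onI continuous_intros)

lemma L2_functions_measurable: "f \<in> L2_functions M \<Longrightarrow> f \<in> borel_measurable M"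
  by (simp add: L2_functions_def)

lemma L2_functions_0: "(\<lambda>x. 0) \<in> L2_functions M"
  by (simp add: L2_functions_def)

lemma L2_functions_scale:
  assumes "f \<in> L2_functions M"
  shows "(\<lambda>x. c * f x) \<in> L2_functions M"
  using assms by (auto simp: L2_functions_def norm_mult power_mult_distrib)

lemma L2_functions_add:
  assumes f: "f \<in> L2_functions M" and g: "g \<in> L2_functions M"
  shows "(\<lambda>x. f x + g x) \<in> L2_functions M"
proof -
  have [measurable]: "f \<in> borel_measurable M" "g \<in> borel_measurable M"
    using f g by (auto simp: L2_functions_def)
  have "integrable M (\<lambda>x. 2 * (cmod (f x))\<^sup>2 + 2 * (cmod (g x))\<^sup>2)"
    using f g by (auto simp: L2_functions_def)
  then have "integrable M (\<lambda>x. (cmod (f x + g x))\<^sup>2)"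
  proof (rule Bochner_Integration.integrable_bound)
    have "(cmod (f x + g x))\<^sup>2 \<le> 2 * (cmod (f x))\<^sup>2 + 2 * (cmod (g x))\<^sup>2" for x
    proof -
      have "(cmod (f x + g x))\<^sup>2 \<le> (cmod (f x) + cmod (g x))\<^sup>2"
        by (intro power_mono norm_triangle_ineq) auto
      also have "\<dots> \<le> 2 * (cmod (f x))\<^sup>2 + 2 * (cmod (g x))\<^sup>2"
        using sum_squares_bound[of "cmod (f x)" "cmod (g x)"] by (simp add: power2_sum)
      finally show ?thesis .
    qed
    then show "AE x in M. norm ((cmod (f x + g x))\<^sup>2) \<le> norm (2 * (cmod (f x))\<^sup>2 + 2 * (cmod (g x))\<^sup>2)"
      by (intro AE_I2) (simp add: abs_of_nonneg)
  qed measurable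
  then show ?thesis by (simp add: L2_functions_def)
qed

lemma L2_functions_sum:
  assumes "\<And>i. i \<in> I \<Longrightarrow> f i \<in> L2_functions M"
  shows "(\<lambda>x. \<Sum>i\<in>I. f i x) \<in> L2_functions M"
  using assms
  by (induction I rule: infinite_finite_induct) (auto simp: L2_functions_0 intro: L2_functions_add)

lemma L2_functions_mult_integrable:
  assumes f: "f \<in> L2_functions M" and g: "g \<in> L2_functions M"
  shows "integrable M (\<lambda>x. f x * cnj (g x))"
proof -
  have [measurable]: "f \<in> borel_measurable M" "g \<in> borel_measurable M"
    using f g by (auto simp: L2_functions_def)
  have "integrable M (\<lambda>x. (cmod (f x))\<^sup>2 + (cmod (g x))\<^sup>2)"
    using f g by (auto simp: L2_functions_def)
  then show ?thesis
  proof (rule Bochner_Integration.integrable_bound)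
    have "cmod (f x) * cmod (g x) \<le> (cmod (f x))\<^sup>2 + (cmod (g x))\<^sup>2" for x
      using sum_squares_bound[of "cmod (f x)" "cmod (g x)"]
        mult_nonneg_nonneg[OF norm_ge_zero[of "f x"] norm_ge_zero[of "g x"]]
      by linarith
    then show "AE x in M. norm (f x * cnj (g x)) \<le> norm ((cmod (f x))\<^sup>2 + (cmod (g x))\<^sup>2)"
      by (intro AE_I2) (simp add: norm_mult)
  qed measurable
qed

lemma L2_functions_cong_AE:
  assumes "f \<in> L2_functions M" "g \<in> borel_measurable M" "AE x in M. f x = g x"
  shows "g \<in> L2_functions M"
proof -
  have [measurable]: "f \<in> borel_measurable M" "g \<in> borel_measurable M"
    using assms by (auto simp: L2_functions_def)
  have "integrable M (\<lambda>x. (cmod (f x))\<^sup>2)" using assms(1) by (simp add: L2_functions_def)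
  moreover have "AE x in M. (cmod (f x))\<^sup>2 = (cmod (g x))\<^sup>2" using assms(3) by eventually_elim simp
  ultimately have "integrable M (\<lambda>x. (cmod (g x))\<^sup>2)"
    by (subst integrable_cong_AE[symmetric, where f="\<lambda>x. (cmod (f x))\<^sup>2"]) measurable
  then show ?thesis using assms(2) by (simp add: L2_functions_def)
qed

section \<open>Classes modulo equality almost everywhere\<close>

lemma ae_class_eq_iff:
  assumes "f \<in> borel_measurable M" "g \<in> borel_measurable M"
  shows "ae_class M f = ae_class M g \<longleftrightarrow> (AE x in M. f x = g x)"
proof
  assume "ae_class M f = ae_class M g"
  then have "f \<in> ae_class M g" using assms by (auto simp: ae_class_def)
  then show "AE x in M. f x = g x" by (simp add: ae_class_def)
next
  assume fg: "AE x in M. f x = g x"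
  have "(AE x in M. h x = f x) \<longleftrightarrow> (AE x in M. h x = g x)" for h
  proof
    show "AE x in M. h x = g x" if "AE x in M. h x = f x" using that fg by eventually_elim simp
    show "AE x in M. h x = f x" if "AE x in M. h x = g x" using that fg by eventually_elim simp
  qed
  then show "ae_class M f = ae_class M g" by (auto simp: ae_class_def)
qed

lemma ae_rep_ae_class:
  assumes "f \<in> borel_measurable M"
  shows "ae_rep (ae_class M f) \<in> borel_measurable M" "AE x in M. ae_rep (ae_class M f) x = f x"
proof -
  have "f \<in> ae_class M f" using assms by (auto simp: ae_class_def)
  then have "ae_rep (ae_class M f) \<in> ae_class M f" unfolding ae_rep_def by (metis someI)
  then show "ae_rep (ae_class M f) \<in> borel_measurable M" "AE x in M. ae_rep (ae_class M f) x = f x"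
    by (auto simp: ae_class_def)
qed

lemma ae_rep_L2_functions:
  assumes "f \<in> L2_functions M"
  shows "ae_rep (ae_class M f) \<in> L2_functions M"
  using ae_rep_ae_class[OF L2_functions_measurable[OF assms]]
  by (intro L2_functions_cong_AE[OF assms]) auto

lemma hinner_L2:
  assumes "f \<in> L2_functions M" "g \<in> L2_functions M"
  shows "hinner (L2 M) (ae_class M f) (ae_class M g) = (LINT x|M. f x * cnj (g x))"
proof -
  note f = L2_functions_measurable[OF assms(1)] and g = L2_functions_measurable[OF assms(2)]
  note [measurable] = f g ae_rep_ae_class(1)[OF f] ae_rep_ae_class(1)[OF g]
  have "AE x in M. ae_rep (ae_class M f) x * cnj (ae_rep (ae_class M g) x) = f x * cnj (g x)"
    using ae_rep_ae_class(2)[OF f] ae_rep_ae_class(2)[OF g] by eventually_elim simp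
  moreover have "(\<lambda>x. ae_rep (ae_class M f) x * cnj (ae_rep (ae_class M g) x)) \<in> borel_measurable M"
    "(\<lambda>x. f x * cnj (g x)) \<in> borel_measurable M" by measurable
  ultimately show ?thesis
    unfolding L2_def by (simp, intro integral_cong_AE)
qed

lemma hadd_L2:
  assumes "f \<in> borel_measurable M" "g \<in> borel_measurable M"
  shows "hadd (L2 M) (ae_class M f) (ae_class M g) = ae_class M (\<lambda>x. f x + g x)"
proof -
  note [measurable] = assms ae_rep_ae_class(1)[OF assms(1)] ae_rep_ae_class(1)[OF assms(2)]
  have "(\<lambda>x. ae_rep (ae_class M f) x + ae_rep (ae_class M g) x) \<in> borel_measurable M"
    "(\<lambda>x. f x + g x) \<in> borel_measurable M" by measurable
  moreover have "AE x in M. ae_rep (ae_class M f) x + ae_rep (ae_class M g) x = f x + g x"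
    using ae_rep_ae_class(2)[OF assms(1)] ae_rep_ae_class(2)[OF assms(2)] by eventually_elim simp
  ultimately show ?thesis
    unfolding L2_def by (simp add: ae_class_eq_iff)
qed

lemma hscale_L2:
  assumes "f \<in> borel_measurable M"
  shows "hscale (L2 M) c (ae_class M f) = ae_class M (\<lambda>x. c * f x)"
proof -
  note [measurable] = assms ae_rep_ae_class(1)[OF assms(1)]
  have "(\<lambda>x. c * ae_rep (ae_class M f) x) \<in> borel_measurable M"
    "(\<lambda>x. c * f x) \<in> borel_measurable M" by measurable
  moreover have "AE x in M. c * ae_rep (ae_class M f) x = c * f x"
    using ae_rep_ae_class(2)[OF assms(1)] by eventually_elim simp
  ultimately show ?thesis
    unfolding L2_def by (simp add: ae_class_eq_iff)
qed

lemma hcarrier_L2: "hcarrier (L2 M) = ae_class M ` L2_functions M"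
  by (simp add: L2_def)

text \<open>The middle clause lets a form on functions descend to classes, which is not automatic
  for forms that pick weak derivatives by \<open>SOME\<close>. The last two clauses make the class
  of 0 a \<open>form_null\<close> vector.\<close>

definition ae_form ::
  "'a measure \<Rightarrow> ('a \<Rightarrow> complex) set \<Rightarrow> (('a \<Rightarrow> complex) \<Rightarrow> ('a \<Rightarrow> complex) \<Rightarrow> complex) \<Rightarrow> bool"
where
  "ae_form M D a \<longleftrightarrow> D \<subseteq> L2_functions M \<and>
     (\<forall>u\<in>D. \<forall>u'\<in>D. \<forall>h\<in>D. \<forall>h'\<in>D.
        (AE x in M. u x = u' x) \<longrightarrow> (AE x in M. h x = h' x) \<longrightarrow> a u h = a u' h') \<and>
     (\<lambda>x. 0) \<in> D \<and> (\<forall>u\<in>D. a u (\<lambda>x. 0) = 0)"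

text \<open>The representative is chosen inside \<open>D\<close>; \<open>ae_rep\<close> could return
  a function outside \<open>D\<close>, for instance a discontinuous one.\<close>

definition class_form ::
  "'a measure \<Rightarrow> ('a \<Rightarrow> complex) set \<Rightarrow> (('a \<Rightarrow> complex) \<Rightarrow> ('a \<Rightarrow> complex) \<Rightarrow> complex)
     \<Rightarrow> ('a \<Rightarrow> complex) set \<Rightarrow> ('a \<Rightarrow> complex) set \<Rightarrow> complex"
where
  "class_form M D a X Y =
     a (SOME u. u \<in> D \<and> ae_class M u = X) (SOME u. u \<in> D \<and> ae_class M u = Y)"

lemma class_form_eq:
  assumes a: "ae_form M D a" and u: "u \<in> D" and h: "h \<in> D"
  shows "class_form M D a (ae_class M u) (ae_class M h) = a u h"
proof -
  let ?r = "\<lambda>u. SOME u'. u' \<in> D \<and> ae_class M u' = ae_class M u"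
  have r: "?r v \<in> D \<and> (AE x in M. ?r v x = v x)" if v: "v \<in> D" for v
  proof -
    have *: "?r v \<in> D \<and> ae_class M (?r v) = ae_class M v"
      by (rule someI[where x=v]) (use v in auto)
    then have "?r v \<in> borel_measurable M" "v \<in> borel_measurable M"
      using a v by (auto simp: ae_form_def L2_functions_def)
    with * show ?thesis using ae_class_eq_iff by blast
  qed
  from a r[OF u] r[OF h] u h show ?thesis
    unfolding class_form_def ae_form_def by blast
qed

lemma form_operator_eq_abstract:
  assumes a: "ae_form M D a"
  shows "form_operator M D a =
    abstract_form_operator (L2 M) (ae_class M ` D) (class_form M D a)"
proof -
  have DL: "D \<subseteq> L2_functions M" using a by (simp add: ae_form_def)
  have eq: "(\<forall>h\<in>ae_class M ` D. class_form M D a (ae_class M u) h = hinner (L2 M) (ae_class M w) h) \<longleftrightarrow>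
      (\<forall>h\<in>D. a u h = (LINT x|M. w x * cnj (h x)))" if "u \<in> D" "w \<in> L2_functions M" for u w
  proof -
    have "class_form M D a (ae_class M u) (ae_class M h) = hinner (L2 M) (ae_class M w) (ae_class M h)
        \<longleftrightarrow> a u h = (LINT x|M. w x * cnj (h x))" if "h \<in> D" for h
      using that DL \<open>u \<in> D\<close> \<open>w \<in> L2_functions M\<close>
      by (subst class_form_eq[OF a]) (auto simp: hinner_L2)
    then show ?thesis by simp
  qed
  have "(\<exists>u w. X = ae_class M u \<and> Y = ae_class M w \<and> u \<in> D \<and> w \<in> L2_functions M \<and>
        (\<forall>h\<in>D. a u h = (LINT x|M. w x * cnj (h x)))) \<longleftrightarrow>
      X \<in> ae_class M ` D \<and> Y \<in> ae_class M ` L2_functions M \<and>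
        (\<forall>h\<in>ae_class M ` D. class_form M D a X h = hinner (L2 M) Y h)"
    (is "?L \<longleftrightarrow> ?R") for X Y
  proof
    assume ?L
    then obtain u w where "X = ae_class M u" "Y = ae_class M w" "u \<in> D" "w \<in> L2_functions M"
      "\<forall>h\<in>D. a u h = (LINT x|M. w x * cnj (h x))" by blast
    with eq[of u w] show ?R by blast
  next
    assume ?R
    then obtain u w where "X = ae_class M u" "Y = ae_class M w" "u \<in> D" "w \<in> L2_functions M"
      "\<forall>h\<in>ae_class M ` D. class_form M D a X h = hinner (L2 M) Y h" by blast
    with eq[of u w] show ?L by blast
  qed
  then show ?thesis
    unfolding form_operator_def abstract_form_operator_def hcarrier_L2 by auto
qed

lemma form_null_L2:
  assumes a: "ae_form M D a"
  shows "form_null (L2 M) (ae_class M ` D) (class_form M D a) (ae_class M (\<lambda>x. 0))"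
  unfolding form_null_def hcarrier_L2
proof (intro conjI ballI)
  show "ae_class M (\<lambda>x. 0) \<in> ae_class M ` D" using a by (auto simp: ae_form_def)
  show "class_form M D a u (ae_class M (\<lambda>x. 0)) = 0" if u: "u \<in> ae_class M ` D" for u
  proof -
    obtain v where "v \<in> D" "u = ae_class M v" using u by blast
    with a class_form_eq[OF a, of v "\<lambda>x. 0"] show ?thesis by (auto simp: ae_form_def)
  qed
  show "hinner (L2 M) w (ae_class M (\<lambda>x. 0)) = 0" if w: "w \<in> ae_class M ` L2_functions M" for w
    using w by (auto simp: hinner_L2 L2_functions_0)
qed


section \<open>Decomposition of operators associated with forms\<close>

text \<open>Reduces a unitary equivalence to statements about functions: linear maps to the
  components that are jointly isometric, onto up to null sets both on the whole space and between
  the form domains, and compatible with the forms. That the maps respect almost everywhere equality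
  is a consequence of the isometry.\<close>

lemma form_operator_unitarily_equivalent_sum:
  fixes M :: "'a measure" and M0 :: "'b measure" and M1 :: "nat \<Rightarrow> 'b measure"
    and \<Phi>0 :: "('a \<Rightarrow> complex) \<Rightarrow> 'b \<Rightarrow> complex"
    and \<Phi> :: "nat \<Rightarrow> nat \<Rightarrow> ('a \<Rightarrow> complex) \<Rightarrow> 'b \<Rightarrow> complex"
  assumes a: "ae_form M D a" and a0: "ae_form M0 D0 a0"
    and a1: "\<And>k. k \<le> N \<Longrightarrow> ae_form (M1 k) (D1 k) (a1 k)"
    and lin0: "\<And>c f g. \<Phi>0 (\<lambda>x. c * f x + g x) = (\<lambda>s. c * \<Phi>0 f s + \<Phi>0 g s)"
    and lin1: "\<And>k i c f g. \<Phi> k i (\<lambda>x. c * f x + g x) = (\<lambda>s. c * \<Phi> k i f s + \<Phi> k i g s)"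
    and L0: "\<And>f. f \<in> L2_functions M \<Longrightarrow> \<Phi>0 f \<in> L2_functions M0"
    and L1: "\<And>f k i. f \<in> L2_functions M \<Longrightarrow> k \<le> N \<Longrightarrow> i < n k \<Longrightarrow> \<Phi> k i f \<in> L2_functions (M1 k)"
    and iso: "\<And>f g. f \<in> L2_functions M \<Longrightarrow> g \<in> L2_functions M \<Longrightarrow>
      (LINT x|M. f x * cnj (g x)) = (LINT s|M0. \<Phi>0 f s * cnj (\<Phi>0 g s)) +
        (\<Sum>k\<in>{0..N}. \<Sum>i<n k. LINT s|M1 k. \<Phi> k i f s * cnj (\<Phi> k i g s))"
    and surj: "\<And>\<phi>0 \<phi>. \<phi>0 \<in> L2_functions M0 \<Longrightarrow>
      (\<And>k i. k \<le> N \<Longrightarrow> i < n k \<Longrightarrow> \<phi> k i \<in> L2_functions (M1 k)) \<Longrightarrow>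
      \<exists>f\<in>L2_functions M. (AE s in M0. \<Phi>0 f s = \<phi>0 s) \<and>
        (\<forall>k\<le>N. \<forall>i<n k. AE s in M1 k. \<Phi> k i f s = \<phi> k i s)"
    and D0: "\<And>f. f \<in> D \<Longrightarrow> \<Phi>0 f \<in> D0"
    and D1: "\<And>f k i. f \<in> D \<Longrightarrow> k \<le> N \<Longrightarrow> i < n k \<Longrightarrow> \<Phi> k i f \<in> D1 k"
    and surjD: "\<And>\<phi>0 \<phi>. \<phi>0 \<in> D0 \<Longrightarrow>
      (\<And>k i. k \<le> N \<Longrightarrow> i < n k \<Longrightarrow> \<phi> k i \<in> D1 k) \<Longrightarrow>
      \<exists>f\<in>D. (AE s in M0. \<Phi>0 f s = \<phi>0 s) \<and>
        (\<forall>k\<le>N. \<forall>i<n k. AE s in M1 k. \<Phi> k i f s = \<phi> k i s)"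
    and form: "\<And>f g. f \<in> D \<Longrightarrow> g \<in> D \<Longrightarrow>
      a f g = a0 (\<Phi>0 f) (\<Phi>0 g) + (\<Sum>k\<in>{0..N}. \<Sum>i<n k. a1 k (\<Phi> k i f) (\<Phi> k i g))"
  shows "unitarily_equivalent (form_operator M D a)
    (op_sum (form_operator M0 D0 a0)
      (op_dsum {0..N} (\<lambda>k. op_copies (form_operator (M1 k) (D1 k) (a1 k)) (n k))))"
proof -
  have DL: "D \<subseteq> L2_functions M" and DL0: "D0 \<subseteq> L2_functions M0"
    and DL1: "\<And>k. k \<le> N \<Longrightarrow> D1 k \<subseteq> L2_functions (M1 k)"
    using a a0 a1 by (auto simp: ae_form_def)
  let ?q0 = "class_form M0 D0 a0" and ?q1 = "\<lambda>k. class_form (M1 k) (D1 k) (a1 k)"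
  let ?Q0 = "ae_class M0 ` D0" and ?Q1 = "\<lambda>k. ae_class (M1 k) ` D1 k"
  let ?A1 = "\<lambda>k. abstract_form_operator (L2 (M1 k)) (?Q1 k) (?q1 k)"
  let ?C = "\<lambda>k. op_dsum {..<n k} (\<lambda>_. ?A1 k)"
  let ?QC = "\<lambda>k. \<Pi>\<^sub>E i\<in>{..<n k}. ?Q1 k" and ?qC = "\<lambda>k x y. \<Sum>i<n k. ?q1 k (x i) (y i)"
  let ?B = "\<lambda>k. abstract_form_operator (fst (?C k)) (?QC k) (?qC k)"
  let ?S = "op_dsum {0..N} ?B"
  let ?QS = "\<Pi>\<^sub>E k\<in>{0..N}. ?QC k" and ?qS = "\<lambda>x y. \<Sum>k\<in>{0..N}. ?qC k (x k) (y k)"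
  let ?A0 = "abstract_form_operator (L2 M0) ?Q0 ?q0"
  let ?T = "op_sum ?A0 (abstract_form_operator (fst ?S) ?QS ?qS)"
  let ?QT = "?Q0 \<times> ?QS" and ?qT = "\<lambda>x y. ?q0 (fst x) (fst y) + ?qS (snd x) (snd y)"
  note null1 = form_null_L2[OF a1]
  have C: "?C k = ?B k" if "k \<le> N" for k
    by (rule op_dsum_abstract_form_operator[where z="\<lambda>_. ae_class (M1 k) (\<lambda>x. 0)"])
      (use null1[OF that] in auto)
  have nullC: "form_null (fst (?C k)) (?QC k) (?qC k)
      (\<lambda>i\<in>{..<n k}. ae_class (M1 k) (\<lambda>x. 0))" if "k \<le> N" for k
    by (rule form_null_op_dsum) (use null1[OF that] in auto)
  have S: "?S = abstract_form_operator (fst ?S) ?QS ?qS"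
    by (rule op_dsum_abstract_form_operator[where z="\<lambda>k. \<lambda>i\<in>{..<n k}. ae_class (M1 k) (\<lambda>x. 0)"])
      (use nullC in auto)
  have nullS: "form_null (fst ?S) ?QS ?qS (\<lambda>k\<in>{0..N}. \<lambda>i\<in>{..<n k}. ae_class (M1 k) (\<lambda>x. 0))"
    by (rule form_null_op_dsum) (use nullC in auto)
  have T: "?T = abstract_form_operator (fst ?T) ?QT ?qT"
    by (rule op_sum_abstract_form_operator[OF form_null_L2[OF a0] nullS])
  have dsum_cong: "op_dsum {0..N} A = op_dsum {0..N} A'" if "\<And>k. k \<le> N \<Longrightarrow> A k = A' k"
    for A A' :: "nat \<Rightarrow> (nat \<Rightarrow> ('b \<Rightarrow> complex) set) hoperator"
    using that by (auto simp: op_dsum_def Let_def fun_eq_iff intro!: PiE_cong sum.cong)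
  have tgt: "op_sum (form_operator M0 D0 a0)
      (op_dsum {0..N} (\<lambda>k. op_copies (form_operator (M1 k) (D1 k) (a1 k)) (n k))) =
      abstract_form_operator (fst ?T) ?QT ?qT"
  proof -
    have "op_copies (form_operator (M1 k) (D1 k) (a1 k)) (n k) = ?B k" if "k \<le> N" for k
      unfolding op_copies_def form_operator_eq_abstract[OF a1[OF that]] by (rule C[OF that])
    then have "op_dsum {0..N} (\<lambda>k. op_copies (form_operator (M1 k) (D1 k) (a1 k)) (n k)) = ?S"
      by (rule dsum_cong)
    then show ?thesis
      unfolding form_operator_eq_abstract[OF a0] using S T by simp
  qed
  have carT: "hcarrier (fst ?T) = hcarrier (L2 M0) \<times>
      (\<Pi>\<^sub>E k\<in>{0..N}. \<Pi>\<^sub>E i\<in>{..<n k}. hcarrier (L2 (M1 k)))"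
    by (simp add: op_sum_def op_dsum_def abstract_form_operator_def Let_def)
  have addT: "hadd (fst ?T) x y = (hadd (L2 M0) (fst x) (fst y),
      \<lambda>k\<in>{0..N}. \<lambda>i\<in>{..<n k}. hadd (L2 (M1 k)) (snd x k i) (snd y k i))" for x y
    by (simp add: op_sum_def op_dsum_def abstract_form_operator_def Let_def)
  have scaleT: "hscale (fst ?T) c x = (hscale (L2 M0) c (fst x),
      \<lambda>k\<in>{0..N}. \<lambda>i\<in>{..<n k}. hscale (L2 (M1 k)) c (snd x k i))" for c x
    by (simp add: op_sum_def op_dsum_def abstract_form_operator_def Let_def)
  have innerT: "hinner (fst ?T) x y = hinner (L2 M0) (fst x) (fst y) +
      (\<Sum>k\<in>{0..N}. \<Sum>i<n k. hinner (L2 (M1 k)) (snd x k i) (snd y k i))" for x y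
    by (simp add: op_sum_def op_dsum_def abstract_form_operator_def Let_def)
  define V where "V f = (ae_class M0 (\<Phi>0 f),
      \<lambda>k\<in>{0..N}. \<lambda>i\<in>{..<n k}. ae_class (M1 k) (\<Phi> k i f))" for f
  \<comment> \<open>\<open>V\<close> acts on functions, \<open>U\<close> on classes;
    \<open>V_iff\<close> below shows that the choice made by \<open>ae_rep\<close> is
    immaterial.\<close>
  define U where "U X = V (ae_rep X)" for X
  have V_eq_iff: "V f = V g \<longleftrightarrow> (AE s in M0. \<Phi>0 f s = \<Phi>0 g s) \<and>
      (\<forall>k\<le>N. \<forall>i<n k. AE s in M1 k. \<Phi> k i f s = \<Phi> k i g s)"
    if f: "f \<in> L2_functions M" and g: "g \<in> L2_functions M" for f g
  proof -
    have "ae_class (M1 k) (\<Phi> k i f) = ae_class (M1 k) (\<Phi> k i g) \<longleftrightarrow>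
        (AE s in M1 k. \<Phi> k i f s = \<Phi> k i g s)" if "k \<le> N" "i < n k" for k i
      using L1[OF f that] L1[OF g that] by (intro ae_class_eq_iff L2_functions_measurable)
    moreover have "ae_class M0 (\<Phi>0 f) = ae_class M0 (\<Phi>0 g) \<longleftrightarrow> (AE s in M0. \<Phi>0 f s = \<Phi>0 g s)"
      using L0[OF f] L0[OF g] by (intro ae_class_eq_iff L2_functions_measurable)
    moreover have "V f = V g \<longleftrightarrow> ae_class M0 (\<Phi>0 f) = ae_class M0 (\<Phi>0 g) \<and>
        (\<forall>k\<le>N. \<forall>i<n k. ae_class (M1 k) (\<Phi> k i f) = ae_class (M1 k) (\<Phi> k i g))"
      by (auto simp: V_def fun_eq_iff restrict_def)
    ultimately show ?thesis by auto
  qed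
  have diff: "\<Phi>0 (\<lambda>x. f x - g x) = (\<lambda>s. \<Phi>0 f s - \<Phi>0 g s)"
    "\<Phi> k i (\<lambda>x. f x - g x) = (\<lambda>s. \<Phi> k i f s - \<Phi> k i g s)" for f g k i
    using lin0[of "-1" g f] lin1[of k i "-1" g f] by (auto simp: algebra_simps)
  have diffL: "(\<lambda>x. f x - g x) \<in> L2_functions M"
    if "f \<in> L2_functions M" "g \<in> L2_functions M" for f g
    using L2_functions_add[OF that(1) L2_functions_scale[OF that(2), of "-1"]] by simp
  \<comment> \<open>The isometry applied to \<open>f - g\<close>: its norm is 0 iff all component
    norms are 0. One direction makes \<open>U\<close> well defined, the other makes it
    injective.\<close>
  have V_iff: "V f = V g \<longleftrightarrow> (AE x in M. f x = g x)"
    if f: "f \<in> L2_functions M" and g: "g \<in> L2_functions M" for f g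
  proof -
    let ?d = "\<lambda>x. f x - g x"
    let ?I0 = "LINT s|M0. (cmod (\<Phi>0 ?d s))\<^sup>2" and ?I1 = "\<lambda>k i. LINT s|M1 k. (cmod (\<Phi> k i ?d s))\<^sup>2"
    have d: "?d \<in> L2_functions M" by (rule diffL[OF f g])
    have sq: "z * cnj z = complex_of_real ((cmod z)\<^sup>2)" for z
      by (rule complex_norm_square[symmetric])
    have i: "(LINT x|M. (cmod (?d x))\<^sup>2) = ?I0 + (\<Sum>k\<in>{0..N}. \<Sum>i<n k. ?I1 k i)"
      using iso[OF d d] unfolding sq integral_complex_of_real
      unfolding of_real_sum[symmetric] of_real_add[symmetric] of_real_eq_iff .
    have zero: "(LINT x|K. (cmod (h x))\<^sup>2) = 0 \<longleftrightarrow> (AE x in K. h x = 0)"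
      if "h \<in> L2_functions K" for K :: "'c measure" and h
      using that by (subst integral_nonneg_eq_0_iff_AE) (auto simp: L2_functions_def)
    have "(LINT x|M. (cmod (?d x))\<^sup>2) = 0 \<longleftrightarrow> ?I0 = 0 \<and> (\<forall>k\<le>N. \<forall>i<n k. ?I1 k i = 0)"
    proof -
      have "(\<Sum>k\<in>{0..N}. \<Sum>i<n k. ?I1 k i) = 0 \<longleftrightarrow> (\<forall>k\<in>{0..N}. (\<Sum>i<n k. ?I1 k i) = 0)"
        by (rule sum_nonneg_eq_0_iff) (auto intro!: sum_nonneg)
      also have "\<dots> \<longleftrightarrow> (\<forall>k\<in>{0..N}. \<forall>i\<in>{..<n k}. ?I1 k i = 0)"
        by (intro ball_cong refl sum_nonneg_eq_0_iff) auto
      finally have "(\<Sum>k\<in>{0..N}. \<Sum>i<n k. ?I1 k i) = 0 \<longleftrightarrow> (\<forall>k\<le>N. \<forall>i<n k. ?I1 k i = 0)" by auto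
      moreover have "0 \<le> ?I0" "0 \<le> (\<Sum>k\<in>{0..N}. \<Sum>i<n k. ?I1 k i)"
        by (auto intro!: sum_nonneg)
      ultimately show ?thesis unfolding i by (simp add: add_nonneg_eq_0_iff)
    qed
    then have "(AE x in M. ?d x = 0) \<longleftrightarrow> (AE s in M0. \<Phi>0 ?d s = 0) \<and>
        (\<forall>k\<le>N. \<forall>i<n k. AE s in M1 k. \<Phi> k i ?d s = 0)"
      using zero[OF d] zero[OF L0[OF d]] zero[OF L1[OF d]] by simp
    then show ?thesis
      unfolding V_eq_iff[OF f g] diff by simp
  qed
  have U: "U (ae_class M f) = V f" if f: "f \<in> L2_functions M" for f
    unfolding U_def V_iff[OF ae_rep_L2_functions[OF f] f]
    by (rule ae_rep_ae_class(2)[OF L2_functions_measurable[OF f]])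
  \<comment> \<open>Stated for general subsets because it is used twice: for the whole spaces, where
    it gives surjectivity of \<open>U\<close>, and for the form domains.\<close>
  have lift: "\<exists>f\<in>E. y = V f" if y: "y \<in> (ae_class M0 ` E0) \<times>
      (\<Pi>\<^sub>E k\<in>{0..N}. \<Pi>\<^sub>E i\<in>{..<n k}. ae_class (M1 k) ` E1 k)"
    and EL: "E \<subseteq> L2_functions M" "E0 \<subseteq> L2_functions M0" "\<And>k. k \<le> N \<Longrightarrow> E1 k \<subseteq> L2_functions (M1 k)"
    and s: "\<And>\<phi>0 \<phi>. \<phi>0 \<in> E0 \<Longrightarrow> (\<And>k i. k \<le> N \<Longrightarrow> i < n k \<Longrightarrow> \<phi> k i \<in> E1 k) \<Longrightarrow>
      \<exists>f\<in>E. (AE s in M0. \<Phi>0 f s = \<phi>0 s) \<and> (\<forall>k\<le>N. \<forall>i<n k. AE s in M1 k. \<Phi> k i f s = \<phi> k i s)"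
    for y E E0 E1
  proof -
    obtain y0 y1 where yy: "y = (y0, y1)" by (cases y)
    obtain \<phi>0 where p0: "\<phi>0 \<in> E0" "y0 = ae_class M0 \<phi>0" using y yy by auto
    have "\<forall>k i. \<exists>\<phi>. k \<le> N \<longrightarrow> i < n k \<longrightarrow> \<phi> \<in> E1 k \<and> y1 k i = ae_class (M1 k) \<phi>"
    proof (intro allI)
      fix k i
      have "y1 k i \<in> ae_class (M1 k) ` E1 k" if "k \<le> N" "i < n k"
        using y yy that by (auto simp: PiE_iff)
      then show "\<exists>\<phi>. k \<le> N \<longrightarrow> i < n k \<longrightarrow> \<phi> \<in> E1 k \<and> y1 k i = ae_class (M1 k) \<phi>"
        by auto
    qed
    then obtain \<phi> where p: "\<And>k i. k \<le> N \<Longrightarrow> i < n k \<Longrightarrow> \<phi> k i \<in> E1 k"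
      "\<And>k i. k \<le> N \<Longrightarrow> i < n k \<Longrightarrow> y1 k i = ae_class (M1 k) (\<phi> k i)"
      by metis
    obtain f where f: "f \<in> E" "AE s in M0. \<Phi>0 f s = \<phi>0 s"
      "\<And>k i. k \<le> N \<Longrightarrow> i < n k \<Longrightarrow> AE s in M1 k. \<Phi> k i f s = \<phi> k i s"
      using s[of \<phi>0 \<phi>, OF p0(1) p(1)] by auto
    have fL: "f \<in> L2_functions M" using f EL by auto
    have e0: "y0 = ae_class M0 (\<Phi>0 f)"
      unfolding p0 by (subst ae_class_eq_iff)
        (use p0 EL L0[OF fL] f(2) in \<open>auto simp: L2_functions_def eq_commute\<close>)
    have e1: "y1 k i = ae_class (M1 k) (\<Phi> k i f)" if ki: "k \<le> N" "i < n k" for k i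
    proof -
      have "\<phi> k i \<in> L2_functions (M1 k)" using p(1)[OF ki] EL(3)[OF ki(1)] by auto
      then have "ae_class (M1 k) (\<phi> k i) = ae_class (M1 k) (\<Phi> k i f)"
        using L1[OF fL ki] f(3)[OF ki]
        by (subst ae_class_eq_iff) (auto simp: L2_functions_measurable eq_commute)
      then show ?thesis using p(2)[OF ki] by simp
    qed
    have "y1 = (\<lambda>k\<in>{0..N}. \<lambda>i\<in>{..<n k}. ae_class (M1 k) (\<Phi> k i f))"
    proof (rule ext, rule ext)
      fix k i
      show "y1 k i = (\<lambda>k\<in>{0..N}. \<lambda>i\<in>{..<n k}. ae_class (M1 k) (\<Phi> k i f)) k i"
        using y yy e1[of k i] by (auto simp: PiE_iff extensional_def)
    qed
    with e0 yy f(1) show ?thesis by (auto simp: V_def)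
  qed
  have "unitary (L2 M) (fst ?T) U"
    unfolding unitary_def
  proof (intro conjI ballI allI)
    show "bij_betw U (hcarrier (L2 M)) (hcarrier (fst ?T))"
      unfolding bij_betw_def
    proof
      show "inj_on U (hcarrier (L2 M))"
        unfolding hcarrier_L2
        by (rule inj_onI, elim imageE) (simp add: U V_iff ae_class_eq_iff[OF L2_functions_measurable L2_functions_measurable])
      show "U ` hcarrier (L2 M) = hcarrier (fst ?T)"
      proof
        show "U ` hcarrier (L2 M) \<subseteq> hcarrier (fst ?T)"
          unfolding hcarrier_L2 carT by (auto simp: U V_def L0 L1)
        show "hcarrier (fst ?T) \<subseteq> U ` hcarrier (L2 M)"
        proof
          fix y assume "y \<in> hcarrier (fst ?T)"
          then have "\<exists>f\<in>L2_functions M. y = V f"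
            unfolding carT hcarrier_L2
            by (rule lift) (use surj in auto)
          then obtain f where "f \<in> L2_functions M" "y = V f" by blast
          with U[of f] show "y \<in> U ` hcarrier (L2 M)" unfolding hcarrier_L2 by force
        qed
      qed
    qed
  next
    fix x y assume "x \<in> hcarrier (L2 M)" "y \<in> hcarrier (L2 M)"
    then obtain f g where f: "f \<in> L2_functions M" "x = ae_class M f"
      and g: "g \<in> L2_functions M" "y = ae_class M g" unfolding hcarrier_L2 by auto
    note m = L2_functions_measurable[OF f(1)] L2_functions_measurable[OF g(1)]
    note m0 = L2_functions_measurable[OF L0[OF f(1)]] L2_functions_measurable[OF L0[OF g(1)]]
    have "V (\<lambda>x. f x + g x) = hadd (fst ?T) (V f) (V g)"
      unfolding addT using lin0[of 1 f g] lin1[of _ _ 1 f g]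
      by (auto simp: V_def hadd_L2[OF m0] hadd_L2 L2_functions_measurable L1 f(1) g(1)
          intro!: restrict_ext)
    then show "U (hadd (L2 M) x y) = hadd (fst ?T) (U x) (U y)"
      unfolding f g hadd_L2[OF m] using f(1) g(1) by (simp add: U L2_functions_add)
    show "hinner (fst ?T) (U x) (U y) = hinner (L2 M) x y"
      unfolding innerT f g U[OF f(1)] U[OF g(1)] hinner_L2[OF f(1) g(1)] iso[OF f(1) g(1)]
      by (auto simp: V_def hinner_L2 L0 L1 f(1) g(1) intro!: sum.cong)
  next
    fix c x assume "x \<in> hcarrier (L2 M)"
    then obtain f where f: "f \<in> L2_functions M" "x = ae_class M f" unfolding hcarrier_L2 by auto
    note m = L2_functions_measurable[OF f(1)]
    note m0 = L2_functions_measurable[OF L0[OF f(1)]]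
    have z: "\<Phi>0 (\<lambda>x. 0) = (\<lambda>s. 0)" "\<Phi> k i (\<lambda>x. 0) = (\<lambda>s. 0)" for k i
      using diff(1)[of "\<lambda>x. 0" "\<lambda>x. 0"] diff(2)[of k i "\<lambda>x. 0" "\<lambda>x. 0"] by auto
    have "V (\<lambda>x. c * f x) = hscale (fst ?T) c (V f)"
      unfolding scaleT using lin0[of c f "\<lambda>x. 0"] lin1[of _ _ c f "\<lambda>x. 0"]
      by (auto simp: V_def hscale_L2[OF m0] hscale_L2 L2_functions_measurable L1 f(1) z
          intro!: restrict_ext)
    then show "U (hscale (L2 M) c x) = hscale (fst ?T) c (U x)"
      unfolding f hscale_L2[OF m] using f(1) by (simp add: U L2_functions_scale)
  qed
  moreover have "ae_class M ` D \<subseteq> hcarrier (L2 M)" unfolding hcarrier_L2 using DL by auto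
  moreover have "U ` (ae_class M ` D) = ?QT"
  proof
    show "U ` (ae_class M ` D) \<subseteq> ?QT"
      using DL by (auto simp: U V_def D0 D1 subset_iff)
    show "?QT \<subseteq> U ` (ae_class M ` D)"
    proof
      fix y assume "y \<in> ?QT"
      then have "\<exists>f\<in>D. y = V f"
        by (rule lift) (use surjD DL DL0 DL1 in auto)
      then show "y \<in> U ` (ae_class M ` D)" using U DL by force
    qed
  qed
  moreover have "?qT (U x) (U y) = class_form M D a x y"
    if "x \<in> ae_class M ` D" "y \<in> ae_class M ` D" for x y
  proof -
    from that obtain f g where f: "f \<in> D" "x = ae_class M f"
      and g: "g \<in> D" "y = ae_class M g" by auto
    have "f \<in> L2_functions M" "g \<in> L2_functions M" using f g DL by auto
    then show ?thesis
      unfolding f g class_form_eq[OF a f(1) g(1)] form[OF f(1) g(1)]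
      by (auto simp: U V_def class_form_eq[OF a0] class_form_eq[OF a1] D0 D1 f g intro!: sum.cong)
  qed
  ultimately show ?thesis
    unfolding tgt form_operator_eq_abstract[OF a]
    by (rule unitarily_equivalent_abstract_form_operator)
qed


section \<open>Smooth cut-off functions\<close>

text \<open>For \<open>n = 0\<close> this is the classical smooth function that is flat at 0. The
  powers in the denominator make the linear span of the family closed under differentiation.\<close>

definition flat :: "nat \<Rightarrow> real \<Rightarrow> real" where
  "flat n x = (if x \<le> 0 then 0 else exp (- (1 / x)) / x ^ n)"

text \<open>With \<open>y = 1 / x\<close> the limit from the right says that exponentials beat
  powers at infinity.\<close>

lemma tendsto_flat_0: "(flat n \<longlongrightarrow> 0) (at 0)"
proof -
  have "((\<lambda>x::real. inverse x ^ n / exp (inverse x)) \<longlongrightarrow> 0) (at_right 0)"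
    by (rule filterlim_compose[OF tendsto_power_div_exp_0 filterlim_inverse_at_top_right])
  moreover have "\<forall>\<^sub>F x in at_right 0. inverse x ^ n / exp (inverse x) = flat n x"
    unfolding eventually_at_filter
    by (intro always_eventually) (auto simp: flat_def exp_minus field_simps)
  ultimately have "(flat n \<longlongrightarrow> 0) (at_right 0)"
    by (rule Lim_transform_eventually)
  moreover have "(flat n \<longlongrightarrow> 0) (at_left 0)"
    by (rule tendsto_eventually, unfold eventually_at_filter)
      (intro always_eventually, auto simp: flat_def)
  ultimately show ?thesis by (simp add: filterlim_split_at)
qed

text \<open>At 0 the difference quotient of \<open>flat n\<close> is exactly
  \<open>flat (n + 1)\<close>, which tends to 0; elsewhere this is calculus.\<close>

lemma flat_has_derivative:
  "(flat n has_real_derivative (flat (n + 2) x - real n * flat (n + 1) x)) (at x)"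
proof (cases x "0 :: real" rule: linorder_cases)
  case less
  have "((\<lambda>x. 0) has_real_derivative (flat (n + 2) x - real n * flat (n + 1) x)) (at x)"
    using less by (simp add: flat_def)
  then show ?thesis
    by (rule has_field_derivative_transform_within_open[where S="{..<0}"])
      (use less in \<open>auto simp: flat_def\<close>)
next
  case greater
  have e: "((\<lambda>x. exp (- inverse x)) has_real_derivative exp (- inverse x) * inverse x ^ 2) (at x)"
    using greater by (auto intro!: derivative_eq_intros simp: power2_eq_square)
  have p: "((\<lambda>x. inverse x ^ n) has_real_derivative - (real n * inverse x ^ (n + 1))) (at x)"
    using DERIV_power[OF DERIV_inverse[of x], of n] greater
    by (cases n) (simp_all add: power2_eq_square mult.assoc)
  have "exp (- inverse x) * inverse x ^ 2 * inverse x ^ n +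
      - (real n * inverse x ^ (n + 1)) * exp (- inverse x) = flat (n + 2) x - real n * flat (n + 1) x"
    using greater by (simp add: flat_def divide_inverse power_add power_inverse power2_eq_square)
  with DERIV_mult[OF e p] have "((\<lambda>x. exp (- inverse x) * inverse x ^ n) has_real_derivative
      (flat (n + 2) x - real n * flat (n + 1) x)) (at x)" by simp
  then show ?thesis
    by (rule has_field_derivative_transform_within_open[where S="{0<..}"])
      (use greater in \<open>auto simp: flat_def divide_inverse power_inverse\<close>)
next
  case equal
  have "\<forall>\<^sub>F h in at 0. flat (n + 1) h = (flat n (0 + h) - flat n 0) / h"
    unfolding eventually_at_filter by (intro always_eventually) (auto simp: flat_def)
  then have "((\<lambda>h. (flat n (0 + h) - flat n 0) / h) \<longlongrightarrow> 0) (at 0)"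
    by (rule Lim_transform_eventually[OF tendsto_flat_0])
  then have "(flat n has_real_derivative 0) (at 0)"
    by (simp add: DERIV_def)
  then show ?thesis
    using equal by (simp add: flat_def)
qed

text \<open>Smoothness is proved by membership in a class of functions that is closed under
  differentiation.\<close>

inductive_set smooth_class :: "(real \<Rightarrow> real) set" where
  const: "(\<lambda>x. c) \<in> smooth_class"
| flat: "(\<lambda>x. flat n (a * x + c)) \<in> smooth_class"
| add: "f \<in> smooth_class \<Longrightarrow> g \<in> smooth_class \<Longrightarrow> (\<lambda>x. f x + g x) \<in> smooth_class"
| mult: "f \<in> smooth_class \<Longrightarrow> g \<in> smooth_class \<Longrightarrow> (\<lambda>x. f x * g x) \<in> smooth_class"
| inverse: "f \<in> smooth_class \<Longrightarrow> (\<And>x. f x \<noteq> 0) \<Longrightarrow> (\<lambda>x. inverse (f x)) \<in> smooth_class"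

lemma smooth_class_derivative:
  assumes "f \<in> smooth_class"
  shows "\<exists>f'\<in>smooth_class. \<forall>x. (f has_real_derivative f' x) (at x)"
  using assms
proof induction
  case (const c)
  show ?case by (rule bexI[of _ "\<lambda>x. 0"]) (auto intro: smooth_class.const)
next
  case (flat n a c)
  let ?f' = "\<lambda>x. a * (flat (n + 2) (a * x + c) + (- real n) * flat (n + 1) (a * x + c))"
  have "?f' \<in> smooth_class" by (intro smooth_class.intros)
  moreover have "((\<lambda>x. flat n (a * x + c)) has_real_derivative ?f' x) (at x)" for x
    by (rule DERIV_cong[OF DERIV_chain2[OF flat_has_derivative]])
      (auto intro!: derivative_eq_intros simp: algebra_simps)
  ultimately show ?case by (intro bexI[of _ ?f']) auto
next
  case (add f g)
  then obtain f' g' where "f' \<in> smooth_class" "g' \<in> smooth_class"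
    "\<And>x. (f has_real_derivative f' x) (at x)" "\<And>x. (g has_real_derivative g' x) (at x)" by blast
  then show ?case
    by (intro bexI[of _ "\<lambda>x. f' x + g' x"] allI DERIV_add) (auto intro: smooth_class.add)
next
  case (mult f g)
  then obtain f' g' where "f' \<in> smooth_class" "g' \<in> smooth_class"
    "\<And>x. (f has_real_derivative f' x) (at x)" "\<And>x. (g has_real_derivative g' x) (at x)" by blast
  with mult(1,2) show ?case
    by (intro bexI[of _ "\<lambda>x. f' x * g x + g' x * f x"] allI DERIV_mult) (auto intro: smooth_class.intros)
next
  case (inverse f)
  then obtain f' where f': "f' \<in> smooth_class" "\<And>x. (f has_real_derivative f' x) (at x)" by blast
  have "(\<lambda>x. (-1) * (inverse (f x) * f' x * inverse (f x))) \<in> smooth_class"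
    using inverse f' by (intro smooth_class.intros) auto
  moreover have "((\<lambda>x. inverse (f x)) has_real_derivative (-1) * (inverse (f x) * f' x * inverse (f x))) (at x)"
    for x
    using DERIV_inverse'[OF f'(2) inverse(2), of x] by simp
  ultimately show ?case by (intro bexI[of _ "\<lambda>x. (-1) * (inverse (f x) * f' x * inverse (f x))"]) auto
qed

lemma smooth_class_higher_derivative:
  "f \<in> smooth_class \<Longrightarrow> (deriv ^^ n) f \<in> smooth_class"
proof (induction n)
  case (Suc n)
  then obtain f' where "f' \<in> smooth_class" "\<forall>x. ((deriv ^^ n) f has_real_derivative f' x) (at x)"
    using smooth_class_derivative by blast
  moreover from this have "deriv ((deriv ^^ n) f) = f'" by (intro ext DERIV_imp_deriv) auto
  ultimately show ?case by simp
qed simp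

lemma smooth_class_differentiable: "f \<in> smooth_class \<Longrightarrow> (deriv ^^ n) f differentiable (at x)"
  using smooth_class_derivative[OF smooth_class_higher_derivative, of f n]
  by (auto simp: real_differentiable_def)

lemma smooth_class_continuous: "f \<in> smooth_class \<Longrightarrow> continuous_on A f"
  using smooth_class_derivative[of f]
  by (blast intro: continuous_at_imp_continuous_on DERIV_isCont)

lemma compact_closed_subset:
  fixes a b :: real
  assumes "closure A \<subseteq> {a..b}"
  shows "compact (closure A)"
  using compact_Int_closed[OF compact_Icc closed_closure, of a b A] assms by (simp add: Int_absorb1)

lemma test_functionsI:
  assumes "f \<in> smooth_class" "\<And>x. x \<notin> {a..b} \<Longrightarrow> f x = 0" "{a..b} \<subseteq> S"
  shows "f \<in> test_functions S"
proof -
  have "closure {x. f x \<noteq> 0} \<subseteq> {a..b}"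
    using assms(2) by (intro closure_minimal) force+
  then show ?thesis
    unfolding test_functions_def
    using smooth_class_differentiable[OF assms(1)] assms(3) compact_closed_subset by auto
qed

text \<open>A primitive of an element of \<open>smooth_class\<close> need not belong to the class;
  its smoothness is read off from its derivative.\<close>

lemma test_functions_antiderivI:
  assumes "f \<in> smooth_class" "\<And>x. (F has_real_derivative f x) (at x)"
    "\<And>x. x \<notin> {a..b} \<Longrightarrow> F x = 0" "{a..b} \<subseteq> S"
  shows "F \<in> test_functions S" "deriv F = f"
proof -
  show *: "deriv F = f" using assms(2) by (intro ext DERIV_imp_deriv)
  have "(deriv ^^ n) F differentiable (at x)" for n x
  proof (cases n)
    case 0 then show ?thesis using assms(2) real_differentiable_def by auto
  next
    case (Suc m)
    then show ?thesis
      using smooth_class_differentiable[OF assms(1)] * by (simp add: funpow_swap1)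
  qed
  moreover have "closure {x. F x \<noteq> 0} \<subseteq> {a..b}"
    using assms(3) by (intro closure_minimal) force+
  ultimately show "F \<in> test_functions S"
    unfolding test_functions_def using assms(4) compact_closed_subset by auto
qed

text \<open>The standard smooth transition from 0 on \<open>x \<le> 0\<close> to 1 on
  \<open>1 \<le> x\<close>. The denominator never vanishes since \<open>x\<close> and
  \<open>1 - x\<close> are not both nonpositive.\<close>

definition smooth_step :: "real \<Rightarrow> real" where
  "smooth_step x = flat 0 x * inverse (flat 0 x + flat 0 (1 - x))"

lemma flat_nonneg: "0 \<le> flat n x" and flat_pos: "0 < x \<Longrightarrow> 0 < flat n x"
  by (auto simp: flat_def)

lemma flat_denominator_pos: "0 < flat 0 x + flat 0 (1 - x)"
  using flat_pos[of x 0] flat_pos[of "1 - x" 0] flat_nonneg[of 0 x] flat_nonneg[of 0 "1 - x"]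
  by (cases "0 < x") auto

lemma smooth_step_0: "x \<le> 0 \<Longrightarrow> smooth_step x = 0"
  and smooth_step_1: "1 \<le> x \<Longrightarrow> smooth_step x = 1"
  and smooth_step_bounds: "0 \<le> smooth_step x" "smooth_step x \<le> 1"
  using flat_nonneg[of 0 x] flat_nonneg[of 0 "1 - x"] flat_denominator_pos[of x]
  by (auto simp: smooth_step_def flat_def field_simps)

lemma smooth_step_smooth: "(\<lambda>x. smooth_step (a * x + c)) \<in> smooth_class"
proof -
  have "(\<lambda>x. flat 0 (a * x + c) * inverse (flat 0 (a * x + c) + flat 0 ((- a) * x + (1 - c))))
      \<in> smooth_class"
  proof (intro smooth_class.intros)
    fix x show "flat 0 (a * x + c) + flat 0 ((- a) * x + (1 - c)) \<noteq> 0"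
      using flat_denominator_pos[of "a * x + c"] by (simp add: algebra_simps)
  qed
  moreover have "(\<lambda>x. flat 0 (a * x + c) * inverse (flat 0 (a * x + c) + flat 0 ((- a) * x + (1 - c)))) =
      (\<lambda>x. smooth_step (a * x + c))"
    by (simp add: smooth_step_def fun_eq_iff diff_add_eq_diff_diff_swap)
  ultimately show ?thesis by simp
qed

text \<open>Both transitions take place inside the interval, within distance \<open>1 / n\<close> of
  the ends. Hence every bump is supported in \<open>{a..b}\<close> itself, and no enlarged interval
  has to fit into the domain.\<close>

definition smooth_bump :: "real \<Rightarrow> real \<Rightarrow> nat \<Rightarrow> real \<Rightarrow> real" where
  "smooth_bump a b n x = smooth_step (real n * (x - a)) * smooth_step (real n * (b - x))"

lemma smooth_bump_smooth: "smooth_bump a b n \<in> smooth_class"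
proof -
  have "(\<lambda>x. smooth_step (real n * x + (- real n * a)) * smooth_step ((- real n) * x + real n * b))
      \<in> smooth_class"
    by (intro smooth_class.intros smooth_step_smooth)
  then show ?thesis by (simp add: smooth_bump_def[abs_def] algebra_simps)
qed

lemma smooth_bump_outside: "x \<notin> {a..b} \<Longrightarrow> smooth_bump a b n x = 0"
  by (auto simp: smooth_bump_def smooth_step_0 mult_nonneg_nonpos)

lemma smooth_bump_bounds: "0 \<le> smooth_bump a b n x" "smooth_bump a b n x \<le> 1"
  using smooth_step_bounds by (auto simp: smooth_bump_def intro: mult_le_one)

lemma smooth_bump_continuous: "continuous_on A (smooth_bump a b n)"
  by (rule smooth_class_continuous[OF smooth_bump_smooth])

lemma smooth_bump_measurable [measurable]: "smooth_bump a b n \<in> borel_measurable borel"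
  by (rule borel_measurable_continuous_onI[OF smooth_bump_continuous])

lemma tendsto_smooth_bump: "(\<lambda>n. smooth_bump a b n x) \<longlonglongrightarrow> indicat_real {a<..<b} x"
proof (cases "x \<in> {a<..<b}")
  case True
  have large: "\<forall>\<^sub>F n in sequentially. 1 \<le> real n * y" if "0 < y" for y
    using filterlim_at_top[THEN iffD1, OF filterlim_real_sequentially, rule_format, of "1 / y"]
    by (rule eventually_mono) (use that in \<open>simp add: field_simps\<close>)
  have "\<forall>\<^sub>F n in sequentially. 1 \<le> real n * (x - a)" "\<forall>\<^sub>F n in sequentially. 1 \<le> real n * (b - x)"
    by (rule large; use True in simp)+
  then have "\<forall>\<^sub>F n in sequentially. smooth_bump a b n x = 1"
    by eventually_elim (simp add: smooth_bump_def smooth_step_1)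
  with True show ?thesis by (simp add: tendsto_eventually)
next
  case False
  then have "smooth_bump a b n x = 0" for n
    by (auto simp: smooth_bump_def smooth_step_0 mult_nonneg_nonpos)
  with False show ?thesis by simp
qed


section \<open>Weak derivatives on intervals\<close>

text \<open>A Dynkin argument: extended by 0, \<open>h\<close> has integral 0 over all half-lines
  \<open>{..x}\<close>, which are stable under intersection and generate the Borel sets; hence over
  every Borel set.\<close>

lemma AE_eq_0_if_subinterval_integrals_eq_0:
  fixes h :: "real \<Rightarrow> complex"
  assumes h: "set_integrable lborel {a..b} h"
    and 0: "\<And>x y. a \<le> x \<Longrightarrow> x \<le> y \<Longrightarrow> y \<le> b \<Longrightarrow> (LINT t:{x..y}|lborel. h t) = 0"
  shows "AE t in lborel. t \<in> {a..b} \<longrightarrow> h t = 0"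
proof -
  let ?f = "\<lambda>t. indicator {a..b} t *\<^sub>R h t"
  have f: "integrable lborel ?f" using h by (simp add: set_integrable_def)
  have ind: "set_integrable lborel A ?f" if "A \<in> sets lborel" for A
    unfolding set_integrable_def by (rule integrable_mult_indicator[OF that f])
  \<comment> \<open>The total integral is what the complement step of the induction needs.\<close>
  have tot: "(LINT t:UNIV|lborel. ?f t) = 0"
  proof (cases "a \<le> b")
    case True
    then show ?thesis using 0[of a b] by (simp add: set_lebesgue_integral_def)
  qed (simp add: set_lebesgue_integral_def)
  have "(LINT t:A|lborel. ?f t) = 0" if A: "A \<in> sets lborel" for A
  proof -
    have "Int_stable (range (\<lambda>x::real. {..x}))"
      by (auto simp: Int_stable_def)
    moreover have "range (\<lambda>x::real. {..x}) \<subseteq> Pow UNIV" by simp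
    moreover have "A \<in> sigma_sets UNIV (range (\<lambda>x::real. {..x}))"
      using A by (simp add: borel_eq_atMost sets_measure_of)
    ultimately show ?thesis
    proof (induction rule: sigma_sets_induct_disjoint)
      case (basic A)
      then obtain x where x: "A = {..x}" by auto
      have "(LINT t:A|lborel. ?f t) = (LINT t:{a..min x b}|lborel. h t)"
        unfolding set_lebesgue_integral_def x
        by (rule Bochner_Integration.integral_cong) (auto simp: indicator_def)
      also have "\<dots> = 0"
        by (cases "a \<le> min x b") (use 0[of a "min x b"] in \<open>auto simp: set_lebesgue_integral_def\<close>)
      finally show ?case .
    next
      case empty
      then show ?case by (simp add: set_lebesgue_integral_def)
    next
      case (compl A)
      then have A: "A \<in> sets lborel"
        by (simp add: borel_eq_atMost sets_measure_of)
      have "(LINT t:A \<union> - A|lborel. ?f t) = (LINT t:A|lborel. ?f t) + (LINT t:- A|lborel. ?f t)"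
        by (rule set_integral_Un) (use A ind in auto)
      with compl tot show ?case by (simp add: Compl_eq_Diff_UNIV)
    next
      case (union A)
      then have A: "A i \<in> sets lborel" for i
        by (auto simp: borel_eq_atMost sets_measure_of)
      have "(LINT t:(\<Union>i. A i)|lborel. ?f t) = (\<Sum>i. (LINT t:A i|lborel. ?f t))"
        by (rule lebesgue_integral_countable_add)
          (use A union(1) ind in \<open>auto simp: disjoint_family_on_def\<close>)
      with union show ?case by simp
    qed
  qed
  then have "AE t in lborel. ?f t = 0"
    by (rule sigma_finite_measure.density_zero[OF sigma_finite_lborel f])
  then show ?thesis by eventually_elim (auto simp: indicator_def)
qed

text \<open>On an interval: \<open>f\<close> is locally absolutely continuous with density
  \<open>g\<close>, up to and including those end points that belong to \<open>I\<close>. Unlike the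
  formulation with test functions, this notion can be glued at a common end point and keeps
  pointwise boundary values.\<close>

definition primitive_on :: "real set \<Rightarrow> (real \<Rightarrow> complex) \<Rightarrow> (real \<Rightarrow> complex) \<Rightarrow> bool" where
  "primitive_on I f g \<longleftrightarrow> (\<forall>x\<in>I. \<forall>y\<in>I. x \<le> y \<longrightarrow>
     set_integrable lborel {x..y} g \<and> f y - f x = (LINT t:{x..y}|lborel. g t))"

lemma primitive_on_subset: "primitive_on I f g \<Longrightarrow> J \<subseteq> I \<Longrightarrow> primitive_on J f g"
  unfolding primitive_on_def by blast

lemma primitive_onD:
  assumes "primitive_on I f g" "x \<in> I" "y \<in> I" "x \<le> y"
  shows "set_integrable lborel {x..y} g" "f y = f x + (LINT t:{x..y}|lborel. g t)"
  using assms unfolding primitive_on_def by (blast, metis add.commute diff_eq_eq)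

lemma set_integral_combine_Icc:
  fixes g :: "real \<Rightarrow> complex"
  assumes "set_integrable lborel {x..z} g" "x \<le> y" "y \<le> z"
  shows "(LINT t:{x..z}|lborel. g t) = (LINT t:{x..y}|lborel. g t) + (LINT t:{y..z}|lborel. g t)"
proof -
  have "(LINT t:{x..y} \<union> {y..z}|lborel. g t) = (LINT t:{x..y}|lborel. g t) + (LINT t:{y..z}|lborel. g t)"
    by (rule set_integral_Un_AE)
      (use assms AE_lborel_singleton[of y] in \<open>auto intro: set_integrable_subset elim: eventually_mono\<close>)
  then show ?thesis using ivl_disj_un_two_touch(4)[OF assms(2,3)] by simp
qed

lemma set_integrable_combine_Icc:
  fixes g :: "real \<Rightarrow> complex"
  assumes "set_integrable lborel {x..y} g" "set_integrable lborel {y..z} g" "x \<le> y" "y \<le> z"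
  shows "set_integrable lborel {x..z} g"
  using set_integrable_Un[OF assms(1,2)] ivl_disj_un_two_touch(4)[OF assms(3,4)] by simp

lemma primitive_on_continuous:
  assumes "primitive_on {x..y} f g"
  shows "continuous_on {x..y} f"
proof (cases "x \<le> y")
  case True
  then have g: "set_integrable lborel {x..y} g"
    by (intro primitive_onD(1)[OF assms]) simp_all
  have f: "f z = f x + (LINT t:{x..z}|lborel. g t)" if "z \<in> {x..y}" for z
    by (rule primitive_onD(2)[OF assms]) (use True that in simp_all)
  have "(LINT t:{x..z}|lborel. g t) = integral {x..z} g" if "z \<in> {x..y}" for z
    by (rule set_borel_integral_eq_integral(2)) (use that in \<open>auto intro: set_integrable_subset[OF g]\<close>)
  then have "f x + integral {x..z} g = f z" if "z \<in> {x..y}" for z using f[OF that] that by simp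
  moreover have "continuous_on {x..y} (\<lambda>z. f x + integral {x..z} g)"
    by (intro continuous_intros indefinite_integral_continuous_1 set_borel_integral_eq_integral(1)[OF g])
  ultimately show ?thesis
    using continuous_on_eq by blast
qed auto

lemma set_integral_deriv:
  fixes \<phi> \<phi>' :: "real \<Rightarrow> real"
  assumes "a \<le> b" "\<And>x. (\<phi> has_real_derivative \<phi>' x) (at x)" "continuous_on {a..b} \<phi>'"
  shows "set_integrable lborel {a..b} \<phi>'" "(LINT t:{a..b}|lborel. \<phi>' t) = \<phi> b - \<phi> a"
proof -
  show "set_integrable lborel {a..b} \<phi>'"
    by (rule borel_integrable_atLeastAtMost'[OF assms(3)])
  have "(\<phi> has_vector_derivative \<phi>' x) (at x within {a..b})" for x
    by (rule has_vector_derivative_at_within[OF assms(2)[of x, unfolded has_real_derivative_iff_has_vector_derivative]])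
  then show "(LINT t:{a..b}|lborel. \<phi>' t) = \<phi> b - \<phi> a"
    unfolding set_lebesgue_integral_def by (intro integral_FTC_atLeastAtMost assms)
qed

lemma test_functions_deriv:
  assumes "\<phi> \<in> test_functions S"
  shows "(\<phi> has_real_derivative deriv \<phi> x) (at x)" "continuous_on A (deriv \<phi>)" "continuous_on A \<phi>"
proof -
  have d: "(deriv ^^ n) \<phi> differentiable (at x)" for n x
    using assms unfolding test_functions_def by blast
  show *: "(\<phi> has_real_derivative deriv \<phi> x) (at x)" for x
    using d[of 0 x] DERIV_deriv_iff_real_differentiable[of \<phi> x] by simp
  show "continuous_on A (deriv \<phi>)"
    by (intro continuous_at_imp_continuous_on ballI differentiable_imp_continuous_within
        d[of 1, simplified])
  show "continuous_on A \<phi>"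
    by (intro continuous_at_imp_continuous_on ballI DERIV_isCont[OF *])
qed

lemma test_functions_deriv_0:
  assumes "\<phi> \<in> test_functions S" "x \<notin> closure {x. \<phi> x \<noteq> 0}"
  shows "\<phi> x = 0" "deriv \<phi> x = 0"
proof -
  let ?U = "- closure {x. \<phi> x \<noteq> 0}"
  have 0: "\<phi> y = 0" if "y \<in> ?U" for y using that closure_subset[of "{x. \<phi> x \<noteq> 0}"] by blast
  show "\<phi> x = 0" by (rule 0[OF iffD2[OF Compl_iff assms(2)]])
  have "((\<lambda>x. 0) has_real_derivative 0) (at x)" by simp
  then have "(\<phi> has_real_derivative 0) (at x)"
    by (rule has_field_derivative_transform_within_open[where S="?U"])
      (rule open_Compl[OF closed_closure], rule iffD2[OF Compl_iff assms(2)], rule 0[symmetric])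
  then show "deriv \<phi> x = 0" by (rule DERIV_imp_deriv)
qed

lemma is_interval_Icc_subset:
  fixes S :: "real set"
  assumes "is_interval S" "x \<in> S" "y \<in> S"
  shows "{x..y} \<subseteq> S"
  using assms unfolding is_interval_1 by (meson atLeastAtMost_iff subsetI)

text \<open>The hull of the compact support is enlarged on both sides within the open set, so that
  the function and its derivative vanish at \<open>a\<close> and \<open>b\<close> and no boundary
  terms arise.\<close>

lemma test_functions_support:
  assumes \<phi>: "\<phi> \<in> test_functions S" and S: "open S" "is_interval S" "S \<noteq> {}"
  obtains a b where "a < b" "{a..b} \<subseteq> S" "\<And>x. x \<notin> {a<..<b} \<Longrightarrow> \<phi> x = 0 \<and> deriv \<phi> x = 0"
proof -
  obtain K where K: "K = closure {x. \<phi> x \<noteq> 0}" "compact K" "K \<subseteq> S"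
    using \<phi> by (auto simp: test_functions_def)
  obtain s where s: "s \<in> S" using S by auto
  \<comment> \<open>Adding a point of \<open>S\<close> keeps the set nonempty even for the zero test
    function.\<close>
  obtain L where L: "L = insert s K" by blast
  then have "compact L" "L \<noteq> {}" "L \<subseteq> S" using K(2,3) s by auto
  obtain c where c: "c \<in> L" "\<forall>x\<in>L. c \<le> x"
    using compact_attains_inf[OF \<open>compact L\<close> \<open>L \<noteq> {}\<close>] by blast
  obtain d where d: "d \<in> L" "\<forall>x\<in>L. x \<le> d"
    using compact_attains_sup[OF \<open>compact L\<close> \<open>L \<noteq> {}\<close>] by blast
  note cd = c(1) d(1) c(2) d(2)
  have "c \<in> S" "d \<in> S" using cd(1,2) \<open>L \<subseteq> S\<close> by (simp_all only: subsetD)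
  obtain e1 where e1: "e1 > 0" "cball c e1 \<subseteq> S"
    using S(1) \<open>c \<in> S\<close> unfolding open_contains_cball by blast
  obtain e2 where e2: "e2 > 0" "cball d e2 \<subseteq> S"
    using S(1) \<open>d \<in> S\<close> unfolding open_contains_cball by blast
  note e = e1 e2
  have "c - e1 \<in> cball c e1" "d + e2 \<in> cball d e2"
    using e(1,3) by (auto simp: dist_real_def)
  then have "{c - e1..d + e2} \<subseteq> S"
    by (intro is_interval_Icc_subset[OF S(2)] subsetD[OF e(2)] subsetD[OF e(4)])
  moreover have "x \<notin> K" if "x \<notin> {c - e1<..<d + e2}" for x
  proof
    assume "x \<in> K"
    then have "c \<le> x" "x \<le> d" using cd L by blast+
    with that e(1,3) show False by simp
  qed
  moreover have "c - e1 < d + e2" using cd(3)[rule_format, OF cd(2)] e(1,3) by linarith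
  ultimately show thesis
    using test_functions_deriv_0[OF \<phi>, folded K(1)] that[of "c - e1" "d + e2"] by metis
qed

lemma set_integral_restrict_support:
  fixes F :: "real \<Rightarrow> 'b::{banach, second_countable_topology}"
  assumes "A \<subseteq> S" "\<And>x. x \<notin> A \<Longrightarrow> F x = 0"
  shows "(LINT t:S|lborel. F t) = (LINT t:A|lborel. F t)"
  unfolding set_lebesgue_integral_def
  by (rule Bochner_Integration.integral_cong) (use assms in \<open>auto simp: indicator_def\<close>)

text \<open>Fubini's theorem on the triangle \<open>a \<le> y \<le> x \<le> b\<close>.\<close>

lemma primitive_on_integration_by_parts:
  fixes g :: "real \<Rightarrow> complex"
  assumes ab: "a \<le> b" and P: "primitive_on {a..b} f g"
    and \<phi>: "\<And>x. (\<phi> has_real_derivative \<phi>' x) (at x)" "continuous_on UNIV \<phi>'"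
    and 0: "\<phi> a = 0" "\<phi> b = 0"
  shows "(LINT t:{a..b}|lborel. \<phi>' t *\<^sub>R f t) = - (LINT t:{a..b}|lborel. \<phi> t *\<^sub>R g t)"
proof -
  have g: "set_integrable lborel {a..b} g"
    by (rule primitive_onD(1)[OF P]) (use ab in simp_all)
  have f: "f z = f a + (LINT t:{a..z}|lborel. g t)" if "z \<in> {a..b}" for z
    by (rule primitive_onD(2)[OF P]) (use ab that in simp_all)
  define G where "G y = indicator {a..b} y *\<^sub>R g y" for y
  have G: "integrable lborel G" using g by (simp add: set_integrable_def G_def[abs_def])
  then have Gm[measurable]: "G \<in> borel_measurable borel" by auto
  have p'm[measurable]: "\<phi>' \<in> borel_measurable borel"
    by (rule borel_measurable_continuous_onI[OF \<phi>(2)])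
  have "bounded (\<phi>' ` {a..b})"
    by (rule compact_imp_bounded[OF compact_continuous_image[OF continuous_on_subset[OF \<phi>(2)] compact_Icc]]) simp
  then obtain B where "\<forall>y\<in>\<phi>' ` {a..b}. norm y \<le> B" unfolding bounded_iff by blast
  then have B: "\<bar>\<phi>' x\<bar> \<le> B" if "x \<in> {a..b}" for x using that by simp
  have B0: "0 \<le> B" using B[of a] ab by auto
  \<comment> \<open>Integrating \<open>k\<close> over \<open>y\<close> first gives
    \<open>\<phi>' x\<close> times \<open>f x - f a\<close>; over \<open>x\<close> first it gives
    \<open>g y\<close> times \<open>\<phi> b - \<phi> y\<close>, that is, minus
    \<open>\<phi> y\<close> times \<open>g y\<close>.\<close>
  define k where "k x y = (indicator {a..b} x * (if y \<le> x then 1 else 0) * \<phi>' x) *\<^sub>R G y" for x y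
  have km: "(\<lambda>(x, y). k x y) \<in> borel_measurable (lborel \<Otimes>\<^sub>M lborel)"
  proof -
    let ?M = "lborel \<Otimes>\<^sub>M lborel :: (real \<times> real) measure"
    have "fst \<in> ?M \<rightarrow>\<^sub>M lborel" by (rule measurable_fst)
    then have fst: "fst \<in> borel_measurable ?M" by (simp only: measurable_lborel1)
    have "snd \<in> ?M \<rightarrow>\<^sub>M lborel" by (rule measurable_snd)
    then have snd: "snd \<in> borel_measurable ?M" by (simp only: measurable_lborel1)
    have "indicat_real {a..b} \<in> borel_measurable borel" by simp
    note measurable_compose[OF fst this]
    moreover note measurable_compose[OF fst p'm]
    moreover note measurable_compose[OF snd Gm]
    moreover have "(\<lambda>p::real\<times>real. if snd p \<le> fst p then 1 else 0 :: real) \<in> borel_measurable ?M"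
      using fst snd by (intro measurable_If borel_measurable_const borel_measurable_le)
    ultimately show ?thesis
      unfolding k_def case_prod_beta by (intro borel_measurable_scaleR borel_measurable_times)
  qed
  have bound: "norm (k x y) \<le> (indicator {a..b} x * B) * norm (G y)" for x y
  proof -
    have "\<bar>indicator {a..b} x * (if y \<le> x then 1 else 0) * \<phi>' x\<bar> \<le> indicator {a..b} x * B"
      using B[of x] B0 by (cases "x \<in> {a..b}"; cases "y \<le> x"; simp)
    then show ?thesis unfolding norm_scaleR k_def by (rule mult_right_mono) simp
  qed
  have ki: "integrable (lborel \<Otimes>\<^sub>M lborel) (\<lambda>(x, y). k x y)"
  proof (rule lborel_pair.Fubini_integrable[OF km])
    have g1: "integrable lborel (\<lambda>y. k x y)" for x
    proof -
      have "integrable lborel (\<lambda>y. (indicator {a..b} x * \<phi>' x) *\<^sub>R (indicator {..x} y *\<^sub>R G y))"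
        by (intro integrable_scaleR_right integrable_mult_indicator G) simp
      moreover have "k x y = (indicator {a..b} x * \<phi>' x) *\<^sub>R (indicator {..x} y *\<^sub>R G y)" for y
        by (simp add: k_def indicator_def)
      ultimately show ?thesis by (simp only:)
    qed
    then show "AE x in lborel. integrable lborel (\<lambda>y. case (x, y) of (x, y) \<Rightarrow> k x y)" by simp
    have "integrable lborel (indicat_real {a..b})"
      by (rule integrable_real_indicator) (simp_all add: emeasure_lborel_Icc_eq)
    then have "integrable lborel (\<lambda>x. (indicat_real {a..b} x * B) * (LINT y|lborel. norm (G y)))"
      by (intro integrable_mult_left)
    then show "integrable lborel (\<lambda>x. LINT y|lborel. norm (case (x, y) of (x, y) \<Rightarrow> k x y))"
    proof (rule Bochner_Integration.integrable_bound)
      have "(\<lambda>(x, y). norm (k x y)) \<in> borel_measurable (lborel \<Otimes>\<^sub>M lborel)"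
        using measurable_compose[OF km borel_measurable_norm] by (simp add: split_beta)
      then show "(\<lambda>x. LINT y|lborel. norm (case (x, y) of (x, y) \<Rightarrow> k x y)) \<in> borel_measurable lborel"
        by (intro lborel.borel_measurable_lebesgue_integral) simp
      have "(LINT y|lborel. norm (k x y)) \<le> (indicator {a..b} x * B) * (LINT y|lborel. norm (G y))" for x
      proof -
        have "(LINT y|lborel. norm (k x y)) \<le> (LINT y|lborel. (indicator {a..b} x * B) * norm (G y))"
          by (intro integral_mono integrable_norm g1 integrable_mult_right G bound)
        then show ?thesis by simp
      qed
      then show "AE x in lborel. norm (LINT y|lborel. norm (case (x, y) of (x, y) \<Rightarrow> k x y))
          \<le> norm ((indicat_real {a..b} x * B) * (LINT y|lborel. norm (G y)))"
        using B0 by (intro AE_I2) (simp add: abs_of_nonneg integral_nonneg)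
    qed
  qed
  have \<phi>ab: "set_integrable lborel {a..b} \<phi>'" "(LINT t:{a..b}|lborel. \<phi>' t) = 0"
    using set_integral_deriv[OF ab \<phi>(1) continuous_on_subset[OF \<phi>(2)]] 0 by auto
  have "(LINT t:{a..b}|lborel. \<phi>' t *\<^sub>R f t) =
      (LINT x|lborel. (indicator {a..b} x * \<phi>' x) *\<^sub>R f a + (LINT y|lborel. k x y))"
    unfolding set_lebesgue_integral_def
  proof (rule Bochner_Integration.integral_cong[OF refl])
    fix x :: real
    show "indicator {a..b} x *\<^sub>R \<phi>' x *\<^sub>R f x = (indicator {a..b} x * \<phi>' x) *\<^sub>R f a + (LINT y|lborel. k x y)"
    proof (cases "x \<in> {a..b}")
      case True
      have "(LINT y|lborel. k x y) = (LINT y|lborel. \<phi>' x *\<^sub>R (indicator {a..x} y *\<^sub>R g y))"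
        by (rule Bochner_Integration.integral_cong) (use True in \<open>auto simp: indicator_def k_def G_def\<close>)
      also have "\<dots> = \<phi>' x *\<^sub>R (LINT t:{a..x}|lborel. g t)"
        unfolding set_lebesgue_integral_def by (rule integral_scaleR_right)
      finally show ?thesis using True f[OF True] by (simp add: scaleR_add_right)
    qed (simp add: k_def)
  qed
  also have "\<dots> = (LINT x|lborel. (indicator {a..b} x * \<phi>' x) *\<^sub>R f a) + (LINT x|lborel. LINT y|lborel. k x y)"
    using \<phi>ab(1) lborel_pair.integrable_fst[OF ki]
    by (intro Bochner_Integration.integral_add integrable_scaleR_left) (auto simp: set_integrable_def)
  \<comment> \<open>The constant \<open>f a\<close> contributes nothing, because
    \<open>\<phi>'\<close> has integral \<open>\<phi> b - \<phi> a = 0\<close>.\<close>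
  also have "(LINT x|lborel. (indicator {a..b} x * \<phi>' x) *\<^sub>R f a) = 0"
    using \<phi>ab by (subst integral_scaleR_left) (auto simp: set_lebesgue_integral_def set_integrable_def)
  also have "(LINT x|lborel. LINT y|lborel. k x y) = (LINT y|lborel. LINT x|lborel. k x y)"
    by (rule lborel_pair.Fubini_integral[symmetric]) (use ki in \<open>simp add: split_beta\<close>)
  also have "\<dots> = (LINT y|lborel. - (indicator {a..b} y *\<^sub>R \<phi> y *\<^sub>R g y))"
  proof (rule Bochner_Integration.integral_cong[OF refl])
    fix y :: real
    show "(LINT x|lborel. k x y) = - (indicator {a..b} y *\<^sub>R \<phi> y *\<^sub>R g y)"
    proof (cases "y \<in> {a..b}")
      case True
      have *: "set_integrable lborel {y..b} \<phi>'" "(LINT t:{y..b}|lborel. \<phi>' t) = - \<phi> y"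
        using set_integral_deriv[of y b, OF _ \<phi>(1) continuous_on_subset[OF \<phi>(2)]] 0 True by auto
      have "(LINT x|lborel. k x y) = (LINT x|lborel. (indicator {y..b} x * \<phi>' x) *\<^sub>R g y)"
        by (rule Bochner_Integration.integral_cong) (use True in \<open>auto simp: indicator_def k_def G_def\<close>)
      also have "\<dots> = (LINT t:{y..b}|lborel. \<phi>' t) *\<^sub>R g y"
        using * by (subst integral_scaleR_left) (auto simp: set_lebesgue_integral_def set_integrable_def)
      finally show ?thesis using True * by simp
    qed (simp add: k_def G_def)
  qed
  finally show ?thesis by (simp add: set_lebesgue_integral_def)
qed

lemma locally_integrable_onI:
  assumes S: "is_interval S"
    and f: "\<And>x y. x \<in> S \<Longrightarrow> y \<in> S \<Longrightarrow> x \<le> y \<Longrightarrow> set_integrable lborel {x..y} f"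
  shows "locally_integrable_on f S"
  unfolding locally_integrable_on_def
proof (intro allI impI)
  fix K assume K: "compact K \<and> K \<subseteq> S"
  show "set_integrable lborel K f"
  proof (cases "K = {}")
    case False
    obtain c where c: "c \<in> K" "\<forall>x\<in>K. c \<le> x" using compact_attains_inf[of K] K False by metis
    obtain d where d: "d \<in> K" "\<forall>x\<in>K. x \<le> d" using compact_attains_sup[of K] K False by metis
    show ?thesis
      by (rule set_integrable_subset[OF f[of c d]])
        (use c d K in \<open>auto intro: borel_closed compact_imp_closed\<close>)
  qed (simp add: set_integrable_def)
qed

lemma primitive_on_locally_integrable:
  assumes S: "is_interval S" and P: "primitive_on S f g"
  shows "locally_integrable_on f S" "locally_integrable_on g S"
proof -
  show "locally_integrable_on g S"
    by (rule locally_integrable_onI[OF S]) (use P in \<open>auto simp: primitive_on_def\<close>)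
  show "locally_integrable_on f S"
  proof (rule locally_integrable_onI[OF S])
    fix x y assume "x \<in> S" "y \<in> S"
    then have "continuous_on {x..y} f"
      by (intro primitive_on_continuous[OF primitive_on_subset[OF P]] is_interval_Icc_subset[OF S])
    then show "set_integrable lborel {x..y} f"
      by (rule borel_integrable_atLeastAtMost')
  qed
qed

lemma primitive_on_imp_weak_derivative:
  assumes S: "open S" "is_interval S" and P: "primitive_on S f g"
  shows "has_weak_derivative S f g"
  unfolding has_weak_derivative_def
proof (intro conjI ballI)
  show "locally_integrable_on f S" "locally_integrable_on g S"
    using primitive_on_locally_integrable[OF S(2) P] by auto
  fix \<phi> assume \<phi>: "\<phi> \<in> test_functions S"
  show "(LINT t:S|lborel. deriv \<phi> t *\<^sub>R f t) = - (LINT t:S|lborel. \<phi> t *\<^sub>R g t)"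
  proof (cases "S = {}")
    case False
    obtain a b where ab: "a < b" "{a..b} \<subseteq> S" and 0: "\<And>x. x \<notin> {a<..<b} \<Longrightarrow> \<phi> x = 0 \<and> deriv \<phi> x = 0"
      using test_functions_support[OF \<phi> S False] by metis
    have "(LINT t:S|lborel. deriv \<phi> t *\<^sub>R f t) = (LINT t:{a..b}|lborel. deriv \<phi> t *\<^sub>R f t)"
      by (rule set_integral_restrict_support[OF ab(2)]) (use 0 in auto)
    also have "\<dots> = - (LINT t:{a..b}|lborel. \<phi> t *\<^sub>R g t)"
      by (rule primitive_on_integration_by_parts)
        (use ab 0 test_functions_deriv[OF \<phi>] in \<open>auto intro: primitive_on_subset[OF P]\<close>)
    also have "(LINT t:{a..b}|lborel. \<phi> t *\<^sub>R g t) = (LINT t:S|lborel. \<phi> t *\<^sub>R g t)"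
      by (rule set_integral_restrict_support[OF ab(2), symmetric]) (use 0 in auto)
    finally show ?thesis .
  qed (simp add: set_lebesgue_integral_def)
qed


section \<open>Vanishing weak derivatives, uniqueness, and absolutely continuous
  representatives\<close>

lemma tendsto_integral_smooth_bump:
  fixes h :: "real \<Rightarrow> complex"
  assumes "set_integrable lborel {a..b} h"
  shows "(\<lambda>n. LINT t:{a..b}|lborel. smooth_bump a b n t *\<^sub>R h t) \<longlonglongrightarrow> (LINT t:{a..b}|lborel. h t)"
proof -
  define H where "H t = indicator {a..b} t *\<^sub>R h t" for t
  have H: "integrable lborel H" using assms by (simp add: set_integrable_def H_def[abs_def])
  then have Hm [measurable]: "H \<in> borel_measurable borel" by auto
  have "(\<lambda>n. LINT t|lborel. smooth_bump a b n t *\<^sub>R H t) \<longlonglongrightarrow> (LINT t|lborel. H t)"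
  proof (rule integral_dominated_convergence[where w="\<lambda>t. norm (H t)"])
    show "integrable lborel (\<lambda>t. norm (H t))" by (rule integrable_norm[OF H])
    show "AE t in lborel. norm (smooth_bump a b n t *\<^sub>R H t) \<le> norm (H t)" for n
    proof (rule AE_I2)
      fix t
      have "\<bar>smooth_bump a b n t\<bar> * norm (H t) \<le> 1 * norm (H t)"
        using smooth_bump_bounds[of a b n t] by (intro mult_right_mono) auto
      then show "norm (smooth_bump a b n t *\<^sub>R H t) \<le> norm (H t)" by simp
    qed
    show "AE t in lborel. (\<lambda>n. smooth_bump a b n t *\<^sub>R H t) \<longlonglongrightarrow> H t"
      using AE_lborel_singleton[of a] AE_lborel_singleton[of b]
    proof eventually_elim
      case (elim t)
      then have "indicat_real {a<..<b} t *\<^sub>R H t = H t" by (auto simp: H_def indicator_def)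
      then show ?case
        using tendsto_scaleR[OF tendsto_smooth_bump[of a b t] tendsto_const[of "H t"]] by simp
    qed
    show "H \<in> borel_measurable lborel" using Hm by simp
    show "(\<lambda>t. smooth_bump a b n t *\<^sub>R H t) \<in> borel_measurable lborel" for n
      using borel_measurable_scaleR[OF smooth_bump_measurable[of a b n] Hm] by simp
  qed
  moreover have "indicator {a..b} t *\<^sub>R smooth_bump a b n t *\<^sub>R h t = smooth_bump a b n t *\<^sub>R H t" for t n
    by (simp add: H_def)
  ultimately show ?thesis unfolding set_lebesgue_integral_def H_def[symmetric] by simp
qed

lemma tendsto_integral_smooth_bump_real:
  assumes "a \<le> b"
  shows "(\<lambda>n. LINT t:{a..b}|lborel. smooth_bump a b n t) \<longlonglongrightarrow> b - a"
proof -
  have "(\<lambda>n. LINT t:{a..b}|lborel. smooth_bump a b n t *\<^sub>R (1 :: complex)) \<longlonglongrightarrow> (LINT t:{a..b}|lborel. 1)"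
    by (rule tendsto_integral_smooth_bump) (rule borel_integrable_atLeastAtMost', simp)
  moreover have "(LINT t:{a..b}|lborel. smooth_bump a b n t *\<^sub>R (1 :: complex)) =
      complex_of_real (LINT t:{a..b}|lborel. smooth_bump a b n t)" for n
    unfolding set_lebesgue_integral_def integral_complex_of_real[symmetric]
    by (rule Bochner_Integration.integral_cong) (simp_all add: scaleR_conv_of_real)
  moreover have "(LINT t:{a..b}|lborel. (1 :: complex)) = complex_of_real (b - a)"
    using assms by (simp add: set_lebesgue_integral_def scaleR_conv_of_real)
  ultimately have "(\<lambda>n. complex_of_real (LINT t:{a..b}|lborel. smooth_bump a b n t)) \<longlonglongrightarrow> complex_of_real (b - a)"
    by (simp only:)
  then show ?thesis unfolding tendsto_of_real_iff .
qed

text \<open>An open set is covered by the countably many compact intervals with rational ends that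
  it contains. Intervals that degenerate to a point are null, so the hypothesis may be restricted to
  \<open>a < b\<close>.\<close>

lemma AE_open_intervalI:
  assumes S: "open S" and *: "\<And>a b. a < b \<Longrightarrow> {a..b} \<subseteq> S \<Longrightarrow> AE t in lborel. t \<in> {a..b} \<longrightarrow> P t"
  shows "AE t in lborel. t \<in> (S :: real set) \<longrightarrow> P t"
proof -
  have "AE t in lborel. t \<in> {a..b} \<longrightarrow> P t" if "{a..b} \<subseteq> S" for a b
  proof (cases a b rule: linorder_cases)
    case less
    then show ?thesis using *[OF _ that] by blast
  next
    case equal
    show ?thesis using AE_lborel_singleton[of a] by eventually_elim (use equal in auto)
  qed auto
  then have "AE t in lborel. {real_of_rat p..real_of_rat q} \<subseteq> S \<longrightarrow> t \<in> {real_of_rat p..real_of_rat q} \<longrightarrow> P t"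
    for p q by (cases "{real_of_rat p..real_of_rat q} \<subseteq> S") auto
  then have "AE t in lborel. \<forall>p q. {real_of_rat p..real_of_rat q} \<subseteq> S \<longrightarrow> t \<in> {real_of_rat p..real_of_rat q} \<longrightarrow> P t"
    by (simp add: AE_all_countable)
  then show ?thesis
  proof eventually_elim
    case (elim t)
    show ?case
    proof
      assume "t \<in> S"
      then obtain e where e: "e > 0" "cball t e \<subseteq> S" using S open_contains_cball_eq by blast
      obtain p where p: "t - e < real_of_rat p" "real_of_rat p < t" using of_rat_dense[of "t - e" t] e by auto
      obtain q where q: "t < real_of_rat q" "real_of_rat q < t + e" using of_rat_dense[of t "t + e"] e by auto
      have "{real_of_rat p..real_of_rat q} \<subseteq> cball t e" using p q by (auto simp: dist_real_def)
      then show "P t" using elim[rule_format, of p q] p q e by auto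
    qed
  qed
qed

lemma set_integral_complex_scaleR:
  fixes h :: "real \<Rightarrow> complex"
  assumes "set_integrable lborel {a..b} h" "continuous_on UNIV \<psi>"
  shows "set_integrable lborel {a..b} (\<lambda>t. \<psi> t *\<^sub>R h t)"
proof -
  have "bounded (\<psi> ` {a..b})"
    by (intro compact_imp_bounded compact_continuous_image continuous_on_subset[OF assms(2)] compact_Icc) simp
  then obtain B where B: "\<forall>y\<in>\<psi> ` {a..b}. norm y \<le> B" unfolding bounded_iff by blast
  define H where "H t = indicator {a..b} t *\<^sub>R h t" for t
  have H: "integrable lborel H" using assms(1) by (simp add: set_integrable_def H_def[abs_def])
  then have Hm: "H \<in> borel_measurable borel" by auto
  have "integrable lborel (\<lambda>t. \<psi> t *\<^sub>R H t)"
  proof (rule Bochner_Integration.integrable_bound[OF integrable_scaleR_right[OF H, of B]])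
    show "(\<lambda>t. \<psi> t *\<^sub>R H t) \<in> borel_measurable lborel"
      using borel_measurable_scaleR[OF borel_measurable_continuous_onI[OF assms(2)] Hm] by simp
    show "AE t in lborel. norm (\<psi> t *\<^sub>R H t) \<le> norm (B *\<^sub>R H t)"
    proof (rule AE_I2)
      fix t
      show "norm (\<psi> t *\<^sub>R H t) \<le> norm (B *\<^sub>R H t)"
      proof (cases "t \<in> {a..b}")
        case True
        then have "\<bar>\<psi> t\<bar> \<le> B" using B by auto
        then have "\<bar>\<psi> t\<bar> \<le> \<bar>B\<bar>" by linarith
        then show ?thesis unfolding norm_scaleR by (simp add: mult_right_mono)
      qed (simp add: H_def)
    qed
  qed
  moreover have "indicator {a..b} t *\<^sub>R \<psi> t *\<^sub>R h t = \<psi> t *\<^sub>R H t" for t by (simp add: H_def)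
  ultimately show ?thesis by (simp add: set_integrable_def)
qed

text \<open>Differences of two normalised bumps are derivatives of test functions; this forces all mean
  values of \<open>h\<close> to agree.\<close>

lemma weak_derivative_0_means:
  fixes h :: "real \<Rightarrow> complex"
  assumes h: "locally_integrable_on h S" and S: "is_interval S"
    and 0: "\<And>\<phi>. \<phi> \<in> test_functions S \<Longrightarrow> (LINT t:S|lborel. deriv \<phi> t *\<^sub>R h t) = 0"
    and ab: "a < b" "{a..b} \<subseteq> S" and cd: "c < d" "{c..d} \<subseteq> S"
  shows "(d - c) *\<^sub>R (LINT t:{a..b}|lborel. h t) = (b - a) *\<^sub>R (LINT t:{c..d}|lborel. h t)"
proof -
  define I where "I x y n = (LINT t:{x..y}|lborel. smooth_bump x y n t)" for x y n
  let ?m = "min a c" and ?M = "max b d"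
  have mM: "{?m..?M} \<subseteq> S" using ab cd S
    by (intro is_interval_Icc_subset[OF S]) (auto simp: min_def max_def subset_iff)
  have hi: "set_integrable lborel {x..y} h" if "{x..y} \<subseteq> S" for x y
    using h that by (auto simp: locally_integrable_on_def)
  have eq: "I c d n *\<^sub>R (LINT t:{a..b}|lborel. smooth_bump a b n t *\<^sub>R h t) =
      I a b n *\<^sub>R (LINT t:{c..d}|lborel. smooth_bump c d n t *\<^sub>R h t)" for n
  proof -
    \<comment> \<open>Each bump is weighted by the mass of the other one. The total integral of
      \<open>\<psi>\<close> is therefore 0, and its primitive, normalised at the left end, has
      compact support.\<close>
    define \<psi> where "\<psi> t = I c d n * smooth_bump a b n t + (- I a b n) * smooth_bump c d n t" for t
    have \<psi>s: "\<psi> \<in> smooth_class"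
      unfolding \<psi>_def[abs_def] by (intro smooth_class.intros smooth_bump_smooth)
    have \<psi>c: "continuous_on A \<psi>" for A by (rule smooth_class_continuous[OF \<psi>s])
    have \<psi>0: "\<psi> t = 0" if "t \<le> ?m \<or> ?M \<le> t" for t
      using that smooth_step_0
      by (auto simp: \<psi>_def smooth_bump_def mult_nonneg_nonpos min_le_iff_disj le_max_iff_disj)
    obtain F where F: "\<And>x. (F has_real_derivative \<psi> x) (at x)"
    proof -
      have "isCont \<psi> x" for x using \<psi>c[of UNIV] by (simp add: continuous_on_eq_continuous_at)
      then have "\<exists>F. \<forall>x::real. -\<infinity> < ereal x \<longrightarrow> ereal x < \<infinity> \<longrightarrow> (F has_vector_derivative \<psi> x) (at x)"
        by (intro einterval_antiderivative) auto
      then show thesis using that by (auto simp: has_real_derivative_iff_has_vector_derivative)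
    qed
    have FTC: "(LINT t:{x..y}|lborel. \<psi> t) = F y - F x" if "x \<le> y" for x y
      by (rule set_integral_deriv(2)[OF that F \<psi>c])
    have F_low: "F x = F ?m" if "x \<le> ?m" for x
    proof -
      have "(LINT t:{x..?m}|lborel. \<psi> t) = (LINT t:{}|lborel. \<psi> t)"
        unfolding set_lebesgue_integral_def
        by (rule Bochner_Integration.integral_cong) (use \<psi>0 in \<open>auto simp: indicator_def\<close>)
      then show ?thesis using FTC[OF that] by (simp add: set_lebesgue_integral_def)
    qed
    have F_high: "F x = F ?m" if x: "?M \<le> x" for x
    proof -
      have mx: "?m \<le> x" using x ab cd by auto
      have bi: "set_integrable lborel {?m..x} (smooth_bump p q n)" for p q
        by (rule borel_integrable_atLeastAtMost'[OF smooth_bump_continuous])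
      have "(LINT t:{?m..x}|lborel. smooth_bump a b n t) = I a b n"
        unfolding I_def by (rule set_integral_restrict_support)
          (use x in \<open>auto simp: smooth_bump_outside\<close>)
      moreover have "(LINT t:{?m..x}|lborel. smooth_bump c d n t) = I c d n"
        unfolding I_def by (rule set_integral_restrict_support)
          (use x in \<open>auto simp: smooth_bump_outside\<close>)
      moreover have "(LINT t:{?m..x}|lborel. \<psi> t) =
          I c d n * (LINT t:{?m..x}|lborel. smooth_bump a b n t) +
          (- I a b n) * (LINT t:{?m..x}|lborel. smooth_bump c d n t)"
        unfolding \<psi>_def using bi[of a b] bi[of c d]
        by (subst set_integral_add) (auto simp only: set_integrable_mult_right set_integral_mult_right intro!: set_integrable_mult_right)
      ultimately show ?thesis using FTC[OF mx] by simp
    qed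
    define \<phi> where "\<phi> x = F x - F ?m" for x
    have "(\<phi> has_real_derivative \<psi> x) (at x)" for x
      unfolding \<phi>_def[abs_def] by (auto intro!: derivative_eq_intros F)
    moreover have "\<phi> x = 0" if "x \<notin> {?m..?M}" for x
    proof (cases "x \<le> ?m")
      case True
      then show ?thesis unfolding \<phi>_def by (simp only: F_low[OF True] diff_self)
    next
      case False
      then have "?M \<le> x" using that by auto
      then show ?thesis unfolding \<phi>_def by (simp only: F_high diff_self)
    qed
    ultimately have "\<phi> \<in> test_functions S" "deriv \<phi> = \<psi>"
      using test_functions_antiderivI[OF \<psi>s _ _ mM] by blast+
    then have "(LINT t:S|lborel. \<psi> t *\<^sub>R h t) = 0" using 0[of \<phi>] by (simp only:)
    moreover have "(LINT t:S|lborel. \<psi> t *\<^sub>R h t) = (LINT t:{?m..?M}|lborel. \<psi> t *\<^sub>R h t)"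
    proof (rule set_integral_restrict_support[OF mM])
      fix t assume "t \<notin> {?m..?M}"
      then have "t \<le> ?m \<or> ?M \<le> t" by auto
      then show "\<psi> t *\<^sub>R h t = 0" by (simp only: \<psi>0 scaleR_zero_left)
    qed
    moreover have "(LINT t:{?m..?M}|lborel. \<psi> t *\<^sub>R h t) =
        (LINT t:{?m..?M}|lborel. I c d n *\<^sub>R (smooth_bump a b n t *\<^sub>R h t)) +
        (LINT t:{?m..?M}|lborel. (- I a b n) *\<^sub>R (smooth_bump c d n t *\<^sub>R h t))"
    proof -
      have "\<psi> t *\<^sub>R h t = I c d n *\<^sub>R (smooth_bump a b n t *\<^sub>R h t) +
          (- I a b n) *\<^sub>R (smooth_bump c d n t *\<^sub>R h t)" for t
        by (simp add: \<psi>_def scaleR_diff_left)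
      moreover have "set_integrable lborel {?m..?M} (\<lambda>t. z *\<^sub>R (smooth_bump p q n t *\<^sub>R h t))" for p q z
        by (intro set_integrable_scaleR_right set_integral_complex_scaleR[OF hi[OF mM]] smooth_bump_continuous)
      ultimately show ?thesis
        by (simp only: set_integral_add(2))
    qed
    moreover have "(LINT t:{?m..?M}|lborel. z *\<^sub>R (smooth_bump p q n t *\<^sub>R h t)) =
        z *\<^sub>R (LINT t:{p..q}|lborel. smooth_bump p q n t *\<^sub>R h t)"
      if "{p..q} \<subseteq> {?m..?M}" for p q z
    proof -
      have "(LINT t:{?m..?M}|lborel. smooth_bump p q n t *\<^sub>R h t) =
          (LINT t:{p..q}|lborel. smooth_bump p q n t *\<^sub>R h t)"
        by (rule set_integral_restrict_support[OF that]) (simp add: smooth_bump_outside)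
      then show ?thesis by (simp only: set_integral_scaleR_right)
    qed
    from this[of a b "I c d n"] this[of c d "- I a b n"]
    have "(LINT t:{?m..?M}|lborel. I c d n *\<^sub>R (smooth_bump a b n t *\<^sub>R h t)) =
        I c d n *\<^sub>R (LINT t:{a..b}|lborel. smooth_bump a b n t *\<^sub>R h t)"
      "(LINT t:{?m..?M}|lborel. (- I a b n) *\<^sub>R (smooth_bump c d n t *\<^sub>R h t)) =
        (- I a b n) *\<^sub>R (LINT t:{c..d}|lborel. smooth_bump c d n t *\<^sub>R h t)"
      by auto
    ultimately show ?thesis by simp
  qed
  \<comment> \<open>For large \<open>n\<close> the bumps become indicators and their masses the
    lengths of the intervals.\<close>
  have "(\<lambda>n. I c d n *\<^sub>R (LINT t:{a..b}|lborel. smooth_bump a b n t *\<^sub>R h t))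
      \<longlonglongrightarrow> (d - c) *\<^sub>R (LINT t:{a..b}|lborel. h t)"
    unfolding I_def using ab cd
    by (intro tendsto_scaleR tendsto_integral_smooth_bump tendsto_integral_smooth_bump_real hi) auto
  moreover have "(\<lambda>n. I c d n *\<^sub>R (LINT t:{a..b}|lborel. smooth_bump a b n t *\<^sub>R h t))
      \<longlonglongrightarrow> (b - a) *\<^sub>R (LINT t:{c..d}|lborel. h t)"
    unfolding eq unfolding I_def using ab cd
    by (intro tendsto_scaleR tendsto_integral_smooth_bump tendsto_integral_smooth_bump_real hi) auto
  ultimately show ?thesis by (rule LIMSEQ_unique)
qed

text \<open>\<open>C\<close> is the mean of \<open>h\<close> over one fixed interval inside
  \<open>S\<close>. All other means agree with it, so \<open>h - C\<close> has integral 0 over every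
  subinterval and vanishes almost everywhere.\<close>

lemma weak_derivative_0_imp_constant:
  assumes S: "open S" "is_interval S" and w: "has_weak_derivative S h (\<lambda>t. 0)"
  shows "\<exists>C. AE t in lborel. t \<in> S \<longrightarrow> h t = C"
proof (cases "S = {}")
  case False
  then obtain s where "s \<in> S" by blast
  then obtain e where e: "e > 0" "cball s e \<subseteq> S" using S(1) open_contains_cball_eq by blast
  define c d where "c = s" and "d = s + e"
  have cd: "c < d" "{c..d} \<subseteq> S" using e by (auto simp: c_def d_def subset_iff dist_real_def)
  have h: "locally_integrable_on h S" using w by (simp add: has_weak_derivative_def)
  have 0: "(LINT t:S|lborel. deriv \<phi> t *\<^sub>R h t) = 0" if "\<phi> \<in> test_functions S" for \<phi>
    using w that by (auto simp: has_weak_derivative_def)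
  define C where "C = (LINT t:{c..d}|lborel. h t) /\<^sub>R (d - c)"
  have hi: "set_integrable lborel {x..y} h" if "{x..y} \<subseteq> S" for x y
    using h that by (auto simp: locally_integrable_on_def)
  have ci: "set_integrable lborel {x..y} (\<lambda>t. C)" for x y :: real
    by (rule borel_integrable_atLeastAtMost') simp
  have "AE t in lborel. t \<in> S \<longrightarrow> h t - C = 0"
  proof (rule AE_open_intervalI[OF S(1)])
    fix a b :: real assume "a < b" and ab: "{a..b} \<subseteq> S"
    show "AE t in lborel. t \<in> {a..b} \<longrightarrow> h t - C = 0"
    proof (rule AE_eq_0_if_subinterval_integrals_eq_0)
      show "set_integrable lborel {a..b} (\<lambda>t. h t - C)"
        by (rule set_integral_diff(1)[OF hi[OF ab] ci])
      fix x y assume xy: "a \<le> x" "x \<le> y" "y \<le> b"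
      have xyS: "{x..y} \<subseteq> S" using ab xy by (auto simp: subset_iff)
      have "(LINT t:{x..y}|lborel. h t - C) = (LINT t:{x..y}|lborel. h t) - (LINT t:{x..y}|lborel. C)"
        by (rule set_integral_diff(2)[OF hi[OF xyS] ci])
      also have "(LINT t:{x..y}|lborel. C) = (y - x) *\<^sub>R C"
        using xy by (simp add: set_lebesgue_integral_def)
      also have "(LINT t:{x..y}|lborel. h t) = (y - x) *\<^sub>R C"
      proof (cases "x < y")
        case True
        have "(LINT t:{x..y}|lborel. h t) = (1 / (d - c)) *\<^sub>R ((d - c) *\<^sub>R (LINT t:{x..y}|lborel. h t))"
          using cd by simp
        also have "\<dots> = (1 / (d - c)) *\<^sub>R ((y - x) *\<^sub>R (LINT t:{c..d}|lborel. h t))"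
          using weak_derivative_0_means[OF h S(2) 0 True xyS cd] by simp
        finally show ?thesis by (simp add: C_def divide_inverse mult.commute)
      next
        case False
        then have "x = y" using xy by simp
        then show ?thesis
          unfolding set_lebesgue_integral_def
          by (simp, intro integral_eq_zero_AE) (use AE_lborel_singleton[of y] in \<open>auto elim!: eventually_mono\<close>)
      qed
      finally show "(LINT t:{x..y}|lborel. h t - C) = 0" by simp
    qed
  qed
  then show ?thesis by (intro exI[of _ C]) (auto elim: eventually_mono)
qed auto

lemma set_integral_scaleR_locally_integrable:
  assumes "\<phi> \<in> test_functions S" "open S" "is_interval S" "locally_integrable_on f S"
    and "\<psi> = \<phi> \<or> \<psi> = deriv \<phi>"
  shows "set_integrable lborel S (\<lambda>t. \<psi> t *\<^sub>R f t)"
proof (cases "S = {}")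
  case False
  obtain a b where ab: "{a..b} \<subseteq> S" and 0: "\<And>x. x \<notin> {a<..<b} \<Longrightarrow> \<phi> x = 0 \<and> deriv \<phi> x = 0"
    using test_functions_support[OF assms(1-3) False] by metis
  have "set_integrable lborel {a..b} f" using assms(4) ab by (auto simp: locally_integrable_on_def)
  then have "set_integrable lborel {a..b} (\<lambda>t. \<psi> t *\<^sub>R f t)"
    by (rule set_integral_complex_scaleR) (use test_functions_deriv[OF assms(1)] assms(5) in auto)
  moreover have "indicator S t *\<^sub>R \<psi> t *\<^sub>R f t = indicator {a..b} t *\<^sub>R \<psi> t *\<^sub>R f t" for t
  proof (cases "t \<in> {a..b}")
    case False
    then show ?thesis using 0[of t] assms(5) by auto
  qed (use ab in auto)
  ultimately show ?thesis unfolding set_integrable_def by (simp only:)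
qed (simp add: set_integrable_def)

lemma has_weak_derivative_lincomb:
  assumes S: "open S" "is_interval S"
    and f: "has_weak_derivative S f g" "has_weak_derivative S f' g'"
  shows "has_weak_derivative S (\<lambda>t. f t + c * f' t) (\<lambda>t. g t + c * g' t)"
proof -
  have li: "locally_integrable_on (\<lambda>t. u t + c * v t) S"
    if "locally_integrable_on u S" "locally_integrable_on v S" for u v
    using that unfolding locally_integrable_on_def
    by (auto intro!: set_integral_add set_integrable_mult_right)
  have int: "(LINT t:S|lborel. \<psi> t *\<^sub>R (u t + c * v t)) =
      (LINT t:S|lborel. \<psi> t *\<^sub>R u t) + c * (LINT t:S|lborel. \<psi> t *\<^sub>R v t)"
    if "\<phi> \<in> test_functions S" "\<psi> = \<phi> \<or> \<psi> = deriv \<phi>"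
      "locally_integrable_on u S" "locally_integrable_on v S" for \<phi> \<psi> u v
  proof -
    have *: "\<psi> t *\<^sub>R (u t + c * v t) = \<psi> t *\<^sub>R u t + c * (\<psi> t *\<^sub>R v t)" for t
      by (simp add: scaleR_add_right)
    have "(LINT t:S|lborel. \<psi> t *\<^sub>R u t + c * (\<psi> t *\<^sub>R v t)) =
        (LINT t:S|lborel. \<psi> t *\<^sub>R u t) + (LINT t:S|lborel. c * (\<psi> t *\<^sub>R v t))"
      by (intro set_integral_add(2) set_integrable_mult_right
          set_integral_scaleR_locally_integrable[OF that(1) S _ that(2)] that)
    then show ?thesis unfolding * by (simp only: set_integral_mult_right)
  qed
  show ?thesis
    unfolding has_weak_derivative_def
  proof (intro conjI ballI)
    fix \<phi> assume \<phi>: "\<phi> \<in> test_functions S"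
    show "(LINT t:S|lborel. deriv \<phi> t *\<^sub>R (f t + c * f' t)) = - (LINT t:S|lborel. \<phi> t *\<^sub>R (g t + c * g' t))"
      using f \<phi> by (simp add: int[OF \<phi>] has_weak_derivative_def)
  qed (use f li in \<open>auto simp: has_weak_derivative_def\<close>)
qed

text \<open>Testing with bumps and letting them tend to an indicator equates the integrals of
  \<open>g\<close> and \<open>g'\<close> over every compact subinterval. Starting from functions
  that agree only almost everywhere is what makes forms well defined on classes.\<close>

lemma has_weak_derivative_unique:
  assumes S: "open S" "is_interval S"
    and f: "has_weak_derivative S f g" "has_weak_derivative S f' g'"
    and ff': "AE t in lborel. t \<in> S \<longrightarrow> f t = f' t"
  shows "AE t in lborel. t \<in> S \<longrightarrow> g t = g' t"
proof -
  have fl: "locally_integrable_on f S" "locally_integrable_on f' S"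
    and gl: "locally_integrable_on g S" "locally_integrable_on g' S"
    using f by (auto simp: has_weak_derivative_def)
  have eq: "(LINT t:S|lborel. \<phi> t *\<^sub>R g t) = (LINT t:S|lborel. \<phi> t *\<^sub>R g' t)"
    if \<phi>: "\<phi> \<in> test_functions S" for \<phi>
  proof -
    note i = set_integral_scaleR_locally_integrable[OF \<phi> S fl(1), of "deriv \<phi>"]
      set_integral_scaleR_locally_integrable[OF \<phi> S fl(2), of "deriv \<phi>"]
    have "(LINT t:S|lborel. deriv \<phi> t *\<^sub>R f t) = (LINT t:S|lborel. deriv \<phi> t *\<^sub>R f' t)"
      unfolding set_lebesgue_integral_def
    proof (rule integral_cong_AE)
      show "(\<lambda>t. indicator S t *\<^sub>R deriv \<phi> t *\<^sub>R f t) \<in> borel_measurable lborel"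
        "(\<lambda>t. indicator S t *\<^sub>R deriv \<phi> t *\<^sub>R f' t) \<in> borel_measurable lborel"
        using i by (auto simp: set_integrable_def)
      show "AE t in lborel. indicator S t *\<^sub>R deriv \<phi> t *\<^sub>R f t = indicator S t *\<^sub>R deriv \<phi> t *\<^sub>R f' t"
        using ff' by eventually_elim (auto simp: indicator_def)
    qed
    then show ?thesis using f \<phi> by (auto simp: has_weak_derivative_def)
  qed
  have gi: "set_integrable lborel {x..y} g" "set_integrable lborel {x..y} g'" if "{x..y} \<subseteq> S" for x y
    using gl that by (auto simp: locally_integrable_on_def)
  have "AE t in lborel. t \<in> S \<longrightarrow> g t - g' t = 0"
  proof (rule AE_open_intervalI[OF S(1)])
    fix a b :: real assume "a < b" and ab: "{a..b} \<subseteq> S"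
    show "AE t in lborel. t \<in> {a..b} \<longrightarrow> g t - g' t = 0"
    proof (rule AE_eq_0_if_subinterval_integrals_eq_0)
      show "set_integrable lborel {a..b} (\<lambda>t. g t - g' t)"
        by (rule set_integral_diff(1)[OF gi[OF ab]])
      fix x y assume xy: "a \<le> x" "x \<le> y" "y \<le> b"
      have xyS: "{x..y} \<subseteq> S" using ab xy by (auto simp: subset_iff)
      have bump: "(LINT t:S|lborel. smooth_bump x y n t *\<^sub>R u t) =
          (LINT t:{x..y}|lborel. smooth_bump x y n t *\<^sub>R u t)" for n and u :: "real \<Rightarrow> complex"
        by (rule set_integral_restrict_support[OF xyS]) (simp add: smooth_bump_outside)
      have "smooth_bump x y n \<in> test_functions S" for n
        by (rule test_functionsI[OF smooth_bump_smooth smooth_bump_outside xyS])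
      from eq[OF this] have "(LINT t:{x..y}|lborel. g t) = (LINT t:{x..y}|lborel. g' t)"
        unfolding bump
        using tendsto_integral_smooth_bump[OF gi(1)[OF xyS]] tendsto_integral_smooth_bump[OF gi(2)[OF xyS]]
        by (simp add: LIMSEQ_unique)
      then show "(LINT t:{x..y}|lborel. g t - g' t) = 0"
        using set_integral_diff(2)[OF gi[OF xyS]] by simp
    qed
  qed
  then show ?thesis by simp
qed

text \<open>The base point may lie anywhere in \<open>I\<close>, hence the two signs in
  \<open>F\<close> and the three positions of \<open>s\<close> relative to \<open>x\<close> and
  \<open>y\<close>.\<close>

lemma primitive_on_Icc_exists:
  fixes g :: "real \<Rightarrow> complex"
  assumes g: "\<And>x y. x \<in> I \<Longrightarrow> y \<in> I \<Longrightarrow> x \<le> y \<Longrightarrow> set_integrable lborel {x..y} g" and s: "s \<in> I"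
  shows "\<exists>F. primitive_on I F g \<and> F s = C"
proof -
  define F where "F x = (if s \<le> x then C + (LINT t:{s..x}|lborel. g t) else C - (LINT t:{x..s}|lborel. g t))" for x
  have "F y - F x = (LINT t:{x..y}|lborel. g t)" if xy: "x \<in> I" "y \<in> I" "x \<le> y" for x y
  proof -
    consider "s \<le> x" | "x < s" "s \<le> y" | "y < s" by linarith
    then show ?thesis
    proof cases
      case 1
      then show ?thesis
        using set_integral_combine_Icc[OF g[OF s xy(2)] 1 xy(3)] xy by (simp add: F_def)
    next
      case 2
      then show ?thesis
        using set_integral_combine_Icc[OF g[OF xy], of s] by (simp add: F_def)
    next
      case 3
      then show ?thesis
        using set_integral_combine_Icc[OF g[OF xy(1) s] xy(3)] xy by (simp add: F_def)
    qed
  qed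
  then have "primitive_on I F g" using g by (simp add: primitive_on_def)
  moreover have "F s = C"
  proof -
    have "(LINT t:{s}|lborel. g t) = 0"
      unfolding set_lebesgue_integral_def
      by (intro integral_eq_zero_AE) (use AE_lborel_singleton[of s] in \<open>auto elim!: eventually_mono\<close>)
    then show ?thesis by (simp add: F_def)
  qed
  ultimately show ?thesis by blast
qed

text \<open>The difference of \<open>f\<close> and any primitive of \<open>g\<close> has weak
  derivative 0, so it is a constant, which is added to the primitive. The set \<open>I\<close> may
  contain end points missing from \<open>S\<close>; integrability of \<open>g\<close> up to them
  extends the primitive there.\<close>

lemma weak_derivative_imp_AE_primitive:
  assumes S: "open S" "is_interval S" and I: "S \<subseteq> I" and w: "has_weak_derivative S f g"
    and g: "\<And>x y. x \<in> I \<Longrightarrow> y \<in> I \<Longrightarrow> x \<le> y \<Longrightarrow> set_integrable lborel {x..y} g"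
  shows "\<exists>F. primitive_on I F g \<and> (AE t in lborel. t \<in> S \<longrightarrow> f t = F t)"
proof (cases "S = {}")
  case True
  show ?thesis
  proof (cases "I = {}")
    case True
    then show ?thesis using I by (auto simp: primitive_on_def)
  next
    case False
    then show ?thesis using primitive_on_Icc_exists[of I g] g \<open>S = {}\<close> by blast
  qed
next
  case False
  then obtain s where s: "s \<in> S" by blast
  then obtain F where F: "primitive_on I F g" using primitive_on_Icc_exists[of I g s] g I by blast
  have "has_weak_derivative S F g"
    by (rule primitive_on_imp_weak_derivative[OF S primitive_on_subset[OF F I]])
  from has_weak_derivative_lincomb[OF S w this, of "-1"]
  have "has_weak_derivative S (\<lambda>t. f t - F t) (\<lambda>t. 0)" by simp
  from weak_derivative_0_imp_constant[OF S this]
  obtain C where C: "AE t in lborel. t \<in> S \<longrightarrow> f t - F t = C" by blast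
  have "primitive_on I (\<lambda>t. F t + C) g" using F by (simp add: primitive_on_def)
  moreover have "AE t in lborel. t \<in> S \<longrightarrow> f t = F t + C"
    using C by eventually_elim (auto simp: algebra_simps)
  ultimately show ?thesis by blast
qed

text \<open>The set where the functions differ inside \<open>S\<close> is open and null, hence
  empty; the remaining points of \<open>I\<close> are limits of points of \<open>S\<close>.\<close>

lemma continuous_AE_eq_imp_eq:
  fixes f F :: "real \<Rightarrow> complex"
  assumes S: "open S" and I: "S \<subseteq> I" "I \<subseteq> closure S" "continuous_on I f" "continuous_on I F"
    and ae: "AE t in lborel. t \<in> S \<longrightarrow> f t = F t" and x: "x \<in> I"
  shows "f x = F x"
proof -
  let ?Z = "{t \<in> S. f t \<noteq> F t}"
  have "continuous_on S (\<lambda>t. f t - F t)"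
    using I by (intro continuous_intros) (auto intro: continuous_on_subset)
  then have "open (S \<inter> (\<lambda>t. f t - F t) -` (- {0}))"
    by (rule continuous_open_preimage[OF _ S]) auto
  moreover have "S \<inter> (\<lambda>t. f t - F t) -` (- {0}) = ?Z" by auto
  ultimately have Z: "open ?Z" by (simp only:)
  have "emeasure lborel ?Z = 0"
  proof -
    have "AE t in lborel. t \<notin> ?Z" using ae by eventually_elim auto
    moreover have "?Z \<in> sets lborel" using Z by simp
    ultimately show ?thesis by (subst (asm) AE_iff_measurable[of ?Z]) auto
  qed
  have "?Z = {}"
  proof (rule ccontr)
    assume "?Z \<noteq> {}"
    then obtain z where "z \<in> ?Z" by blast
    then obtain e where e: "e > 0" "ball z e \<subseteq> ?Z" using Z open_contains_ball by blast
    have "emeasure lborel {z - e<..<z + e} \<le> emeasure lborel ?Z"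
      by (rule emeasure_mono) (use e Z in \<open>auto simp: subset_iff dist_real_def\<close>)
    then show False using e \<open>emeasure lborel ?Z = 0\<close> by simp
  qed
  then have eq: "f t = F t" if "t \<in> S" for t using that by blast
  obtain u where u: "\<And>n. u n \<in> S" "u \<longlonglongrightarrow> x"
    using subsetD[OF I(2) x] unfolding closure_sequential by blast
  have uI: "\<forall>\<^sub>F n in sequentially. u n \<in> I" using u(1) I(1) by (intro always_eventually) blast
  have "(\<lambda>n. f (u n)) \<longlonglongrightarrow> f x" "(\<lambda>n. F (u n)) \<longlonglongrightarrow> F x"
    by (rule continuous_on_tendsto_compose[OF I(3) u(2) x uI] continuous_on_tendsto_compose[OF I(4) u(2) x uI])+
  then show ?thesis unfolding eq[OF u(1)] by (rule LIMSEQ_unique)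
qed

text \<open>A convergent sequence together with its limit is compact, so continuity only has to be
  known on a compact subinterval.\<close>

lemma primitive_on_continuous_on:
  assumes P: "primitive_on I F g" and I: "is_interval I"
  shows "continuous_on I F"
  unfolding continuous_on_sequentially comp_def
proof (intro allI ballI impI)
  fix u x assume x: "x \<in> I" and u: "(\<forall>n. u n \<in> I) \<and> u \<longlonglongrightarrow> x"
  define K where "K = insert x (range u)"
  have K: "compact K" "K \<noteq> {}" "K \<subseteq> I"
    using x u compact_sequence_with_limit[of u x] by (auto simp: K_def)
  obtain p where p: "p \<in> K" "\<forall>y\<in>K. p \<le> y" using compact_attains_inf[OF K(1,2)] by blast
  obtain q where q: "q \<in> K" "\<forall>y\<in>K. y \<le> q" using compact_attains_sup[OF K(1,2)] by blast
  have "{p..q} \<subseteq> I" by (rule is_interval_Icc_subset[OF I subsetD[OF K(3) p(1)] subsetD[OF K(3) q(1)]])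
  then have "continuous_on {p..q} F"
    by (rule primitive_on_continuous[OF primitive_on_subset[OF P]])
  moreover have "x \<in> {p..q}" "\<forall>n. u n \<in> {p..q}" using p(2) q(2) by (auto simp: K_def)
  ultimately show "(\<lambda>n. F (u n)) \<longlonglongrightarrow> F x"
    using u by (intro continuous_on_tendsto_compose[of "{p..q}" F u]) simp_all
qed

text \<open>A continuous \<open>f\<close> coincides everywhere with the primitive that it equals
  almost everywhere. This turns the weak derivative in the interior into information about the
  values of \<open>f\<close> at the end points.\<close>

lemma weak_derivative_imp_primitive:
  assumes I: "is_interval I" "I \<subseteq> closure (interior I)" and w: "has_weak_derivative (interior I) f g"
    and f: "continuous_on I f"
    and g: "\<And>x y. x \<in> I \<Longrightarrow> y \<in> I \<Longrightarrow> x \<le> y \<Longrightarrow> set_integrable lborel {x..y} g"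
  shows "primitive_on I f g"
proof -
  have int: "is_interval (interior I)"
    using I(1) by (simp add: is_interval_convex_1 convex_interior)
  obtain F where F: "primitive_on I F g" "AE t in lborel. t \<in> interior I \<longrightarrow> f t = F t"
    using weak_derivative_imp_AE_primitive[OF open_interior int interior_subset w g] by blast
  have "f x = F x" if "x \<in> I" for x
    by (rule continuous_AE_eq_imp_eq[OF open_interior interior_subset I(2) f
          primitive_on_continuous_on[OF F(1) I(1)] F(2) that])
  with F(1) show ?thesis by (simp add: primitive_on_def)
qed


section \<open>Weighted Sobolev spaces on intervals\<close>

lemma gauss_pos: "0 < gauss s"
  by (simp add: gauss_def)

lemma gauss_measurable [measurable]: "gauss \<in> borel_measurable borel"
  unfolding gauss_def[abs_def] by measurable

lemma gauss_lower_bound: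
  assumes "s \<in> {x..y}"
  shows "gauss (max \<bar>x\<bar> \<bar>y\<bar>) \<le> gauss s"
proof -
  have "\<bar>s\<bar> \<le> max \<bar>x\<bar> \<bar>y\<bar>" using assms by auto
  then have "s\<^sup>2 \<le> (max \<bar>x\<bar> \<bar>y\<bar>)\<^sup>2" by (metis abs_ge_zero power2_abs power_mono)
  then show ?thesis by (simp add: gauss_def divide_right_mono)
qed

lemma borel_measurable_weighted_iff:
  fixes f :: "real \<Rightarrow> 'b::real_normed_vector"
  assumes "I \<in> sets borel"
  shows "f \<in> borel_measurable (weighted I w) \<longleftrightarrow> (\<lambda>s. indicator I s *\<^sub>R f s) \<in> borel_measurable borel"
proof -
  have "borel_measurable (weighted I w) = (borel_measurable (restrict_space lborel I) :: (real \<Rightarrow> 'b) set)"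
    unfolding weighted_def by (rule measurable_cong_sets) simp_all
  moreover have "f \<in> borel_measurable (restrict_space lborel I) \<longleftrightarrow>
      (\<lambda>s. indicator I s *\<^sub>R f s) \<in> borel_measurable lborel"
    using assms by (intro borel_measurable_restrict_space_iff) simp
  ultimately show ?thesis by simp
qed

lemma indicator_mult_measurable:
  fixes f :: "real \<Rightarrow> 'b::{banach, second_countable_topology}"
  assumes "(\<lambda>s. indicator I s *\<^sub>R f s) \<in> borel_measurable borel" "J \<in> sets borel" "J \<subseteq> I"
  shows "(\<lambda>s. indicator J s *\<^sub>R f s) \<in> borel_measurable borel"
proof -
  have "(\<lambda>s. indicator J s *\<^sub>R (indicator I s *\<^sub>R f s)) \<in> borel_measurable borel"
    by (rule borel_measurable_scaleR[OF _ assms(1)]) (use assms(2) in simp)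
  moreover have "indicator J s *\<^sub>R (indicator I s *\<^sub>R f s) = indicator J s *\<^sub>R f s" for s
    using assms(3) by (auto simp: indicator_def)
  ultimately show ?thesis by (simp only:)
qed

text \<open>Covers both weights in use: the Gaussian on a single edge, with \<open>C = 1\<close>,
  and the reduced weight, with \<open>C\<close> the total number of words. Comparability on the
  nonnegative axis gives both the same square-integrable functions and the same null sets.\<close>

locale gauss_weight =
  fixes w :: "real \<Rightarrow> real" and C :: real
  assumes weight_measurable [measurable]: "w \<in> borel_measurable borel"
    and weight_lower: "0 \<le> s \<Longrightarrow> gauss s \<le> w s"
    and weight_upper: "0 \<le> s \<Longrightarrow> w s \<le> C * gauss s"
begin

lemma weight_pos: "0 \<le> s \<Longrightarrow> 0 < w s"
  using weight_lower[of s] gauss_pos[of s] by linarith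

lemma AE_weighted_iff:
  assumes I: "I \<in> sets borel" "I \<subseteq> {0..}"
  shows "(AE s in weighted I w. P s) \<longleftrightarrow> (AE s in lborel. s \<in> I \<longrightarrow> P s)"
proof -
  have "(\<lambda>s. ennreal (w s)) \<in> borel_measurable lborel" by simp
  then have m: "(\<lambda>s. ennreal (w s)) \<in> borel_measurable (restrict_space lborel I)"
    by (rule measurable_restrict_space1)
  have "(AE s in weighted I w. P s) \<longleftrightarrow> (AE s in restrict_space lborel I. 0 < ennreal (w s) \<longrightarrow> P s)"
    unfolding weighted_def by (rule AE_density[OF m])
  also have "\<dots> \<longleftrightarrow> (AE s in lborel. s \<in> I \<longrightarrow> 0 < ennreal (w s) \<longrightarrow> P s)"
    using I by (intro AE_restrict_space_iff) simp
  also have "\<dots> \<longleftrightarrow> (AE s in lborel. s \<in> I \<longrightarrow> P s)"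
  proof -
    have "s \<in> I \<Longrightarrow> 0 < ennreal (w s)" for s using I weight_pos[of s] by (auto simp: subset_iff)
    then have "(s \<in> I \<longrightarrow> 0 < ennreal (w s) \<longrightarrow> P s) = (s \<in> I \<longrightarrow> P s)" for s by blast
    then show ?thesis by (simp only:)
  qed
  finally show ?thesis .
qed

lemma
  fixes F :: "real \<Rightarrow> 'b::{banach, second_countable_topology}"
  assumes I: "I \<in> sets borel" "I \<subseteq> {0..}" and F: "(\<lambda>s. indicator I s *\<^sub>R F s) \<in> borel_measurable borel"
  shows integrable_weighted_iff:
      "integrable (weighted I w) F \<longleftrightarrow> integrable lborel (\<lambda>s. indicator I s *\<^sub>R (w s *\<^sub>R F s))"
    and integral_weighted:
      "(LINT s|weighted I w. F s) = (LINT s|lborel. indicator I s *\<^sub>R (w s *\<^sub>R F s))"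
proof -
  have F': "F \<in> borel_measurable (restrict_space lborel I)"
    using F I by (subst borel_measurable_restrict_space_iff) simp_all
  have "w \<in> borel_measurable lborel" by simp
  then have m: "w \<in> borel_measurable (restrict_space lborel I)"
    by (rule measurable_restrict_space1)
  have nn: "AE s in restrict_space lborel I. 0 \<le> w s"
    using I weight_pos by (intro AE_I2) (auto simp: space_restrict_space subset_iff intro: less_imp_le)
  have I': "I \<inter> space lborel \<in> sets lborel" using I by simp
  show "integrable (weighted I w) F \<longleftrightarrow> integrable lborel (\<lambda>s. indicator I s *\<^sub>R (w s *\<^sub>R F s))"
    unfolding weighted_def integrable_density[OF F' m nn] by (rule integrable_restrict_space[OF I'])
  show "(LINT s|weighted I w. F s) = (LINT s|lborel. indicator I s *\<^sub>R (w s *\<^sub>R F s))"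
    unfolding weighted_def integral_density[OF F' m nn] by (rule integral_restrict_space[OF I'])
qed

text \<open>The right-hand side mentions only the Gaussian, so membership is the same for all
  weights of the locale; functions can thus be moved between edges and half-lines.\<close>

lemma L2_weighted_iff:
  assumes I: "I \<in> sets borel" "I \<subseteq> {0..}"
  shows "f \<in> L2_functions (weighted I w) \<longleftrightarrow>
    (\<lambda>s. indicator I s *\<^sub>R f s) \<in> borel_measurable borel \<and>
    integrable lborel (\<lambda>s. indicator I s *\<^sub>R (gauss s *\<^sub>R (cmod (f s))\<^sup>2))"
proof (cases "(\<lambda>s. indicator I s *\<^sub>R f s) \<in> borel_measurable borel")
  case True
  have "(\<lambda>s. (cmod (indicator I s *\<^sub>R f s))\<^sup>2) \<in> borel_measurable borel"
    using measurable_compose[OF True borel_measurable_norm] by (intro borel_measurable_power)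
  moreover have "(cmod (indicator I s *\<^sub>R f s))\<^sup>2 = indicator I s *\<^sub>R (cmod (f s))\<^sup>2" for s
    by (simp add: indicator_def)
  ultimately have m: "(\<lambda>s. indicator I s *\<^sub>R (cmod (f s))\<^sup>2) \<in> borel_measurable borel"
    by (simp only:)
  have mv: "(\<lambda>s. indicator I s *\<^sub>R (v s *\<^sub>R (cmod (f s))\<^sup>2)) \<in> borel_measurable lborel"
    if "v \<in> borel_measurable borel" for v
    using borel_measurable_scaleR[OF that m] by (simp add: mult_ac)
  have le: "AE s in lborel. norm (indicator I s *\<^sub>R (u s *\<^sub>R (cmod (f s))\<^sup>2)) \<le>
      norm (K * (indicator I s *\<^sub>R (v s *\<^sub>R (cmod (f s))\<^sup>2)))"
    if uv: "\<And>s. 0 \<le> s \<Longrightarrow> 0 \<le> u s" "\<And>s. 0 \<le> s \<Longrightarrow> u s \<le> K * v s" for u v K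
  proof (rule AE_I2)
    fix s
    show "norm (indicator I s *\<^sub>R (u s *\<^sub>R (cmod (f s))\<^sup>2)) \<le>
      norm (K * (indicator I s *\<^sub>R (v s *\<^sub>R (cmod (f s))\<^sup>2)))"
    proof (cases "s \<in> I")
      case True
      then have "0 \<le> s" using I by auto
      then have "u s * (cmod (f s))\<^sup>2 \<le> (K * v s) * (cmod (f s))\<^sup>2"
        using uv by (intro mult_right_mono) auto
      also have "\<dots> \<le> \<bar>(K * v s) * (cmod (f s))\<^sup>2\<bar>" by (rule abs_ge_self)
      finally show ?thesis using True uv(1)[OF \<open>0 \<le> s\<close>] by (simp add: mult_ac)
    qed simp
  qed
  have "integrable lborel (\<lambda>s. indicator I s *\<^sub>R (w s *\<^sub>R (cmod (f s))\<^sup>2)) \<longleftrightarrow>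
      integrable lborel (\<lambda>s. indicator I s *\<^sub>R (gauss s *\<^sub>R (cmod (f s))\<^sup>2))"
  proof
    assume "integrable lborel (\<lambda>s. indicator I s *\<^sub>R (w s *\<^sub>R (cmod (f s))\<^sup>2))"
    then have "integrable lborel (\<lambda>s. 1 * (indicator I s *\<^sub>R (w s *\<^sub>R (cmod (f s))\<^sup>2)))" by simp
    then show "integrable lborel (\<lambda>s. indicator I s *\<^sub>R (gauss s *\<^sub>R (cmod (f s))\<^sup>2))"
      by (rule Bochner_Integration.integrable_bound[OF _ mv[OF gauss_measurable] le])
        (use weight_lower gauss_pos in \<open>auto intro: less_imp_le\<close>)
  next
    assume "integrable lborel (\<lambda>s. indicator I s *\<^sub>R (gauss s *\<^sub>R (cmod (f s))\<^sup>2))"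
    then have "integrable lborel (\<lambda>s. C * (indicator I s *\<^sub>R (gauss s *\<^sub>R (cmod (f s))\<^sup>2)))"
      by (rule integrable_mult_right)
    then show "integrable lborel (\<lambda>s. indicator I s *\<^sub>R (w s *\<^sub>R (cmod (f s))\<^sup>2))"
      by (rule Bochner_Integration.integrable_bound[OF _ mv[OF weight_measurable] le])
        (use weight_upper weight_pos in \<open>auto intro: less_imp_le\<close>)
  qed
  then show ?thesis
    unfolding L2_functions_def mem_Collect_eq borel_measurable_weighted_iff[OF I(1)]
      integrable_weighted_iff[OF I m] by simp
next
  case False
  then show ?thesis
    unfolding L2_functions_def mem_Collect_eq borel_measurable_weighted_iff[OF I(1)] by simp
qed

lemma L2_weighted_measurable:
  assumes "I \<in> sets borel" "I \<subseteq> {0..}" "f \<in> L2_functions (weighted I w)"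
  shows "(\<lambda>s. indicator I s *\<^sub>R f s) \<in> borel_measurable borel"
  using assms(3) unfolding L2_weighted_iff[OF assms(1,2)] by (rule conjunct1)

lemma L2_weighted_subset:
  assumes I: "I \<in> sets borel" "I \<subseteq> {0..}" and J: "J \<in> sets borel" "J \<subseteq> I"
    and f: "f \<in> L2_functions (weighted I w)"
  shows "f \<in> L2_functions (weighted J w)"
proof -
  have J0: "J \<subseteq> {0..}" using I J by auto
  have "integrable lborel (\<lambda>s. indicator J s *\<^sub>R (indicator I s *\<^sub>R (gauss s *\<^sub>R (cmod (f s))\<^sup>2)))"
    using f J unfolding L2_weighted_iff[OF I] by (intro integrable_mult_indicator[of J]) simp_all
  moreover have "indicator J s *\<^sub>R (indicator I s *\<^sub>R (gauss s *\<^sub>R (cmod (f s))\<^sup>2)) =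
      indicator J s *\<^sub>R (gauss s *\<^sub>R (cmod (f s))\<^sup>2)" for s
    using J(2) by (auto simp: indicator_def)
  ultimately show ?thesis
    using f indicator_mult_measurable[OF _ J]
    unfolding L2_weighted_iff[OF I] L2_weighted_iff[OF J(1) J0] by (simp only:) blast
qed

lemma L2_weighted_cong:
  assumes I: "I \<in> sets borel" "I \<subseteq> {0..}" and fg: "\<And>s. s \<in> I \<Longrightarrow> f s = g s"
  shows "f \<in> L2_functions (weighted I w) \<longleftrightarrow> g \<in> L2_functions (weighted I w)"
proof -
  have "indicator I s *\<^sub>R f s = indicator I s *\<^sub>R g s" for s using fg by (auto simp: indicator_def)
  moreover have "indicator I s *\<^sub>R (gauss s *\<^sub>R (cmod (f s))\<^sup>2) = indicator I s *\<^sub>R (gauss s *\<^sub>R (cmod (g s))\<^sup>2)" for s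
    using fg by (auto simp: indicator_def)
  ultimately show ?thesis unfolding L2_weighted_iff[OF I] by (simp only:)
qed

lemma L2_weighted_zero_extension:
  assumes I: "I \<in> sets borel" "I \<subseteq> {0..}" and J: "J \<in> sets borel" "J \<subseteq> I"
    and f: "f \<in> L2_functions (weighted J w)"
  shows "(\<lambda>s. if s \<in> J then f s else 0) \<in> L2_functions (weighted I w)"
proof -
  have J0: "J \<subseteq> {0..}" using I J by auto
  have "indicator I s *\<^sub>R (if s \<in> J then f s else 0) = indicator J s *\<^sub>R f s" for s
    using J(2) by (auto simp: indicator_def)
  moreover have "indicator I s *\<^sub>R (gauss s *\<^sub>R (cmod (if s \<in> J then f s else 0))\<^sup>2) =
      indicator J s *\<^sub>R (gauss s *\<^sub>R (cmod (f s))\<^sup>2)" for s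
    using J(2) by (auto simp: indicator_def)
  ultimately show ?thesis
    using f unfolding L2_weighted_iff[OF I] L2_weighted_iff[OF J(1) J0] by (simp only:)
qed

lemma L2_weighted_Un:
  assumes I: "I \<in> sets borel" "I \<subseteq> {0..}" and J: "J \<in> sets borel" "J \<subseteq> {0..}"
    and f: "f \<in> L2_functions (weighted I w)" "f \<in> L2_functions (weighted J w)"
  shows "f \<in> L2_functions (weighted (I \<union> J) w)"
proof -
  let ?U = "I \<union> J"
  have U: "?U \<in> sets borel" "?U \<subseteq> {0..}" using I J by auto
  have D: "J - I \<in> sets borel" "J - I \<subseteq> {0..}" "J - I \<subseteq> J" using I J by auto
  have "f \<in> L2_functions (weighted (J - I) w)"
    by (rule L2_weighted_subset[OF J D(1) D(3) f(2)])
  then have "(\<lambda>s. (if s \<in> I then f s else 0) + (if s \<in> J - I then f s else 0)) \<in> L2_functions (weighted ?U w)"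
    using I D by (intro L2_functions_add L2_weighted_zero_extension[OF U] f(1)) auto
  then show ?thesis
    by (subst L2_weighted_cong[OF U, of f "\<lambda>s. (if s \<in> I then f s else 0) + (if s \<in> J - I then f s else 0)"]) auto
qed

lemma L2_weighted_UN:
  assumes "finite K" "\<And>k. k \<in> K \<Longrightarrow> A k \<in> sets borel \<and> A k \<subseteq> {0..}"
    and "\<And>k. k \<in> K \<Longrightarrow> f \<in> L2_functions (weighted (A k) w)"
  shows "f \<in> L2_functions (weighted (\<Union>k\<in>K. A k) w)"
  using assms
proof (induction K)
  case empty
  show ?case by (simp add: L2_weighted_iff)
next
  case (insert k K)
  have "(\<Union>k\<in>K. A k) \<in> sets borel" using insert by (intro sets.finite_UN) auto
  moreover have "(\<Union>k\<in>K. A k) \<subseteq> {0..}" using insert.prems(1) by blast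
  ultimately show ?case
    using insert.prems insert.IH by (simp, intro L2_weighted_Un) auto
qed

text \<open>On a compact interval the Gaussian is bounded below, and \<open>|f|\<close> is at most
  \<open>1 + |f|^2\<close>.\<close>

lemma L2_weighted_set_integrable:
  assumes I: "I \<in> sets borel" "I \<subseteq> {0..}" and f: "f \<in> L2_functions (weighted I w)" and xy: "{x..y} \<subseteq> I"
  shows "set_integrable lborel {x..y} f"
proof -
  let ?c = "gauss (max \<bar>x\<bar> \<bar>y\<bar>)"
  have c: "0 < ?c" by (rule gauss_pos)
  have m: "(\<lambda>s. indicator {x..y} s *\<^sub>R f s) \<in> borel_measurable borel"
    using f unfolding L2_weighted_iff[OF I] by (intro indicator_mult_measurable[OF _ _ xy]) simp_all
  have "integrable lborel (indicat_real {x..y})"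
    by (rule integrable_real_indicator) (simp_all add: emeasure_lborel_Icc_eq)
  moreover have "integrable lborel (\<lambda>s. (1 / ?c) * (indicator I s *\<^sub>R (gauss s *\<^sub>R (cmod (f s))\<^sup>2)))"
    using f unfolding L2_weighted_iff[OF I] by (intro integrable_mult_right) simp
  ultimately have "integrable lborel (\<lambda>s. indicat_real {x..y} s + (1 / ?c) * (indicator I s *\<^sub>R (gauss s *\<^sub>R (cmod (f s))\<^sup>2)))"
    by (rule Bochner_Integration.integrable_add)
  then show ?thesis
    unfolding set_integrable_def
  proof (rule Bochner_Integration.integrable_bound)
    show "(\<lambda>s. indicat_real {x..y} s *\<^sub>R f s) \<in> borel_measurable lborel" using m by simp
    show "AE s in lborel. norm (indicat_real {x..y} s *\<^sub>R f s) \<le>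
        norm (indicat_real {x..y} s + (1 / ?c) * (indicator I s *\<^sub>R (gauss s *\<^sub>R (cmod (f s))\<^sup>2)))"
    proof (rule AE_I2)
      fix s
      show "norm (indicat_real {x..y} s *\<^sub>R f s) \<le>
        norm (indicat_real {x..y} s + (1 / ?c) * (indicator I s *\<^sub>R (gauss s *\<^sub>R (cmod (f s))\<^sup>2)))"
      proof (cases "s \<in> {x..y}")
        case True
        then have "s \<in> I" using xy by blast
        have "cmod (f s) \<le> 1 + (cmod (f s))\<^sup>2"
          using sum_squares_bound[of 1 "cmod (f s)"] by simp (smt (verit) norm_ge_zero)
        also have "\<dots> \<le> 1 + (gauss s / ?c) * (cmod (f s))\<^sup>2"
          using mult_right_mono[of 1 "gauss s / ?c" "(cmod (f s))\<^sup>2"] gauss_lower_bound[OF True] c by simp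
        also have "\<dots> \<le> \<bar>1 + (gauss s / ?c) * (cmod (f s))\<^sup>2\<bar>" by (rule abs_ge_self)
        finally show ?thesis using True \<open>s \<in> I\<close> by simp
      qed simp
    qed
  qed
qed

end

text \<open>Measurability up to the ends of \<open>I\<close> is needed for weak derivatives chosen
  by \<open>SOME\<close>, whose values at the end points are arbitrary. The interior is covered by
  countably many compact rational intervals, and the finitely many remaining points are treated as
  singletons.\<close>

lemma locally_integrable_measurable:
  fixes g :: "real \<Rightarrow> complex"
  assumes g: "locally_integrable_on g (interior I)" and I: "I \<in> sets borel" "finite (I - interior I)"
  shows "(\<lambda>s. indicator I s *\<^sub>R g s) \<in> borel_measurable borel"
proof -
  let ?P = "{(p, q). {real_of_rat p..real_of_rat q} \<subseteq> interior I}"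
  let ?C = "(\<lambda>(p, q). {real_of_rat p..real_of_rat q}) ` ?P \<union> (\<lambda>x. {x}) ` (I - interior I)"
  have "g \<in> borel_measurable (restrict_space lborel I)"
  proof (rule measurable_piecewise_restrict[of ?C])
    show "countable ?C" using I(2) by (intro countable_Un countable_image) (auto intro: countable_finite)
    show "space (restrict_space lborel I) \<subseteq> \<Union>?C"
    proof
      fix x assume "x \<in> space (restrict_space lborel I)"
      then have x: "x \<in> I" by (simp add: space_restrict_space)
      show "x \<in> \<Union>?C"
      proof (cases "x \<in> interior I")
        case True
        then obtain e where e: "e > 0" "cball x e \<subseteq> interior I"
          using open_contains_cball_eq[OF open_interior] by blast
        obtain p where p: "x - e < real_of_rat p" "real_of_rat p < x" using of_rat_dense[of "x - e" x] e by auto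
        obtain q where q: "x < real_of_rat q" "real_of_rat q < x + e" using of_rat_dense[of x "x + e"] e by auto
        have "{real_of_rat p..real_of_rat q} \<subseteq> cball x e" using p q by (auto simp: dist_real_def)
        then have "(p, q) \<in> ?P" using e by auto
        moreover have "x \<in> {real_of_rat p..real_of_rat q}" using p q by simp
        ultimately show ?thesis by blast
      qed (use x in blast)
    qed
  next
    fix \<Omega> assume \<Omega>: "\<Omega> \<in> ?C"
    have \<Omega>': "\<Omega> \<in> sets borel" "\<Omega> \<subseteq> I" using \<Omega> interior_subset[of I] by auto
    then show "\<Omega> \<inter> space (restrict_space lborel I) \<in> sets (restrict_space lborel I)"
      using I by (auto simp: space_restrict_space sets_restrict_space Int_absorb2 intro!: image_eqI[of _ _ \<Omega>])
    have "(\<lambda>s. indicator \<Omega> s *\<^sub>R g s) \<in> borel_measurable borel"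
    proof (cases "\<Omega> \<in> (\<lambda>x. {x}) ` (I - interior I)")
      case True
      then obtain x where "\<Omega> = {x}" by blast
      then have "(\<lambda>s. indicator \<Omega> s *\<^sub>R g s) = (\<lambda>s. indicator {x} s *\<^sub>R g x)"
        by (auto simp: indicator_def)
      then show ?thesis by simp
    next
      case False
      then obtain p q where "\<Omega> = {real_of_rat p..real_of_rat q}" "\<Omega> \<subseteq> interior I" using \<Omega> by auto
      then have "set_integrable lborel \<Omega> g" using g by (auto simp: locally_integrable_on_def)
      then show ?thesis by (auto simp: set_integrable_def)
    qed
    then have "g \<in> borel_measurable (restrict_space lborel \<Omega>)"
      using \<Omega>' by (subst borel_measurable_restrict_space_iff) simp_all
    moreover have "restrict_space (restrict_space lborel I) \<Omega> = restrict_space lborel \<Omega>"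
      using \<Omega>' I by (subst restrict_restrict_space) (simp_all add: Int_absorb1)
    ultimately show "g \<in> borel_measurable (restrict_space (restrict_space lborel I) \<Omega>)" by simp
  qed
  then show ?thesis
    using I by (subst (asm) borel_measurable_restrict_space_iff) simp_all
qed

lemma AE_interior:
  assumes "finite (I - interior I)" "AE s in lborel. s \<in> interior I \<longrightarrow> P s"
  shows "AE s in lborel. (s :: real) \<in> I \<longrightarrow> P s"
proof -
  have "AE s in lborel. s \<notin> I - interior I"
    using finite_imp_null_set_lborel[OF assms(1)] by (rule AE_not_in)
  with assms(2) show ?thesis by eventually_elim auto
qed

lemma has_weak_derivative_weak_deriv:
  "has_weak_derivative S f g \<Longrightarrow> has_weak_derivative S f (weak_deriv S f)"
  unfolding weak_deriv_def by (metis someI)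

section \<open>Sobolev functions and forms for a weight comparable to the Gaussian\<close>

context gauss_weight
begin

text \<open>The definition of \<open>H1\<close> provides some square-integrable weak derivative; by
  uniqueness the one selected by \<open>SOME\<close> agrees with it almost everywhere and inherits
  square-integrability.\<close>

lemma H1_weak_deriv:
  assumes I: "is_interval I" "I \<in> sets borel" "I \<subseteq> {0..}" "finite (I - interior I)" and f: "f \<in> H1 I w"
  shows "has_weak_derivative (interior I) f (weak_deriv (interior I) f)"
    and "weak_deriv (interior I) f \<in> L2_functions (weighted I w)"
proof -
  obtain g where g: "g \<in> L2_functions (weighted I w)" "has_weak_derivative (interior I) f g"
    using f by (auto simp: H1_def)
  show d: "has_weak_derivative (interior I) f (weak_deriv (interior I) f)"
    by (rule has_weak_derivative_weak_deriv[OF g(2)])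
  have int: "is_interval (interior I)" using I(1) by (simp add: is_interval_convex_1 convex_interior)
  have "AE s in lborel. s \<in> interior I \<longrightarrow> g s = weak_deriv (interior I) f s"
    by (rule has_weak_derivative_unique[OF open_interior int g(2) d]) simp
  then have ae: "AE s in weighted I w. g s = weak_deriv (interior I) f s"
    unfolding AE_weighted_iff[OF I(2,3)] by (rule AE_interior[OF I(4)])
  have "weak_deriv (interior I) f \<in> borel_measurable (weighted I w)"
    unfolding borel_measurable_weighted_iff[OF I(2)]
    by (rule locally_integrable_measurable[OF _ I(2,4)]) (use d in \<open>simp add: has_weak_derivative_def\<close>)
  then show "weak_deriv (interior I) f \<in> L2_functions (weighted I w)"
    by (rule L2_functions_cong_AE[OF g(1) _ ae])
qed

lemma H1_primitive:
  assumes I: "is_interval I" "I \<in> sets borel" "I \<subseteq> {0..}" "finite (I - interior I)" "I \<subseteq> closure (interior I)"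
    and f: "f \<in> H1 I w" "continuous_on I f"
  shows "primitive_on I f (weak_deriv (interior I) f)"
  using H1_weak_deriv[OF I(1-4) f(1)] is_interval_Icc_subset[OF I(1)]
  by (intro weak_derivative_imp_primitive[OF I(1,5) _ f(2)] L2_weighted_set_integrable[OF I(2,3)])

lemma primitive_H1:
  assumes I: "is_interval I" "I \<in> sets borel" "I \<subseteq> {0..}"
    and f: "f \<in> L2_functions (weighted I w)" "g \<in> L2_functions (weighted I w)" "primitive_on I f g"
  shows "f \<in> H1 I w" "continuous_on I f" "has_weak_derivative (interior I) f g"
proof -
  have int: "is_interval (interior I)" using I(1) by (simp add: is_interval_convex_1 convex_interior)
  show d: "has_weak_derivative (interior I) f g"
    by (rule primitive_on_imp_weak_derivative[OF open_interior int primitive_on_subset[OF f(3) interior_subset]])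
  then show "f \<in> H1 I w" using f by (auto simp: H1_def)
  show "continuous_on I f" by (rule primitive_on_continuous_on[OF f(3) I(1)])
qed

lemma weak_deriv_AE:
  assumes I: "is_interval I" "I \<in> sets borel" "I \<subseteq> {0..}" "finite (I - interior I)"
    and d: "has_weak_derivative (interior I) f g" and ff': "AE s in weighted I w. f s = f' s"
    and d': "has_weak_derivative (interior I) f' g'"
  shows "AE s in weighted I w. g s = g' s"
proof -
  have int: "is_interval (interior I)" using I(1) by (simp add: is_interval_convex_1 convex_interior)
  have "AE s in lborel. s \<in> interior I \<longrightarrow> f s = f' s"
    using ff' interior_subset[of I] unfolding AE_weighted_iff[OF I(2,3)] by (auto elim!: eventually_mono)
  then have "AE s in lborel. s \<in> interior I \<longrightarrow> g s = g' s"
    by (rule has_weak_derivative_unique[OF open_interior int d d'])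
  then show ?thesis unfolding AE_weighted_iff[OF I(2,3)] by (rule AE_interior[OF I(4)])
qed

lemma half_line:
  fixes c :: real
  assumes "0 \<le> c"
  shows "is_interval {c..}" "{c..} \<in> sets borel" "{c..} \<subseteq> {0..}" "finite ({c..} - interior {c..})"
    "{c..} \<subseteq> closure (interior {c..})"
proof -
  have "{c..} - {c<..} = {c}" by auto
  then show "finite ({c..} - interior {c..})" by (simp add: interior_real_atLeast)
  show "{c..} \<subseteq> closure (interior {c..})" by (simp add: interior_real_atLeast)
qed (use assms in \<open>auto simp: is_interval_1\<close>)

definition half_line_form :: "real \<Rightarrow> (real \<Rightarrow> complex) \<Rightarrow> (real \<Rightarrow> complex) \<Rightarrow> complex" where
  "half_line_form c f h =
     1/2 * (LINT s|weighted {c..} w. weak_deriv {c<..} f s * cnj (weak_deriv {c<..} h s))"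

text \<open>Eliminates the choice made by \<open>weak_deriv\<close>: any square-integrable weak
  derivatives compute the form.\<close>

lemma half_line_form_eq:
  assumes c: "0 \<le> c" and f: "f \<in> H1 {c..} w" "h \<in> H1 {c..} w"
    and g: "has_weak_derivative {c<..} f g" "g \<in> L2_functions (weighted {c..} w)"
      "has_weak_derivative {c<..} h k" "k \<in> L2_functions (weighted {c..} w)"
  shows "half_line_form c f h = 1/2 * (LINT s|weighted {c..} w. g s * cnj (k s))"
proof -
  note H = half_line[OF c]
  note wd = H1_weak_deriv[OF H(1-4) f(1), unfolded interior_real_atLeast]
    H1_weak_deriv[OF H(1-4) f(2), unfolded interior_real_atLeast]
  note unique = weak_deriv_AE[OF H(1-4), unfolded interior_real_atLeast]
  have "AE s in weighted {c..} w. weak_deriv {c<..} f s = g s"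
    by (rule unique[OF wd(1) _ g(1)]) simp
  moreover have "AE s in weighted {c..} w. weak_deriv {c<..} h s = k s"
    by (rule unique[OF wd(3) _ g(3)]) simp
  ultimately have ae: "AE s in weighted {c..} w. weak_deriv {c<..} f s * cnj (weak_deriv {c<..} h s) = g s * cnj (k s)"
    by eventually_elim simp
  have "(LINT s|weighted {c..} w. weak_deriv {c<..} f s * cnj (weak_deriv {c<..} h s)) =
      (LINT s|weighted {c..} w. g s * cnj (k s))"
    using ae
    by (intro integral_cong_AE borel_measurable_integrable L2_functions_mult_integrable wd g)
  then show ?thesis by (simp add: half_line_form_def)
qed

lemma zero_primitive: "primitive_on I (\<lambda>s. 0) (\<lambda>s. 0)"
  by (simp add: primitive_on_def set_integrable_def)

lemma ae_form_half_line:
  assumes c: "0 \<le> c" and D: "D \<subseteq> H1 {c..} w" "(\<lambda>s. 0) \<in> D"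
  shows "ae_form (weighted {c..} w) D (half_line_form c)"
  unfolding ae_form_def
proof (intro conjI ballI impI)
  note H = half_line[OF c]
  show "D \<subseteq> L2_functions (weighted {c..} w)" using D by (auto simp: H1_def)
  fix u assume u: "u \<in> D"
  note wd = H1_weak_deriv[OF H(1-4), unfolded interior_real_atLeast]
  {
    fix u' h h' assume D': "u' \<in> D" "h \<in> D" "h' \<in> D"
      and ae: "AE s in weighted {c..} w. u s = u' s" "AE s in weighted {c..} w. h s = h' s"
    have *: "u \<in> H1 {c..} w" "u' \<in> H1 {c..} w" "h \<in> H1 {c..} w" "h' \<in> H1 {c..} w"
      using u D' D(1) by auto
    note unique = weak_deriv_AE[OF H(1-4), unfolded interior_real_atLeast]
    have "AE s in weighted {c..} w. weak_deriv {c<..} u s = weak_deriv {c<..} u' s"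
      by (rule unique[OF wd(1)[OF *(1)] ae(1) wd(1)[OF *(2)]])
    moreover have "AE s in weighted {c..} w. weak_deriv {c<..} h s = weak_deriv {c<..} h' s"
      by (rule unique[OF wd(1)[OF *(3)] ae(2) wd(1)[OF *(4)]])
    ultimately have "AE s in weighted {c..} w. weak_deriv {c<..} u s * cnj (weak_deriv {c<..} h s) =
        weak_deriv {c<..} u' s * cnj (weak_deriv {c<..} h' s)" by eventually_elim simp
    then show "half_line_form c u h = half_line_form c u' h'"
      unfolding half_line_form_def
      by (intro arg_cong[where f="(*) (1/2)"] integral_cong_AE borel_measurable_integrable
          L2_functions_mult_integrable wd *)
  }
  have z: "primitive_on {c..} (\<lambda>s. 0) (\<lambda>s. 0)" by (rule zero_primitive)
  have "half_line_form c u (\<lambda>s. 0) = 1/2 * (LINT s|weighted {c..} w. weak_deriv {c<..} u s * cnj 0)"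
    using u D wd[of u] primitive_H1[OF H(1-3) L2_functions_0 L2_functions_0 z]
    by (intro half_line_form_eq[OF c]) (auto simp: interior_real_atLeast L2_functions_0)
  then show "half_line_form c u (\<lambda>x. 0) = 0" by simp
qed (rule D(2))

text \<open>Needed for the Neumann case, where the form domain on the half-line contains
  discontinuous functions but functions assembled on the tree have to be continuous.\<close>

lemma H1_half_line_continuous_representative:
  assumes c: "0 \<le> c" and f: "f \<in> H1 {c..} w"
  shows "\<exists>F\<in>H1 {c..} w. continuous_on {c..} F \<and> (AE s in weighted {c..} w. f s = F s)"
proof -
  note H = half_line[OF c]
  note wd = H1_weak_deriv[OF H(1-4) f]
  have int: "is_interval (interior {c..})" by (simp add: interior_real_atLeast is_interval_1)
  have "\<exists>F. primitive_on {c..} F (weak_deriv (interior {c..}) f) \<and>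
      (AE t in lborel. t \<in> interior {c..} \<longrightarrow> f t = F t)"
    by (rule weak_derivative_imp_AE_primitive[OF open_interior int interior_subset wd(1)])
      (rule L2_weighted_set_integrable[OF H(2,3) wd(2)], rule is_interval_Icc_subset[OF H(1)])
  then obtain F where F: "primitive_on {c..} F (weak_deriv (interior {c..}) f)"
    "AE t in lborel. t \<in> interior {c..} \<longrightarrow> f t = F t" by blast
  have ae: "AE s in weighted {c..} w. f s = F s"
    unfolding AE_weighted_iff[OF H(2,3)] by (rule AE_interior[OF H(4) F(2)])
  have cont: "continuous_on {c..} F" by (rule primitive_on_continuous_on[OF F(1) H(1)])
  have "F \<in> borel_measurable (weighted {c..} w)"
    unfolding borel_measurable_weighted_iff[OF H(2)]
    using cont by (intro borel_measurable_continuous_on_indicator) auto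
  then have FL: "F \<in> L2_functions (weighted {c..} w)"
    using f by (intro L2_functions_cong_AE[OF _ _ ae]) (auto simp: H1_def)
  then show ?thesis
    using primitive_H1[OF H(1-3) FL wd(2) F(1)] ae cont by blast
qed

end


section \<open>An orthonormal basis adapted to the branching\<close>

text \<open>A geometric sum with ratio \<open>z\<close>, an \<open>n\<close>-th root of unity. If
  \<open>z = 1\<close>, then \<open>n\<close> divides \<open>p - q\<close>, which forces
  \<open>p = q\<close> because both are below \<open>n\<close>.\<close>

lemma sum_roots_of_unity:
  fixes p q n :: nat
  assumes "p < n" "q < n"
  shows "(\<Sum>j<n. cis (2 * pi / n) ^ (j * p) * cnj (cis (2 * pi / n) ^ (j * q))) = (if p = q then of_nat n else 0)"
proof -
  let ?\<omega> = "cis (2 * pi / n)"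
  define z where "z = ?\<omega> ^ p * cnj (?\<omega> ^ q)"
  have n: "0 < n" using assms by simp
  have pw: "?\<omega> ^ (j * p) * cnj (?\<omega> ^ (j * q)) = z ^ j" for j
    by (simp add: z_def power_mult power_mult_distrib mult.commute[of j] del: cis_cnj)
  have "z = cis (real p * (2 * pi / n)) * cis (- (real q * (2 * pi / n)))"
    by (simp only: z_def Complex.DeMoivre cis_cnj)
  also have "\<dots> = cis (real p * (2 * pi / n) + - (real q * (2 * pi / n)))"
    by (rule cis_mult)
  also have "\<dots> = cis (2 * pi * (real p - real q) / n)"
    by (rule arg_cong[of _ _ cis]) (simp add: diff_divide_distrib left_diff_distrib mult.commute)
  finally have z: "z = cis (2 * pi * (real p - real q) / n)" .
  have zn: "z ^ n = cis (2 * pi * (real p - real q))"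
    unfolding z Complex.DeMoivre using n by simp
  have "z ^ n = 1"
  proof -
    have "cis (2 * pi * (real p - real q)) = cis (2 * pi * of_int (int p - int q))" by simp
    also have "\<dots> = 1" by (rule cis_multiple_2pi) simp
    finally show ?thesis using zn by simp
  qed
  show ?thesis
  proof (cases "p = q")
    case True
    then have "z = 1" using z by simp
    then show ?thesis unfolding pw using True by simp
  next
    case False
    have "z \<noteq> 1"
    proof
      assume "z = 1"
      then have "cis (2 * pi * (real p - real q) / n) = 1" using z by simp
      then have "cos (2 * pi * (real p - real q) / n) = 1" by (metis cis.sel(1) one_complex.sel(1))
      then obtain m :: int where m: "2 * pi * (real p - real q) / n = of_int m * 2 * pi"
        using cos_one_2pi_int by auto
      then have "2 * pi * ((real p - real q) / n) = 2 * pi * of_int m" by simp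
      then have "(real p - real q) / n = of_int m" unfolding mult_cancel_left by simp
      then have "real p - real q = of_int m * real n" using n by (simp add: divide_eq_eq)
      then have "of_int (int p - int q) = (of_int (m * int n) :: real)" by simp
      then have eq: "int p - int q = m * int n" by (simp only: of_int_eq_iff)
      have "\<bar>int p - int q\<bar> < int n" using assms by auto
      then have "\<bar>m\<bar> * int n < 1 * int n" using eq by (simp add: abs_mult)
      then have "m = 0" using n by (simp add: mult_less_cancel_right_pos del: mult_1)
      then show False using eq False by simp
    qed
    then have "(\<Sum>j<n. z ^ j) = 0" using \<open>z ^ n = 1\<close> by (simp add: sum_gp_strict)
    then show ?thesis unfolding pw using False by simp
  qed
qed

lemma restrict_eq_iff: "restrict w A = restrict w' A \<longleftrightarrow> (\<forall>i\<in>A. w i = w' i)"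
  by (auto simp: fun_eq_iff restrict_def)

lemma of_real_sqrt_of_nat: "complex_of_real (sqrt (real n)) * complex_of_real (sqrt (real n)) = of_nat n"
  by (simp flip: of_real_mult)

lemma of_real_sqrt_of_nat': "complex_of_real (sqrt (real n)) * (complex_of_real (sqrt (real n)) * z) = of_nat n * z"
  by (simp flip: of_real_mult mult.assoc)

locale branching =
  fixes N :: nat and b :: "nat \<Rightarrow> nat"
  assumes b_pos: "k \<le> N \<Longrightarrow> 0 < b k"
begin

definition words :: "(nat \<Rightarrow> nat) set" where
  "words = (\<Pi>\<^sub>E k\<in>{0..N}. {..<b k})"

definition prefixes :: "nat \<Rightarrow> (nat \<Rightarrow> nat) set" where
  "prefixes k = (\<Pi>\<^sub>E i\<in>{..<k}. {..<b i})"

abbreviation total :: nat where "total \<equiv> generation_size b (Suc N)"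

text \<open>The second component of \<open>\<beta>\<close> selects a character of the cyclic group
  of order \<open>b k\<close>. For \<open>k \<le> N\<close> a prefix of length \<open>k\<close> has
  relative frequency \<open>1 / generation_size b k\<close> among the words, so the square root
  makes the norm 1 for the uniform probability on words.\<close>

definition basis :: "nat \<Rightarrow> (nat \<Rightarrow> nat) \<times> nat \<Rightarrow> (nat \<Rightarrow> nat) \<Rightarrow> complex" where
  "basis k \<beta> w = (if restrict w {..<k} = fst \<beta>
     then of_real (sqrt (generation_size b k)) * cis (2 * pi / b k) ^ (snd \<beta> * w k) else 0)"

text \<open>Character 0 is left out: it does not depend on the letter \<open>k\<close> and is
  already accounted for by the constant and the earlier generations. This is the origin of the
  factor \<open>b k - 1\<close>.\<close>

definition basis_index :: "nat \<Rightarrow> ((nat \<Rightarrow> nat) \<times> nat) set" where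
  "basis_index k = prefixes k \<times> {1..<b k}"

section \<open>Counting words and prefixes\<close>

lemma finite_words: "finite words"
  by (auto simp: words_def intro: finite_PiE)

lemma finite_prefixes: "finite (prefixes k)"
  by (auto simp: prefixes_def intro: finite_PiE)

lemma card_prefixes: "card (prefixes k) = generation_size b k"
  by (simp add: prefixes_def card_PiE generation_size_def)

lemma total_eq: "total = (\<Prod>k\<in>{0..N}. b k)"
  unfolding generation_size_def by (rule prod.cong) auto

lemma card_words: "card words = total"
  by (simp add: words_def card_PiE total_eq)

lemma card_basis_index: "card (basis_index k) = generation_size b k * (b k - 1)"
  by (simp add: basis_index_def card_prefixes card_cartesian_product)

lemma generation_size_pos: "k \<le> Suc N \<Longrightarrow> 0 < generation_size b k"
  by (auto simp: generation_size_def intro!: prod_pos b_pos)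

lemma words_less: "w \<in> words \<Longrightarrow> k \<le> N \<Longrightarrow> w k < b k"
  by (auto simp: words_def PiE_iff)

lemma restrict_words: "w \<in> words \<Longrightarrow> k \<le> Suc N \<Longrightarrow> restrict w {..<k} \<in> prefixes k"
  by (auto simp: words_def prefixes_def PiE_iff)

lemma words_update: "w \<in> words \<Longrightarrow> k \<le> N \<Longrightarrow> p < b k \<Longrightarrow> w(k := p) \<in> words"
  by (auto simp: words_def PiE_iff extensional_def)

lemma words_eqI: "w \<in> words \<Longrightarrow> w' \<in> words \<Longrightarrow> (\<And>i. i \<le> N \<Longrightarrow> w i = w' i) \<Longrightarrow> w = w'"
  by (rule PiE_ext[where k="{0..N}" and s="\<lambda>k. {..<b k}"]) (auto simp: words_def)

lemma words_nonempty: "words \<noteq> {}"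
proof -
  have "(\<lambda>k\<in>{0..N}. 0) \<in> words" using b_pos by (auto simp: words_def)
  then show ?thesis by blast
qed

text \<open>Prescribing the letters in \<open>A\<close> leaves the product of the other
  \<open>b i\<close> as the number of choices; the multiplied form avoids division.\<close>

lemma card_words_fiber:
  assumes v: "v \<in> words" and A: "A \<subseteq> {0..N}"
  shows "card {w \<in> words. \<forall>i\<in>A. w i = v i} * (\<Prod>i\<in>A. b i) = total"
proof -
  have "{w \<in> words. \<forall>i\<in>A. w i = v i} = (\<Pi>\<^sub>E i\<in>{0..N}. if i \<in> A then {v i} else {..<b i})"
  proof (rule set_eqI)
    fix w
    have v': "v i < b i" if "i \<in> {0..N}" for i using v that by (simp add: words_less)
    have "(\<forall>i\<in>{0..N}. w i \<in> (if i \<in> A then {v i} else {..<b i})) \<longleftrightarrow>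
        (\<forall>i\<in>{0..N}. w i \<in> {..<b i}) \<and> (\<forall>i\<in>A. w i = v i)" (is "?L \<longleftrightarrow> ?R")
    proof
      assume L: ?L
      have "w i = v i" if "i \<in> A" for i using L[rule_format, of i] that subsetD[OF A that] by simp
      moreover have "w i \<in> {..<b i}" if "i \<in> {0..N}" for i
        using L[rule_format, OF that] v'[OF that] by (cases "i \<in> A") simp_all
      ultimately show ?R by blast
    next
      assume ?R then show ?L by simp
    qed
    then show "w \<in> {w \<in> words. \<forall>i\<in>A. w i = v i} \<longleftrightarrow>
        w \<in> (\<Pi>\<^sub>E i\<in>{0..N}. if i \<in> A then {v i} else {..<b i})"
      unfolding words_def PiE_iff mem_Collect_eq by blast
  qed
  then have "card {w \<in> words. \<forall>i\<in>A. w i = v i} = (\<Prod>i\<in>{0..N}. if i \<in> A then 1 else b i)"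
  proof -
    have "card (if i \<in> A then {v i} else {..<b i}) = (if i \<in> A then 1 else b i)" for i by simp
    then show ?thesis unfolding \<open>{w \<in> words. \<forall>i\<in>A. w i = v i} = _\<close> by (simp only: card_PiE finite_atLeastAtMost)
  qed
  also have "\<dots> = (\<Prod>i\<in>{0..N} - A. b i)"
    by (subst prod.If_cases) (auto simp: Diff_eq)
  finally show ?thesis
    unfolding total_eq using prod.subset_diff[OF A finite_atLeastAtMost, of b] by simp
qed

lemma card_words_image:
  assumes A: "A \<subseteq> {0..N}"
  shows "card ((\<lambda>w. restrict w A) ` words) = (\<Prod>i\<in>A. b i)"
proof -
  have "(\<lambda>w. restrict w A) ` words = (\<Pi>\<^sub>E i\<in>A. {..<b i})"
  proof (intro equalityI subsetI)
    fix u assume u: "u \<in> (\<Pi>\<^sub>E i\<in>A. {..<b i})"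
    let ?w = "\<lambda>i\<in>{0..N}. if i \<in> A then u i else 0"
    have "?w \<in> words" using u b_pos by (auto simp: words_def PiE_iff)
    moreover have "u = restrict ?w A"
    proof
      fix i show "u i = restrict ?w A i"
        using u A by (cases "i \<in> A") (auto simp: PiE_iff extensional_def)
    qed
    ultimately show "u \<in> (\<lambda>w. restrict w A) ` words" by (intro image_eqI)
  next
    fix u assume "u \<in> (\<lambda>w. restrict w A) ` words"
    then obtain w where w: "w \<in> words" "u = restrict w A" by blast
    have "w i < b i" if "i \<in> A" for i using subsetD[OF A that] words_less[OF w(1)] by simp
    then show "u \<in> (\<Pi>\<^sub>E i\<in>A. {..<b i})" unfolding w(2) by simp
  qed
  moreover have "finite A" using A finite_subset by blast
  ultimately show ?thesis by (simp add: card_PiE)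
qed

text \<open>Summing over the letter \<open>k\<close> first.\<close>

lemma sum_words_letter_0:
  assumes k: "k \<le> N" and H: "\<And>w p. w \<in> words \<Longrightarrow> p < b k \<Longrightarrow> H (w(k := p)) = H w"
    and c: "(\<Sum>p<b k. c p) = 0"
  shows "(\<Sum>w\<in>words. H w * c (w k)) = (0 :: complex)"
proof -
  let ?U = "\<Pi>\<^sub>E i\<in>{0..N} - {k}. {..<b i}"
  have W: "words = (\<lambda>(p, u). u(k := p)) ` ({..<b k} \<times> ?U)"
  proof -
    have "insert k ({0..N} - {k}) = {0..N}" using k by auto
    then show ?thesis
      using PiE_insert_eq[of k "{0..N} - {k}" "\<lambda>i. {..<b i}"] unfolding words_def by simp
  qed
  have inj: "inj_on (\<lambda>(p, u). u(k := p)) ({..<b k} \<times> ?U)"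
    by (rule inj_combinator[of k "{0..N} - {k}" "\<lambda>i. {..<b i}"]) simp
  have "(\<Sum>w\<in>words. H w * c (w k)) = (\<Sum>(p, u)\<in>{..<b k} \<times> ?U. H (u(k := p)) * c p)"
    unfolding W by (subst sum.reindex[OF inj], rule sum.cong) (simp_all add: case_prod_beta)
  also have "\<dots> = (\<Sum>u\<in>?U. \<Sum>p<b k. H (u(k := p)) * c p)"
    by (subst sum.cartesian_product[symmetric], rule sum.swap)
  also have "\<dots> = (\<Sum>u\<in>?U. H (u(k := 0)) * (\<Sum>p<b k. c p))"
  proof (rule sum.cong[OF refl])
    fix u assume u: "u \<in> ?U"
    have "u(k := 0) \<in> words"
      unfolding W using u b_pos[OF k] by (intro image_eqI[of _ _ "(0, u)"] SigmaI) simp_all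
    then have "H (u(k := p)) * c p = H (u(k := 0)) * c p" if "p \<in> {..<b k}" for p
      using H[of "u(k := 0)" p] that by simp
    then have "(\<Sum>p<b k. H (u(k := p)) * c p) = (\<Sum>p<b k. H (u(k := 0)) * c p)"
      by (rule sum.cong[OF refl])
    then show "(\<Sum>p<b k. H (u(k := p)) * c p) = H (u(k := 0)) * (\<Sum>p<b k. c p)"
      unfolding sum_distrib_left .
  qed
  finally show ?thesis using c by simp
qed

text \<open>For fixed other letters, summing a nontrivial character over the letter \<open>k\<close>
  gives 0, and no other factor involves that letter.\<close>

lemma sum_basis_orthogonal:
  assumes k: "k \<le> N" and \<beta>: "\<beta> \<in> basis_index k"
    and F: "\<And>w w'. w \<in> words \<Longrightarrow> w' \<in> words \<Longrightarrow> (\<And>i. i < k \<Longrightarrow> w i = w' i) \<Longrightarrow> F w = F w'"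
  shows "(\<Sum>w\<in>words. cnj (basis k \<beta> w) * F w) = 0"
proof -
  let ?\<omega> = "cis (2 * pi / b k)"
  let ?H = "\<lambda>w. if restrict w {..<k} = fst \<beta> then of_real (sqrt (generation_size b k)) * F w else 0"
  have "(\<Sum>w\<in>words. cnj (basis k \<beta> w) * F w) = (\<Sum>w\<in>words. ?H w * cnj (?\<omega> ^ (snd \<beta> * w k)))"
    by (intro sum.cong refl) (simp add: basis_def)
  also have "\<dots> = 0"
  proof (rule sum_words_letter_0[OF k])
    show "?H (w(k := p)) = ?H w" if "w \<in> words" "p < b k" for w p
    proof -
      have "restrict (w(k := p)) {..<k} = restrict w {..<k}" unfolding restrict_eq_iff by simp
      moreover have "F (w(k := p)) = F w"
        by (rule F[OF words_update[OF that(1) k that(2)] that(1)]) simp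
      ultimately show ?thesis by simp
    qed
    \<comment> \<open>Orthogonality to the trivial character, written as the power with index
      0.\<close>
    have "(\<Sum>p<b k. ?\<omega> ^ (p * 0) * cnj (?\<omega> ^ (p * snd \<beta>))) = (if 0 = snd \<beta> then of_nat (b k) else 0)"
      by (rule sum_roots_of_unity) (use \<beta> b_pos[OF k] in \<open>auto simp: basis_index_def\<close>)
    moreover have "snd \<beta> \<noteq> 0" using \<beta> by (auto simp: basis_index_def)
    ultimately show "(\<Sum>p<b k. cnj (?\<omega> ^ (snd \<beta> * p))) = 0"
      unfolding mult.commute[of "snd \<beta>"] by simp
  qed
  finally show ?thesis .
qed

lemma basis_cong:
  assumes "\<And>i. i \<le> k \<Longrightarrow> w i = w' i"
  shows "basis k \<beta> w = basis k \<beta> w'"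
proof -
  have "restrict w {..<k} = restrict w' {..<k}" unfolding restrict_eq_iff using assms by simp
  moreover have "w k = w' k" using assms by simp
  ultimately show ?thesis unfolding basis_def by (simp only:)
qed

text \<open>Different prefixes have disjoint supports; with equal prefixes, different characters are
  orthogonal; in the remaining case every word in the support contributes
  \<open>generation_size b k\<close>.\<close>

lemma sum_basis_orthonormal_same:
  assumes k: "k \<le> N" and \<beta>: "\<beta> \<in> basis_index k" and \<beta>': "\<beta>' \<in> basis_index k"
  shows "(\<Sum>w\<in>words. cnj (basis k \<beta> w) * basis k \<beta>' w) = (if \<beta> = \<beta>' then of_nat total else 0)"
proof -
  let ?\<omega> = "cis (2 * pi / b k)"
  consider "fst \<beta> \<noteq> fst \<beta>'" | "fst \<beta> = fst \<beta>'" "snd \<beta> \<noteq> snd \<beta>'" | "\<beta> = \<beta>'"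
    by (metis prod_eqI)
  then show ?thesis
  proof cases
    case 1
    then show ?thesis by (auto simp: basis_def intro!: sum.neutral)
  next
    case 2
    let ?H = "\<lambda>w. if restrict w {..<k} = fst \<beta> then of_nat (generation_size b k) else 0 :: complex"
    have "(\<Sum>w\<in>words. cnj (basis k \<beta> w) * basis k \<beta>' w) =
        (\<Sum>w\<in>words. ?H w * (?\<omega> ^ (snd \<beta>' * w k) * cnj (?\<omega> ^ (snd \<beta> * w k))))"
      using 2 by (intro sum.cong refl) (simp add: basis_def of_real_sqrt_of_nat of_real_sqrt_of_nat' mult_ac)
    also have "\<dots> = 0"
    proof (rule sum_words_letter_0[OF k])
      show "?H (w(k := p)) = ?H w" if "w \<in> words" "p < b k" for w p
      proof -
        have "restrict (w(k := p)) {..<k} = restrict w {..<k}" unfolding restrict_eq_iff by simp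
        then show ?thesis by simp
      qed
      have "(\<Sum>p<b k. ?\<omega> ^ (p * snd \<beta>') * cnj (?\<omega> ^ (p * snd \<beta>))) = 0"
        using \<beta> \<beta>' 2 by (subst sum_roots_of_unity) (auto simp: basis_index_def)
      then show "(\<Sum>p<b k. ?\<omega> ^ (snd \<beta>' * p) * cnj (?\<omega> ^ (snd \<beta> * p))) = 0" by (simp add: mult.commute)
    qed
    finally show ?thesis using 2 by auto
  next
    case 3
    have "\<exists>v\<in>words. restrict v {..<k} = fst \<beta>"
    proof -
      have p: "fst \<beta> \<in> prefixes k" using \<beta> by (auto simp: basis_index_def)
      \<comment> \<open>Some word extends the prefix: it is continued with the letter 0, which is
        always admissible.\<close>
      let ?v = "\<lambda>i\<in>{0..N}. if i < k then fst \<beta> i else 0"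
      have "?v \<in> words" using p b_pos by (auto simp: words_def prefixes_def PiE_iff)
      moreover have "restrict ?v {..<k} = fst \<beta>"
        using p k by (auto simp: prefixes_def PiE_iff fun_eq_iff extensional_def)
      ultimately show ?thesis by blast
    qed
    then obtain v where v: "v \<in> words" "restrict v {..<k} = fst \<beta>" by blast
    have eq: "restrict w {..<k} = fst \<beta> \<longleftrightarrow> (\<forall>i\<in>{..<k}. w i = v i)" for w
      unfolding v(2)[symmetric] by (rule restrict_eq_iff)
    have unit: "cnj (?\<omega> ^ n) * ?\<omega> ^ n = 1" for n
    proof -
      have "cmod (?\<omega> ^ n) = 1" by (simp add: norm_power)
      then have "of_real ((cmod (?\<omega> ^ n))\<^sup>2) = (1 :: complex)" by (simp only: power_one of_real_1)
      then show ?thesis unfolding complex_norm_square by (simp only: mult.commute)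
    qed
    have "(\<Sum>w\<in>words. cnj (basis k \<beta> w) * basis k \<beta>' w) =
        (\<Sum>w\<in>words. if \<forall>i\<in>{..<k}. w i = v i then of_nat (generation_size b k) else 0)"
    proof (intro sum.cong refl)
      fix w
      have "cnj (basis k \<beta> w) * basis k \<beta> w = (if restrict w {..<k} = fst \<beta>
          then of_nat (generation_size b k) *
            (cnj (?\<omega> ^ (snd \<beta> * w k)) * ?\<omega> ^ (snd \<beta> * w k)) else 0)"
        by (simp add: basis_def of_real_sqrt_of_nat of_real_sqrt_of_nat' mult_ac)
      then show "cnj (basis k \<beta> w) * basis k \<beta>' w =
          (if \<forall>i\<in>{..<k}. w i = v i then of_nat (generation_size b k) else 0)"
        unfolding unit eq 3(1)[symmetric] by simp
    qed
    also have "\<dots> = of_nat (card {w \<in> words. \<forall>i\<in>{..<k}. w i = v i} * generation_size b k)"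
      by (simp add: sum.If_cases[OF finite_words] Int_def)
    also have "card {w \<in> words. \<forall>i\<in>{..<k}. w i = v i} * generation_size b k = total"
      using card_words_fiber[OF v(1), of "{..<k}"] k by (simp add: generation_size_def subset_iff)
    finally show ?thesis using 3 by simp
  qed
qed

text \<open>For different generations, the element of the earlier one does not depend on the letter
  of the later one, so \<open>sum_basis_orthogonal\<close> applies, after conjugation if the roles
  are reversed.\<close>

lemma sum_basis_orthonormal:
  assumes k: "k \<le> N" "k' \<le> N" and \<beta>: "\<beta> \<in> basis_index k" "\<beta>' \<in> basis_index k'"
  shows "(\<Sum>w\<in>words. cnj (basis k \<beta> w) * basis k' \<beta>' w) =
    (if k = k' \<and> \<beta> = \<beta>' then of_nat total else 0)"
proof (cases k k' rule: linorder_cases)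
  case greater
  have "(\<Sum>w\<in>words. cnj (basis k \<beta> w) * basis k' \<beta>' w) = 0"
    by (rule sum_basis_orthogonal[OF k(1) \<beta>(1)], rule basis_cong) (use greater in auto)
  then show ?thesis using greater by simp
next
  case less
  have "(\<Sum>w\<in>words. cnj (basis k' \<beta>' w) * basis k \<beta> w) = 0"
    by (rule sum_basis_orthogonal[OF k(2) \<beta>(2)], rule basis_cong) (use less in auto)
  then have "cnj (\<Sum>w\<in>words. cnj (basis k' \<beta>' w) * basis k \<beta> w) = 0" by simp
  then show ?thesis using less by (simp add: mult.commute)
next
  case equal
  then show ?thesis using sum_basis_orthonormal_same k \<beta> by simp
qed

text \<open>Up to the factor \<open>total\<close>, the two terms are the kernels of averaging over
  words with the same first \<open>k + 1\<close>, respectively \<open>k\<close>, letters; generation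
  \<open>k\<close> spans the difference of the two spaces. All characters together detect equality
  of the letters \<open>k\<close>, and leaving out character 0 subtracts 1.\<close>

lemma sum_basis_complete_level:
  assumes k: "k \<le> N" and w: "w \<in> words" "w' \<in> words"
  shows "(\<Sum>\<beta>\<in>basis_index k. basis k \<beta> w * cnj (basis k \<beta> w')) =
    (if restrict w {..<Suc k} = restrict w' {..<Suc k} then of_nat (generation_size b (Suc k)) else 0) -
    (if restrict w {..<k} = restrict w' {..<k} then of_nat (generation_size b k) else 0)"
proof -
  let ?\<omega> = "cis (2 * pi / b k)"
  let ?S = "\<Sum>j\<in>{1..<b k}. ?\<omega> ^ (j * w k) * cnj (?\<omega> ^ (j * w' k))"
  have "(\<Sum>\<beta>\<in>basis_index k. basis k \<beta> w * cnj (basis k \<beta> w')) =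
      (\<Sum>v\<in>prefixes k. \<Sum>j\<in>{1..<b k}. basis k (v, j) w * cnj (basis k (v, j) w'))"
    by (simp add: basis_index_def sum.cartesian_product)
  also have "\<dots> = (\<Sum>v\<in>prefixes k. if v = restrict w {..<k} then
      (if restrict w {..<k} = restrict w' {..<k} then of_nat (generation_size b k) * ?S else 0) else 0)"
  proof (intro sum.cong refl)
    fix v
    have "basis k (v, j) w * cnj (basis k (v, j) w') = (if v = restrict w {..<k} then
      (if restrict w {..<k} = restrict w' {..<k} then of_nat (generation_size b k) *
        (?\<omega> ^ (j * w k) * cnj (?\<omega> ^ (j * w' k))) else 0) else 0)" for j
      by (simp add: basis_def of_real_sqrt_of_nat of_real_sqrt_of_nat' mult_ac eq_commute)
    then show "(\<Sum>j\<in>{1..<b k}. basis k (v, j) w * cnj (basis k (v, j) w')) = (if v = restrict w {..<k} then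
      (if restrict w {..<k} = restrict w' {..<k} then of_nat (generation_size b k) * ?S else 0) else 0)"
      by (auto simp: sum_distrib_left simp del: of_real_mult)
  qed
  also have "\<dots> = (if restrict w {..<k} = restrict w' {..<k} then of_nat (generation_size b k) * ?S else 0)"
    using restrict_words[OF w(1), of k] k by (subst sum.delta[OF finite_prefixes]) (simp only: le_SucI if_True)
  also have "?S = (if w k = w' k then of_nat (b k) else 0) - 1"
  proof -
    have "{..<b k} = insert 0 {1..<b k}" using b_pos[OF k] by auto
    then have "(\<Sum>j<b k. ?\<omega> ^ (j * w k) * cnj (?\<omega> ^ (j * w' k))) = 1 + ?S" by simp
    then show ?thesis
      using sum_roots_of_unity[OF words_less[OF w(1) k] words_less[OF w(2) k]] by (simp add: algebra_simps)
  qed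
  finally have "(\<Sum>\<beta>\<in>basis_index k. basis k \<beta> w * cnj (basis k \<beta> w')) =
      (if restrict w {..<k} = restrict w' {..<k} then
        of_nat (generation_size b k) * ((if w k = w' k then of_nat (b k) else 0) - 1) else 0)" .
  moreover have "restrict w {..<Suc k} = restrict w' {..<Suc k} \<longleftrightarrow>
      restrict w {..<k} = restrict w' {..<k} \<and> w k = w' k"
    unfolding restrict_eq_iff by (auto simp: less_Suc_eq)
  ultimately show ?thesis by (simp add: generation_size_def algebra_simps)
qed

text \<open>The level identities telescope. The bottom term cancels against the contribution 1 of
  the constant, the top term compares complete words.\<close>

lemma sum_basis_complete:
  assumes w: "w \<in> words" "w' \<in> words"
  shows "1 + (\<Sum>k\<in>{0..N}. \<Sum>\<beta>\<in>basis_index k. basis k \<beta> w * cnj (basis k \<beta> w')) =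
    (if w = w' then of_nat total else 0)"
proof -
  let ?g = "\<lambda>k. if restrict w {..<k} = restrict w' {..<k} then of_nat (generation_size b k) else 0 :: complex"
  have "(\<Sum>k\<in>{0..N}. \<Sum>\<beta>\<in>basis_index k. basis k \<beta> w * cnj (basis k \<beta> w')) = (\<Sum>k\<in>{0..N}. ?g (Suc k) - ?g k)"
    by (intro sum.cong refl sum_basis_complete_level w) auto
  also have "\<dots> = ?g (Suc N) - ?g 0"
    by (rule sum_Suc_diff) simp
  also have "?g 0 = 1" by (simp add: generation_size_def restrict_eq_iff)
  also have "restrict w {..<Suc N} = restrict w' {..<Suc N} \<longleftrightarrow> w = w'"
    using words_eqI[OF w] unfolding restrict_eq_iff less_Suc_eq_le[symmetric] by blast
  finally show ?thesis by simp
qed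

text \<open>An arbitrary numbering of the basis elements of generation \<open>k\<close>, matching
  the index set \<open>{..<r}\<close> of \<open>op_copies\<close>.\<close>

definition basis_enum :: "nat \<Rightarrow> nat \<Rightarrow> (nat \<Rightarrow> nat) \<times> nat" where
  "basis_enum k = (SOME h. bij_betw h {..<generation_size b k * (b k - 1)} (basis_index k))"

lemma basis_enum_bij: "bij_betw (basis_enum k) {..<generation_size b k * (b k - 1)} (basis_index k)"
proof -
  have "finite (basis_index k)" by (simp add: basis_index_def finite_prefixes)
  then have "\<exists>h. bij_betw h {..<card (basis_index k)} (basis_index k)"
    using ex_bij_betw_nat_finite[of "basis_index k"] by (simp add: atLeast0LessThan)
  then show ?thesis
    unfolding basis_enum_def card_basis_index by (rule someI_ex)
qed

definition coeff :: "nat \<Rightarrow> nat \<Rightarrow> (nat \<Rightarrow> nat) \<Rightarrow> complex" where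
  "coeff k i w = basis k (basis_enum k i) w"

abbreviation mult_of :: "nat \<Rightarrow> nat" where
  "mult_of k \<equiv> generation_size b k * (b k - 1)"

lemma coeff_cong: "(\<And>i. i \<le> k \<Longrightarrow> w i = w' i) \<Longrightarrow> coeff k j w = coeff k j w'"
  unfolding coeff_def by (rule basis_cong)

lemma coeff_orthogonal:
  assumes "k \<le> N" "i < mult_of k"
    and "\<And>w w'. w \<in> words \<Longrightarrow> w' \<in> words \<Longrightarrow> (\<And>i. i < k \<Longrightarrow> w i = w' i) \<Longrightarrow> F w = F w'"
  shows "(\<Sum>w\<in>words. cnj (coeff k i w) * F w) = 0"
proof -
  have "basis_enum k i \<in> basis_index k" using basis_enum_bij[of k] assms(2) by (auto simp: bij_betw_def)
  then show ?thesis unfolding coeff_def by (rule sum_basis_orthogonal[OF assms(1) _ assms(3)])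
qed

lemma coeff_orthonormal:
  assumes "k \<le> N" "i < mult_of k" "k' \<le> N" "i' < mult_of k'"
  shows "(\<Sum>w\<in>words. cnj (coeff k i w) * coeff k' i' w) = (if k = k' \<and> i = i' then of_nat total else 0)"
proof -
  have "basis_enum k i \<in> basis_index k" "basis_enum k' i' \<in> basis_index k'"
    using assms basis_enum_bij by (auto simp: bij_betw_def)
  moreover have "k = k' \<Longrightarrow> basis_enum k i = basis_enum k' i' \<longleftrightarrow> i = i'"
    using assms basis_enum_bij[of k] by (auto simp: bij_betw_def inj_on_eq_iff)
  ultimately show ?thesis
    unfolding coeff_def using assms by (subst sum_basis_orthonormal) auto
qed

lemma coeff_sum: "k \<le> N \<Longrightarrow> i < mult_of k \<Longrightarrow> (\<Sum>w\<in>words. cnj (coeff k i w)) = 0"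
  using coeff_orthogonal[of k i "\<lambda>_. 1"] by simp

lemma coeff_complete:
  assumes "w \<in> words" "w' \<in> words"
  shows "1 + (\<Sum>k\<in>{0..N}. \<Sum>i<mult_of k. coeff k i w * cnj (coeff k i w')) =
    (if w = w' then of_nat total else 0)"
proof -
  have "(\<Sum>i<mult_of k. coeff k i w * cnj (coeff k i w')) =
      (\<Sum>\<beta>\<in>basis_index k. basis k \<beta> w * cnj (basis k \<beta> w'))" for k
    unfolding coeff_def by (rule sum.reindex_bij_betw[OF basis_enum_bij])
  then show ?thesis using sum_basis_complete[OF assms] by simp
qed

lemma total_pos: "0 < total"
  by (rule generation_size_pos) simp

text \<open>Written as a double sum over pairs of words, the right-hand side contains the
  completeness kernel of \<open>coeff_complete\<close>, which leaves only the diagonal.\<close>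

lemma coeff_parseval:
  fixes F G :: "(nat \<Rightarrow> nat) \<Rightarrow> complex"
  defines "c0 \<equiv> \<lambda>F. (\<Sum>w\<in>words. F w) / of_nat total"
  defines "c \<equiv> \<lambda>k i F. (\<Sum>w\<in>words. cnj (coeff k i w) * F w) / of_nat total"
  shows "(\<Sum>w\<in>words. F w * cnj (G w)) / of_nat total =
    c0 F * cnj (c0 G) + (\<Sum>k\<in>{0..N}. \<Sum>i<mult_of k. c k i F * cnj (c k i G))"
proof -
  let ?M = "of_nat total :: complex"
  have M: "?M \<noteq> 0" using total_pos by simp
  let ?J = "SIGMA k:{0..N}. {..<mult_of k}"
  define e where "e j w = coeff (fst j) (snd j) w" for j w
  have J: "(\<Sum>k\<in>{0..N}. \<Sum>i<mult_of k. h k i) = (\<Sum>j\<in>?J. h (fst j) (snd j))" for h :: "nat \<Rightarrow> nat \<Rightarrow> complex"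
    by (subst sum.Sigma) (auto simp: case_prod_beta)
  have prod: "(\<Sum>w\<in>words. u w) / ?M * cnj ((\<Sum>w\<in>words. v w) / ?M) =
      (\<Sum>w\<in>words. \<Sum>w'\<in>words. u w * cnj (v w') / ?M / ?M)" for u v
    by (simp add: sum_product sum_divide_distrib)
  have "c0 F * cnj (c0 G) + (\<Sum>k\<in>{0..N}. \<Sum>i<mult_of k. c k i F * cnj (c k i G)) =
      (\<Sum>w\<in>words. \<Sum>w'\<in>words. F w * cnj (G w') / ?M / ?M) + (\<Sum>j\<in>?J.
        \<Sum>w\<in>words. \<Sum>w'\<in>words. F w * cnj (G w') / ?M / ?M * (e j w' * cnj (e j w)))"
    unfolding J c0_def c_def prod e_def
    by (intro arg_cong2[where f="(+)"] sum.cong refl) simp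
  also have "(\<Sum>j\<in>?J. \<Sum>w\<in>words. \<Sum>w'\<in>words. F w * cnj (G w') / ?M / ?M * (e j w' * cnj (e j w))) =
      (\<Sum>w\<in>words. \<Sum>j\<in>?J. \<Sum>w'\<in>words. F w * cnj (G w') / ?M / ?M * (e j w' * cnj (e j w)))"
    by (rule sum.swap)
  also have "\<dots> = (\<Sum>w\<in>words. \<Sum>w'\<in>words. \<Sum>j\<in>?J. F w * cnj (G w') / ?M / ?M * (e j w' * cnj (e j w)))"
    by (intro sum.cong refl sum.swap)
  also have "(\<Sum>w\<in>words. \<Sum>w'\<in>words. F w * cnj (G w') / ?M / ?M) + \<dots> =
      (\<Sum>w\<in>words. \<Sum>w'\<in>words. F w * cnj (G w') / ?M / ?M *
        (1 + (\<Sum>k\<in>{0..N}. \<Sum>i<mult_of k. coeff k i w' * cnj (coeff k i w))))"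
    unfolding J e_def[symmetric] by (simp only: sum.distrib[symmetric] sum_distrib_left distrib_left mult_1_right)
  also have "\<dots> = (\<Sum>w\<in>words. \<Sum>w'\<in>words. if w' = w then F w * cnj (G w') / ?M else 0)"
  proof (intro sum.cong refl)
    fix w w' assume "w \<in> words" "w' \<in> words"
    then show "F w * cnj (G w') / ?M / ?M *
        (1 + (\<Sum>k\<in>{0..N}. \<Sum>i<mult_of k. coeff k i w' * cnj (coeff k i w))) =
        (if w' = w then F w * cnj (G w') / ?M else 0)"
      using M by (subst coeff_complete) auto
  qed
  also have "\<dots> = (\<Sum>w\<in>words. F w * cnj (G w)) / ?M"
    using finite_words by (simp add: sum_divide_distrib)
  finally show ?thesis ..
qed

end


section \<open>Rays of a regular tree\<close>

text \<open>A half-line has no end; its starting vertex is returned as a default value.\<close>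

fun edge_end :: "('v, 'e) metric_tree \<Rightarrow> ('v, 'e) tree_edge \<Rightarrow> 'v" where
  "edge_end T (Bounded a) = head (tree_graph T) a"
| "edge_end T (Half_Line v i) = v"

locale regular_metric_tree =
  fixes T :: "('v, 'e) metric_tree" and N :: nat and t :: "nat \<Rightarrow> real" and b :: "nat \<Rightarrow> nat"
  assumes regular: "regular_tree T N t b"
begin

abbreviation "G \<equiv> tree_graph T"
abbreviation "base \<equiv> tree_root T"

section \<open>Depth, levels and incoming arcs\<close>

lemma rooted: "rooted_metric_tree T"
  using regular by (simp add: regular_tree_def)

sublocale fin_digraph G
  using rooted by (simp add: rooted_metric_tree_def)

sublocale branching N b
  using regular by unfold_locales (simp add: regular_tree_def)

lemma root_vertex: "base \<in> verts G"
  using rooted by (simp add: rooted_metric_tree_def)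

definition root_path :: "'v \<Rightarrow> 'e list" where
  "root_path v = (THE p. awalk base p v)"

lemma root_path: "v \<in> verts G \<Longrightarrow> awalk base (root_path v) v"
proof -
  assume "v \<in> verts G"
  then have "\<exists>!p. awalk base p v" using rooted unfolding rooted_metric_tree_def by blast
  then show ?thesis unfolding root_path_def by (rule theI')
qed

lemma root_path_unique: "awalk base p v \<Longrightarrow> p = root_path v"
proof -
  assume p: "awalk base p v"
  then have "v \<in> verts G" by auto
  then have "\<exists>!p. awalk base p v" using rooted by (simp add: rooted_metric_tree_def)
  then show ?thesis using p root_path[OF \<open>v \<in> verts G\<close>] by blast
qed

lemma depth_eq: "depth T v = sum_list (map (edge_length T) (root_path v))"
  by (simp add: depth_def root_path_def)

lemma root_path_root: "root_path base = []"
  by (rule root_path_unique[symmetric]) (simp add: awalk_Nil_iff root_vertex)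

lemma root_path_head:
  assumes "a \<in> arcs G"
  shows "root_path (head G a) = root_path (tail G a) @ [a]"
proof (rule root_path_unique[symmetric])
  have "awalk base (root_path (tail G a)) (tail G a)" using assms by (intro root_path) simp
  moreover have "awalk (tail G a) [a] (head G a)" using assms by (simp add: awalk_def cas.simps)
  ultimately show "awalk base (root_path (tail G a) @ [a]) (head G a)" by (rule awalk_appendI)
qed

lemma depth_head: "a \<in> arcs G \<Longrightarrow> depth T (head G a) = depth T (tail G a) + edge_length T a"
  by (simp add: depth_eq root_path_head)

text \<open>The incoming arc of a vertex is the last arc of its unique path from the root.\<close>

lemma head_inj: "a \<in> arcs G \<Longrightarrow> a' \<in> arcs G \<Longrightarrow> head G a = head G a' \<Longrightarrow> a = a'"
proof -
  assume a: "a \<in> arcs G" "a' \<in> arcs G" and "head G a = head G a'"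
  then have "root_path (tail G a) @ [a] = root_path (tail G a') @ [a']"
    using root_path_head[OF a(1)] root_path_head[OF a(2)] by metis
  then show "a = a'" by simp
qed

lemma edge_length_pos: "a \<in> arcs G \<Longrightarrow> 0 < edge_length T a"
  using rooted by (simp add: rooted_metric_tree_def)

lemma in_arc_exists:
  assumes "v \<in> verts G" "v \<noteq> base"
  shows "\<exists>a\<in>arcs G. head G a = v"
proof -
  have w: "awalk base (root_path v) v" by (rule root_path[OF assms(1)])
  have "root_path v \<noteq> []" using w assms(2) by (auto simp: awalk_Nil_iff)
  then obtain p a where p: "root_path v = p @ [a]" by (metis rev_exhaust)
  then have "awalk base (p @ [a]) v" using w by simp
  then have "awalk (awlast base p) [a] v" by (auto simp: awalk_append_iff)
  then show ?thesis by (auto simp: awalk_def cas.simps)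
qed

lemma depth_nonneg: "v \<in> verts G \<Longrightarrow> 0 \<le> depth T v"
  using root_path[of v] edge_length_pos
  unfolding depth_eq awalk_def by (intro sum_list_nonneg) (auto simp: subset_iff intro: less_imp_le)

lemma depth_root: "depth T base = 0"
  by (simp add: depth_eq root_path_root)

lemma depth_pos:
  assumes "v \<in> verts G" "v \<noteq> base"
  shows "0 < depth T v"
proof -
  obtain a where a: "a \<in> arcs G" "head G a = v" using in_arc_exists[OF assms] by blast
  then have "0 \<le> depth T (tail G a)" by (intro depth_nonneg) simp
  then show ?thesis using depth_head[OF a(1)] edge_length_pos[OF a(1)] a(2) by simp
qed

lemma t_0: "t 0 = 0" and t_Suc: "k < N \<Longrightarrow> t k < t (Suc k)"
  using regular by (simp_all add: regular_tree_def)

lemma t_less: "i < j \<Longrightarrow> j \<le> N \<Longrightarrow> t i < t j"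
proof (induction j)
  case (Suc j)
  have "t j < t (Suc j)" using Suc.prems by (intro t_Suc) simp
  show ?case
  proof (cases "i = j")
    case True
    then show ?thesis using \<open>t j < t (Suc j)\<close> by simp
  next
    case False
    then have "t i < t j" using Suc by simp
    then show ?thesis using \<open>t j < t (Suc j)\<close> by simp
  qed
qed simp

lemma t_less_iff: "i \<le> N \<Longrightarrow> j \<le> N \<Longrightarrow> t i < t j \<longleftrightarrow> i < j"
  using t_less[of i j] t_less[of j i] by (cases i j rule: linorder_cases) auto

lemma t_eq_iff: "i \<le> N \<Longrightarrow> j \<le> N \<Longrightarrow> t i = t j \<longleftrightarrow> i = j"
  using t_less[of i j] t_less[of j i] by (cases i j rule: linorder_cases) auto

lemma t_nonneg: "k \<le> N \<Longrightarrow> 0 \<le> t k"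
  using t_less[of 0 k] t_0 by (cases k) auto

lemma level_verts: "v \<in> level T s \<Longrightarrow> v \<in> verts G" and level_depth: "v \<in> level T s \<Longrightarrow> depth T v = s"
  by (simp_all add: level_def)

lemma verts_level: "v \<in> verts G \<Longrightarrow> \<exists>k\<le>N. v \<in> level T (t k)"
  using regular by (auto simp: regular_tree_def)

lemma level_0: "level T (t 0) = {base}"
proof -
  have "v \<in> {base}" if "v \<in> level T (t 0)" for v
    using depth_pos[OF level_verts[OF that]] level_depth[OF that] t_0 by (cases "v = base") auto
  moreover have "base \<in> level T (t 0)" using depth_root root_vertex by (simp add: level_def t_0)
  ultimately show ?thesis by blast
qed

lemma leaves_eq: "level T (t N) = leaves T"
  using regular by (simp add: regular_tree_def)

text \<open>On the last level an outgoing arc is impossible: a leaf differs from the root, so it has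
  an incoming arc, and its degree is one.\<close>

lemma arc_levels:
  assumes a: "a \<in> arcs G" "tail G a \<in> level T (t k)" "k \<le> N"
  shows "k < N" "head G a \<in> level T (t (Suc k))"
proof -
  show "k < N"
  proof (rule ccontr)
    assume "\<not> k < N"
    then have "tail G a \<in> leaves T" using a leaves_eq by simp
    then have v: "tail G a \<in> verts G" "tail G a \<noteq> base" "in_degree G (tail G a) + out_degree G (tail G a) = 1"
      by (auto simp: leaves_def)
    obtain a' where a': "a' \<in> arcs G" "head G a' = tail G a" using in_arc_exists[OF v(1,2)] by blast
    have "a' \<in> in_arcs G (tail G a)" "a \<in> out_arcs G (tail G a)" using a a' by simp_all
    then have "0 < in_degree G (tail G a)" "0 < out_degree G (tail G a)"
      unfolding in_degree_def out_degree_def by (auto simp: card_gt_0_iff)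
    then show False using v(3) by simp
  qed
  then show "head G a \<in> level T (t (Suc k))"
    using regular a by (simp add: regular_tree_def)
qed

section \<open>Words as paths from the root to infinity\<close>

definition outgoing :: "'v \<Rightarrow> ('v, 'e) tree_edge set" where
  "outgoing v = {e \<in> tree_edges T. edge_start T e = v}"

lemma card_outgoing: "k \<le> N \<Longrightarrow> v \<in> level T (t k) \<Longrightarrow> card (outgoing v) = b k"
  using regular by (simp add: regular_tree_def outgoing_def)

definition child :: "'v \<Rightarrow> nat \<Rightarrow> ('v, 'e) tree_edge" where
  "child v = (SOME h. bij_betw h {..<card (outgoing v)} (outgoing v))"

lemma child_bij:
  assumes "k \<le> N" "v \<in> level T (t k)"
  shows "bij_betw (child v) {..<b k} (outgoing v)"
proof -
  have "0 < card (outgoing v)" using assms card_outgoing b_pos by simp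
  then have "finite (outgoing v)" by (rule card_ge_0_finite)
  then have "\<exists>h. bij_betw h {..<card (outgoing v)} (outgoing v)"
    using ex_bij_betw_nat_finite[of "outgoing v"] by (simp add: atLeast0LessThan)
  then have "bij_betw (child v) {..<card (outgoing v)} (outgoing v)"
    unfolding child_def by (rule someI_ex)
  then show ?thesis using assms card_outgoing by simp
qed

text \<open>A word \<open>w\<close> describes the path from the root to infinity that leaves its vertex of generation
  \<open>k\<close> through the edge number \<open>w k\<close>.\<close>

fun ray_vertex :: "(nat \<Rightarrow> nat) \<Rightarrow> nat \<Rightarrow> 'v" where
  "ray_vertex w 0 = base"
| "ray_vertex w (Suc k) = edge_end T (child (ray_vertex w k) (w k))"

definition ray_edge :: "(nat \<Rightarrow> nat) \<Rightarrow> nat \<Rightarrow> ('v, 'e) tree_edge" where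
  "ray_edge w k = child (ray_vertex w k) (w k)"

lemma ray_vertex_Suc: "ray_vertex w (Suc k) = edge_end T (ray_edge w k)"
  by (simp add: ray_edge_def)

text \<open>Half-lines leave exactly from the last generation: an arc forces \<open>k < N\<close> by
  \<open>arc_levels\<close>, and a leaf has depth \<open>t N\<close>, which is the depth of no other
  level.\<close>

lemma outgoing_cases:
  assumes e: "e \<in> outgoing v" and v: "v \<in> level T (t k)" and k: "k \<le> N"
  obtains a where "k < N" "e = Bounded a" "a \<in> arcs G" "tail G a = v" "head G a \<in> level T (t (Suc k))"
  | i where "k = N" "e = Half_Line v i"
proof (cases e)
  case (Bounded a)
  then have "a \<in> arcs G" "tail G a = v" using e by (auto simp: outgoing_def tree_edges_def)
  then show ?thesis using arc_levels[of a k] v k Bounded that(1) by simp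
next
  case (Half_Line u i)
  then have u: "u = v" "v \<in> leaves T" using e by (auto simp: outgoing_def tree_edges_def)
  then have "t N = t k" using leaves_eq level_depth[OF v] level_depth[of v "t N"] by simp
  then have "k = N" using t_eq_iff[of N k] k by simp
  then show ?thesis using that(2) Half_Line u by simp
qed

lemma child_outgoing: "k \<le> N \<Longrightarrow> v \<in> level T (t k) \<Longrightarrow> i < b k \<Longrightarrow> child v i \<in> outgoing v"
  using child_bij[of k v] by (auto simp: bij_betw_def)

lemma ray_vertex_level: "w \<in> words \<Longrightarrow> k \<le> N \<Longrightarrow> ray_vertex w k \<in> level T (t k)"
proof (induction k)
  case 0
  show ?case using level_0 by simp
next
  case (Suc k)
  then have v: "ray_vertex w k \<in> level T (t k)" "k \<le> N" by simp_all
  have "child (ray_vertex w k) (w k) \<in> outgoing (ray_vertex w k)"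
    using Suc.prems v words_less[of w k] by (intro child_outgoing[OF v(2,1)]) simp
  then show ?case by (rule outgoing_cases[OF _ v]) (use Suc.prems in simp_all)
qed

lemma ray_edge_outgoing: "w \<in> words \<Longrightarrow> k \<le> N \<Longrightarrow> ray_edge w k \<in> outgoing (ray_vertex w k)"
  unfolding ray_edge_def by (intro child_outgoing[of k] ray_vertex_level) (simp_all add: words_less)

lemma ray_edge_tree_edge: "w \<in> words \<Longrightarrow> k \<le> N \<Longrightarrow> ray_edge w k \<in> tree_edges T"
  and ray_edge_start: "w \<in> words \<Longrightarrow> k \<le> N \<Longrightarrow> edge_start T (ray_edge w k) = ray_vertex w k"
  using ray_edge_outgoing[of w k] by (simp_all add: outgoing_def)

lemma ray_edge_bounded:
  assumes "w \<in> words" "k < N"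
  obtains a where "ray_edge w k = Bounded a" "a \<in> arcs G" "tail G a = ray_vertex w k"
    "head G a = ray_vertex w (Suc k)" "depth T (tail G a) = t k" "edge_length T a = t (Suc k) - t k"
proof -
  have k: "k \<le> N" using assms by simp
  show thesis
  proof (rule outgoing_cases[OF ray_edge_outgoing[OF assms(1) k] ray_vertex_level[OF assms(1) k] k])
    fix a assume a: "ray_edge w k = Bounded a" "a \<in> arcs G" "tail G a = ray_vertex w k"
      "head G a \<in> level T (t (Suc k))"
    have "head G a = ray_vertex w (Suc k)" unfolding ray_vertex_Suc a(1) by simp
    moreover have d: "depth T (tail G a) = t k" using level_depth[OF ray_vertex_level[OF assms(1) k]] a(3) by simp
    moreover have "edge_length T a = t (Suc k) - t k"
      using depth_head[OF a(2)] level_depth[OF a(4)] d by simp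
    ultimately show thesis using that a by simp
  qed (use assms in simp)
qed

lemma ray_edge_half_line:
  assumes "w \<in> words"
  obtains i where "ray_edge w N = Half_Line (ray_vertex w N) i" "depth T (ray_vertex w N) = t N"
  using outgoing_cases[OF ray_edge_outgoing[OF assms order_refl] ray_vertex_level[OF assms order_refl] order_refl]
    level_depth[OF ray_vertex_level[OF assms order_refl]] by (metis less_irrefl)

text \<open>Closed at both ends, so that neighbouring segments share the point at which functions
  are glued.\<close>

definition segment :: "nat \<Rightarrow> real set" where
  "segment k = (if k < N then {t k..t (Suc k)} else {t N..})"

lemma edge_interval_ray_edge:
  assumes "w \<in> words" "k \<le> N"
  shows "edge_interval T (ray_edge w k) = segment k"
proof (cases "k < N")
  case True
  obtain a where "ray_edge w k = Bounded a" "depth T (tail G a) = t k" "edge_length T a = t (Suc k) - t k"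
    using ray_edge_bounded[OF assms(1) True] by metis
  then show ?thesis using True by (simp add: segment_def)
next
  case False
  then have "k = N" using assms by simp
  obtain i where "ray_edge w N = Half_Line (ray_vertex w N) i" "depth T (ray_vertex w N) = t N"
    using ray_edge_half_line[OF assms(1)] by metis
  then show ?thesis using \<open>k = N\<close> by (simp add: segment_def)
qed

lemma edge_point_ray_edge:
  assumes "w \<in> words" "k \<le> N"
  shows "edge_point T (ray_edge w k) s =
    (if s = t k then Vertex (ray_vertex w k)
     else if k < N \<and> s = t (Suc k) then Vertex (ray_vertex w (Suc k)) else Inner (ray_edge w k) s)"
proof (cases "k < N")
  case True
  obtain a where "ray_edge w k = Bounded a" "depth T (tail G a) = t k" "edge_length T a = t (Suc k) - t k"
    "tail G a = ray_vertex w k" "head G a = ray_vertex w (Suc k)"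
    using ray_edge_bounded[OF assms(1) True] by metis
  then show ?thesis using True by simp
next
  case False
  then have "k = N" using assms by simp
  obtain i where "ray_edge w N = Half_Line (ray_vertex w N) i" "depth T (ray_vertex w N) = t N"
    using ray_edge_half_line[OF assms(1)] by metis
  then show ?thesis using \<open>k = N\<close> by simp
qed

text \<open>The depth of the starting vertex determines the generation.\<close>

lemma ray_edge_generation:
  assumes "w \<in> words" "k \<le> N" "w' \<in> words" "k' \<le> N" "ray_edge w k = ray_edge w' k'"
  shows "k = k'"
proof -
  have "ray_vertex w k = ray_vertex w' k'" using ray_edge_start assms by metis
  then have "t k = t k'" using level_depth ray_vertex_level assms by metis
  then show ?thesis using t_eq_iff assms by simp
qed

text \<open>An edge of generation \<open>k\<close> uses one letter more than the vertex at which it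
  starts. Letters are recovered because \<open>child\<close> is injective and because a vertex
  determines its incoming arc.\<close>

lemma
  assumes w: "w \<in> words" "w' \<in> words"
  shows ray_vertex_eq_iff: "k \<le> N \<Longrightarrow> ray_vertex w k = ray_vertex w' k \<longleftrightarrow> (\<forall>i<k. w i = w' i)"
    and ray_edge_eq_iff: "k \<le> N \<Longrightarrow> ray_edge w k = ray_edge w' k \<longleftrightarrow> (\<forall>i\<le>k. w i = w' i)"
proof -
  have edge: "ray_edge w k = ray_edge w' k \<longleftrightarrow> ray_vertex w k = ray_vertex w' k \<and> w k = w' k"
    if k: "k \<le> N" for k
  proof
    assume eq: "ray_edge w k = ray_edge w' k"
    then have v: "ray_vertex w k = ray_vertex w' k" using ray_edge_start w k by metis
    have "inj_on (child (ray_vertex w k)) {..<b k}"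
      using child_bij[OF k ray_vertex_level[OF w(1) k]] by (simp add: bij_betw_def)
    then have "w k = w' k"
      using eq v words_less[OF w(1) k] words_less[OF w(2) k] unfolding ray_edge_def
      by (auto dest: inj_onD)
    with v show "ray_vertex w k = ray_vertex w' k \<and> w k = w' k" ..
  qed (simp add: ray_edge_def)
  show vertex: "k \<le> N \<Longrightarrow> ray_vertex w k = ray_vertex w' k \<longleftrightarrow> (\<forall>i<k. w i = w' i)" for k
  proof (induction k)
    case (Suc k)
    obtain a where a: "ray_edge w k = Bounded a" "a \<in> arcs G" "head G a = ray_vertex w (Suc k)"
      using ray_edge_bounded[of w k] w Suc.prems by auto
    obtain a' where a': "ray_edge w' k = Bounded a'" "a' \<in> arcs G" "head G a' = ray_vertex w' (Suc k)"
      using ray_edge_bounded[of w' k] w Suc.prems by auto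
    have "ray_vertex w (Suc k) = ray_vertex w' (Suc k) \<longleftrightarrow> ray_edge w k = ray_edge w' k"
      using head_inj[OF a(2) a'(2)] a a' by auto
    also have "\<dots> \<longleftrightarrow> ray_vertex w k = ray_vertex w' k \<and> w k = w' k"
      using Suc.prems by (intro edge) simp
    also have "\<dots> \<longleftrightarrow> (\<forall>i<Suc k. w i = w' i)"
      using Suc by (auto simp: less_Suc_eq)
    finally show ?case .
  qed simp
  show "k \<le> N \<Longrightarrow> ray_edge w k = ray_edge w' k \<longleftrightarrow> (\<forall>i\<le>k. w i = w' i)"
    using edge[of k] vertex[of k] by (auto simp: le_less)
qed

text \<open>Induction over the parent vertex: an arc from level \<open>j\<close> ends on level
  \<open>j + 1\<close>, so comparing depths puts the parent on level \<open>k\<close>. Changing only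
  the letter \<open>k\<close> of a word through the parent reaches the vertex.\<close>

lemma ray_vertex_surj: "k \<le> N \<Longrightarrow> v \<in> level T (t k) \<Longrightarrow> \<exists>w\<in>words. ray_vertex w k = v"
proof (induction k arbitrary: v)
  case 0
  then have "v = base" using level_0 by simp
  then show ?case using words_nonempty by auto
next
  case (Suc k)
  have v: "v \<in> verts G" "depth T v = t (Suc k)" using Suc.prems by (auto simp: level_def)
  have "0 < t (Suc k)" using t_less[of 0 "Suc k"] t_0 Suc.prems by simp
  then have "v \<noteq> base" using v depth_root by auto
  then obtain a where a: "a \<in> arcs G" "head G a = v" using in_arc_exists v by blast
  obtain j where j: "j \<le> N" "tail G a \<in> level T (t j)" using verts_level[of "tail G a"] a by auto
  have "j < N" "v \<in> level T (t (Suc j))" using arc_levels[OF a(1) j(2,1)] a by auto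
  then have "t (Suc j) = t (Suc k)" using v by (simp add: level_def)
  then have "j = k" using t_eq_iff[of "Suc j" "Suc k"] \<open>j < N\<close> Suc.prems by simp
  then obtain w where w: "w \<in> words" "ray_vertex w k = tail G a"
    using Suc.IH[of "tail G a"] j by auto
  have k: "k \<le> N" using Suc.prems by simp
  have "Bounded a \<in> outgoing (tail G a)" using a by (auto simp: outgoing_def tree_edges_def)
  moreover have bij: "bij_betw (child (tail G a)) {..<b k} (outgoing (tail G a))"
    using child_bij[of k "tail G a"] j \<open>j = k\<close> by simp
  ultimately have "Bounded a \<in> child (tail G a) ` {..<b k}" by (simp add: bij_betw_def)
  then obtain p where p: "p < b k" "child (tail G a) p = Bounded a" by auto
  have w': "w(k := p) \<in> words" by (rule words_update[OF w(1) k p(1)])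
  have "ray_vertex (w(k := p)) k = ray_vertex w k"
    using ray_vertex_eq_iff[OF w' w(1) k] by simp
  then have "ray_vertex (w(k := p)) (Suc k) = v" using w p a by simp
  then show ?case using w' by blast
qed

lemma tree_edges_eq: "tree_edges T = (\<Union>k\<in>{0..N}. (\<lambda>w. ray_edge w k) ` words)"
proof (intro equalityI subsetI)
  fix e assume e: "e \<in> tree_edges T"
  have "edge_start T e \<in> verts G"
    using e by (auto simp: tree_edges_def leaves_def)
  then obtain k where k: "k \<le> N" "edge_start T e \<in> level T (t k)" using verts_level by blast
  obtain w where w: "w \<in> words" "ray_vertex w k = edge_start T e" using ray_vertex_surj[OF k] by blast
  have "e \<in> outgoing (edge_start T e)" using e by (simp add: outgoing_def)
  then have "e \<in> child (edge_start T e) ` {..<b k}" using child_bij[OF k] by (simp add: bij_betw_def)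
  then obtain p where p: "p < b k" "child (edge_start T e) p = e" by auto
  have w': "w(k := p) \<in> words" by (rule words_update[OF w(1) k(1) p(1)])
  have "ray_vertex (w(k := p)) k = ray_vertex w k"
    using ray_vertex_eq_iff[OF w' w(1) k(1)] by simp
  then have "ray_edge (w(k := p)) k = e" using w p by (simp add: ray_edge_def)
  then show "e \<in> (\<Union>k\<in>{0..N}. (\<lambda>w. ray_edge w k) ` words)" using w' k by force
qed (auto simp: ray_edge_tree_edge)

text \<open>At \<open>s = t k\<close> with \<open>k \<le> N\<close> the value is \<open>k\<close>: a
  vertex is read as the start of the next edge. By \<open>ray_segment\<close> reading it as the end
  of the previous edge gives the same point.\<close>

definition generation :: "real \<Rightarrow> nat" where
  "generation s = Max {k. k \<le> N \<and> t k \<le> s}"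

lemma generation:
  assumes "0 \<le> s"
  shows "generation s \<le> N" "t (generation s) \<le> s" "generation s < N \<Longrightarrow> s < t (Suc (generation s))"
proof -
  let ?A = "{k. k \<le> N \<and> t k \<le> s}"
  have A: "finite ?A" "?A \<noteq> {}" using assms t_0 by (auto intro!: exI[of _ 0])
  have "generation s \<in> ?A" unfolding generation_def by (rule Max_in[OF A])
  then show "generation s \<le> N" "t (generation s) \<le> s" by auto
  show "s < t (Suc (generation s))" if "generation s < N"
  proof (rule ccontr)
    assume "\<not> s < t (Suc (generation s))"
    then have "Suc (generation s) \<in> ?A" using that by auto
    then have "Suc (generation s) \<le> generation s" unfolding generation_def by (rule Max_ge[OF A(1)])
    then show False by simp
  qed
qed

lemma generation_eqI:
  assumes "k \<le> N" "t k \<le> s" "k < N \<Longrightarrow> s < t (Suc k)"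
  shows "generation s = k"
  unfolding generation_def
proof (rule Max_eqI)
  fix j assume j: "j \<in> {k. k \<le> N \<and> t k \<le> s}"
  show "j \<le> k"
  proof (rule ccontr)
    assume "\<not> j \<le> k"
    then have "k < N" "Suc k \<le> j" using j by auto
    then have "t (Suc k) \<le> t j" using t_less[of "Suc k" j] j by (cases "Suc k = j") auto
    then show False using assms(3)[OF \<open>k < N\<close>] j by auto
  qed
qed (use assms in auto)

definition ray :: "(nat \<Rightarrow> nat) \<Rightarrow> real \<Rightarrow> ('v, 'e) tree_point" where
  "ray w s = edge_point T (ray_edge w (generation s)) s"

lemma ray_segment:
  assumes w: "w \<in> words" and k: "k \<le> N" and s: "s \<in> segment k"
  shows "ray w s = edge_point T (ray_edge w k) s"
proof (cases "k < N \<and> s = t (Suc k)")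
  case True
  then have "generation s = Suc k" using t_Suc[of "Suc k"] by (intro generation_eqI) auto
  then have "ray w s = Vertex (ray_vertex w (Suc k))"
    using True w by (simp add: ray_def edge_point_ray_edge del: ray_vertex.simps)
  then show ?thesis
    using True w k t_Suc[of k] by (simp add: edge_point_ray_edge del: ray_vertex.simps)
next
  case False
  then have "generation s = k" using s k by (intro generation_eqI) (auto simp: segment_def split: if_splits)
  then show ?thesis by (simp add: ray_def)
qed

lemma segment_generation: "0 \<le> s \<Longrightarrow> s \<in> segment (generation s)"
  using generation[of s] by (cases "generation s < N") (auto simp: segment_def)

lemma segment_nonneg: "k \<le> N \<Longrightarrow> segment k \<subseteq> {0..}"
  using t_nonneg[of k] by (auto simp: segment_def)

lemma t_segment: "k \<le> N \<Longrightarrow> t k \<in> segment k"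
  using t_Suc[of k] by (auto simp: segment_def)

lemma Un_segments: "(\<Union>k\<in>{0..N}. segment k) = {0..}"
proof (intro equalityI subsetI)
  fix s :: real assume "s \<in> {0..}"
  then show "s \<in> (\<Union>k\<in>{0..N}. segment k)"
    using segment_generation[of s] generation(1)[of s] by auto
next
  fix s assume "s \<in> (\<Union>k\<in>{0..N}. segment k)"
  then obtain k where "k \<le> N" "s \<in> segment k" by auto
  then show "s \<in> {0..}" using segment_nonneg by blast
qed

lemma ray_generation_cases:
  assumes w: "w \<in> words" and s: "0 \<le> s" and k: "k = generation s"
  shows "ray w s = (if s = t k then Vertex (ray_vertex w k) else Inner (ray_edge w k) s)"
  using generation[OF s] w k by (auto simp: ray_def edge_point_ray_edge simp del: ray_vertex.simps)

lemma dist_root_ray: "w \<in> words \<Longrightarrow> 0 \<le> s \<Longrightarrow> dist_root T (ray w s) = s"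
  using ray_generation_cases[of w s] generation(1)[of s] ray_vertex_level[of w "generation s"]
  by (auto simp: level_depth)

text \<open>The inequality is strict because at distance \<open>t i\<close> the ray is still at the
  vertex from which the letter \<open>i\<close> chooses the next edge.\<close>

lemma ray_eq_iff:
  assumes w: "w \<in> words" "w' \<in> words" and s: "0 \<le> s"
  shows "ray w s = ray w' s \<longleftrightarrow> (\<forall>i\<le>N. t i < s \<longrightarrow> w i = w' i)"
proof -
  define k where "k = generation s"
  have k: "k \<le> N" "t k \<le> s" "k < N \<Longrightarrow> s < t (Suc k)" using generation[OF s] by (simp_all add: k_def)
  note r = ray_generation_cases[OF w(1) s k_def] ray_generation_cases[OF w(2) s k_def]
  have below: "t i < s" if "i < k" for i using t_less[OF that k(1)] k(2) by simp
  have above: "\<not> t i < s" if "k < i" "i \<le> N" for i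
  proof -
    have "t (Suc k) \<le> t i" using t_less[of "Suc k" i] that by (cases "Suc k = i") auto
    then show ?thesis using k(3) that by simp
  qed
  show ?thesis
  proof (cases "s = t k")
    case True
    have "ray w s = ray w' s \<longleftrightarrow> (\<forall>i<k. w i = w' i)"
      unfolding r using True ray_vertex_eq_iff[OF w k(1)] by simp
    also have "\<dots> \<longleftrightarrow> (\<forall>i\<le>N. t i < s \<longrightarrow> w i = w' i)"
      using below above k(1) True by (metis less_irrefl linorder_neqE_nat order.strict_trans2 less_imp_le)
    finally show ?thesis .
  next
    case False
    have "t k < s" using False k by simp
    have "ray w s = ray w' s \<longleftrightarrow> (\<forall>i\<le>k. w i = w' i)"
      unfolding r using False ray_edge_eq_iff[OF w k(1)] by simp
    also have "\<dots> \<longleftrightarrow> (\<forall>i\<le>N. t i < s \<longrightarrow> w i = w' i)"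
      using below above k(1) \<open>t k < s\<close> by (metis le_neq_implies_less le_trans not_le)
    finally show ?thesis .
  qed
qed

lemma ray_0: "w \<in> words \<Longrightarrow> ray w 0 = Vertex base"
  using ray_segment[of w 0 0] t_segment[of 0] t_0 by (simp add: edge_point_ray_edge)

lemma interior_segment:
  "interior (segment k) = (if k < N then {t k<..<t (Suc k)} else {t N<..})"
  by (simp add: segment_def interior_real_atLeast)

lemma tree_points_eq: "tree_points T = {ray w s | w s. w \<in> words \<and> 0 \<le> s}"
proof (intro equalityI subsetI)
  fix x assume "x \<in> tree_points T"
  then consider v where "x = Vertex v" "v \<in> verts G"
    | e s where "x = Inner e s" "e \<in> tree_edges T" "s \<in> interior (edge_interval T e)"
    by (auto simp: tree_points_def)
  then show "x \<in> {ray w s | w s. w \<in> words \<and> 0 \<le> s}"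
  proof cases
    case 1
    obtain k where k: "k \<le> N" "v \<in> level T (t k)" using verts_level[OF 1(2)] by blast
    obtain w where w: "w \<in> words" "ray_vertex w k = v" using ray_vertex_surj[OF k] by blast
    have "x = ray w (t k)" using w k 1 by (simp add: ray_segment[OF w(1) k(1) t_segment] edge_point_ray_edge)
    then show ?thesis using w t_nonneg[OF k(1)] by blast
  next
    case 2
    obtain k w where k: "k \<le> N" and w: "w \<in> words" "e = ray_edge w k"
      using 2(2) unfolding tree_edges_eq by auto
    have s: "s \<in> interior (segment k)" using 2(3) edge_interval_ray_edge[OF w(1) k] w by simp
    have s': "s \<in> segment k" using s interior_subset by blast
    have "x = ray w s"
      using s 2 w k by (auto simp: ray_segment[OF w(1) k s'] edge_point_ray_edge interior_segment split: if_splits)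
    then show ?thesis using w segment_nonneg[OF k] s' by auto
  qed
next
  fix x assume "x \<in> {ray w s | w s. w \<in> words \<and> 0 \<le> s}"
  then obtain w s where x: "x = ray w s" "w \<in> words" "0 \<le> s" by blast
  define k where "k = generation s"
  have k: "k \<le> N" "t k \<le> s" "k < N \<Longrightarrow> s < t (Suc k)" using generation[OF x(3)] by (simp_all add: k_def)
  show "x \<in> tree_points T"
  proof (cases "s = t k")
    case True
    then show ?thesis
      using x ray_generation_cases[OF x(2,3) k_def] level_verts[OF ray_vertex_level[OF x(2) k(1)]]
      by (simp add: tree_points_def)
  next
    case False
    then have "s \<in> interior (segment k)" using k by (auto simp: interior_segment)
    then show ?thesis
      using False x ray_generation_cases[OF x(2,3) k_def] ray_edge_tree_edge[OF x(2) k(1)]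
        edge_interval_ray_edge[OF x(2) k(1)]
      by (auto simp: tree_points_def)
  qed
qed

section \<open>The branching function as a product of branching numbers\<close>

lemma card_image_cong_eq:
  assumes "\<And>x y. x \<in> A \<Longrightarrow> y \<in> A \<Longrightarrow> f x = f y \<longleftrightarrow> g x = g y"
  shows "card (f ` A) = card (g ` A)"
proof -
  have "bij_betw (\<lambda>y. g (inv_into A f y)) (f ` A) (g ` A)"
  proof (rule bij_betwI')
    fix y y' assume "y \<in> f ` A" "y' \<in> f ` A"
    then show "g (inv_into A f y) = g (inv_into A f y') \<longleftrightarrow> y = y'"
      using assms[of "inv_into A f y" "inv_into A f y'"] by (simp add: inv_into_into f_inv_into_f)
  next
    fix z assume "z \<in> g ` A"
    then obtain x where x: "x \<in> A" "z = g x" by blast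
    then have "g (inv_into A f (f x)) = g x"
      using assms[of "inv_into A f (f x)" x] by (simp add: inv_into_into f_inv_into_f)
    then show "\<exists>y\<in>f ` A. z = g (inv_into A f y)" using x by (intro bexI[of _ "f x"]) auto
  qed (simp add: inv_into_into)
  then show ?thesis by (rule bij_betw_same_card)
qed

text \<open>By \<open>ray_eq_iff\<close>, points at distance \<open>s\<close> correspond to choices
  of the letters whose level lies strictly below \<open>s\<close>.\<close>

lemma branching_function_eq:
  assumes "0 \<le> s"
  shows "branching_function T s = (\<Prod>i\<in>{i\<in>{0..N}. t i < s}. b i)"
proof -
  let ?A = "{i\<in>{0..N}. t i < s}"
  have "{x \<in> tree_points T. dist_root T x = s} = (\<lambda>w. ray w s) ` words"
    using assms dist_root_ray by (auto simp: tree_points_eq)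
  then have "branching_function T s = card ((\<lambda>w. ray w s) ` words)"
    by (simp add: branching_function_def)
  also have "\<dots> = card ((\<lambda>w. restrict w ?A) ` words)"
    by (rule card_image_cong_eq) (auto simp: ray_eq_iff[OF _ _ assms] restrict_eq_iff)
  also have "\<dots> = (\<Prod>i\<in>?A. b i)" by (rule card_words_image) auto
  finally show ?thesis .
qed

lemma branching_function_neg: "s < 0 \<Longrightarrow> branching_function T s = 0"
proof -
  assume s: "s < 0"
  have "{x \<in> tree_points T. dist_root T x = s} = {}"
    using s dist_root_ray by (auto simp: tree_points_eq)
  then show ?thesis unfolding branching_function_def by (simp only: card.empty)
qed

lemma branching_function_bounds:
  assumes "0 \<le> s"
  shows "1 \<le> branching_function T s" "branching_function T s \<le> total"
proof -
  let ?A = "{i\<in>{0..N}. t i < s}"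
  have pos: "0 < (\<Prod>i\<in>B. b i)" if "B \<subseteq> {0..N}" for B
    using that b_pos by (intro prod_pos) auto
  have "0 < (\<Prod>i\<in>?A. b i)" by (rule pos) auto
  then show "1 \<le> branching_function T s" unfolding branching_function_eq[OF assms] by linarith
  have A: "?A \<subseteq> {0..N}" by auto
  have "(\<Prod>i\<in>?A. b i) * 1 \<le> (\<Prod>i\<in>?A. b i) * (\<Prod>i\<in>{0..N} - ?A. b i)"
    using pos[OF Diff_subset, of ?A] by (intro mult_left_mono) linarith+
  also have "\<dots> = total"
    unfolding total_eq prod.subset_diff[OF A finite_atLeastAtMost] by (rule mult.commute)
  finally show "branching_function T s \<le> total" unfolding branching_function_eq[OF assms] by simp
qed

lemma branching_function_segment:
  assumes "k \<le> N" "s \<in> interior (segment k)"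
  shows "branching_function T s = generation_size b (Suc k)"
proof -
  have s: "0 \<le> s" "t k < s" "k < N \<Longrightarrow> s < t (Suc k)"
    using assms segment_nonneg[OF assms(1)] interior_subset[of "segment k"]
    by (auto simp: interior_segment split: if_splits)
  have "t i < s \<longleftrightarrow> i \<le> k" if "i \<le> N" for i
  proof
    assume "t i < s"
    show "i \<le> k"
    proof (rule ccontr)
      assume "\<not> i \<le> k"
      then have "k < N" "Suc k \<le> i" using that by auto
      then have "t (Suc k) \<le> t i" using t_less[of "Suc k" i] that by (cases "Suc k = i") auto
      then show False using s(3)[OF \<open>k < N\<close>] \<open>t i < s\<close> by simp
    qed
  next
    assume "i \<le> k"
    then have "t i \<le> t k" using t_less[of i k] assms(1) by (cases "i = k") auto
    then show "t i < s" using s by simp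
  qed
  then have "{i\<in>{0..N}. t i < s} = {..<Suc k}" using assms(1) by auto
  then show ?thesis unfolding branching_function_eq[OF s(1)] by (simp add: generation_size_def)
qed

lemma branching_function_measurable: "(\<lambda>s. real (branching_function T s)) \<in> borel_measurable borel"
proof -
  have "real (branching_function T s) = (if s < 0 then 0 else (\<Prod>i\<in>{0..N}. if t i < s then real (b i) else 1))" for s
  proof (cases "s < 0")
    case False
    then have "branching_function T s = (\<Prod>i\<in>{0..N}. if t i < s then b i else 1)"
      by (subst branching_function_eq) (auto simp: prod.If_cases Int_def)
    then have "real (branching_function T s) = (\<Prod>i\<in>{0..N}. real (if t i < s then b i else 1))" by simp
    also have "\<dots> = (\<Prod>i\<in>{0..N}. if t i < s then real (b i) else 1)" by (rule prod.cong) auto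
    finally show ?thesis using False by simp
  qed (simp add: branching_function_neg)
  then show ?thesis by simp
qed

sublocale gauss_weight "reduced_weight T" "real total"
proof
  show "reduced_weight T \<in> borel_measurable borel"
    unfolding reduced_weight_def[abs_def]
    by (intro borel_measurable_times branching_function_measurable gauss_measurable)
  fix s :: real assume s: "0 \<le> s"
  have "1 * gauss s \<le> real (branching_function T s) * gauss s"
    using branching_function_bounds(1)[OF s] gauss_pos[of s] by (intro mult_right_mono) auto
  then show "gauss s \<le> reduced_weight T s" by (simp add: reduced_weight_def)
  show "reduced_weight T s \<le> real total * gauss s"
    unfolding reduced_weight_def
    using branching_function_bounds(2)[OF s] gauss_pos[of s] by (intro mult_right_mono) auto
qed

end


section \<open>Integration on a regular tree\<close>

text \<open>Fubini with a finite counting factor; it serves to integrate over all rays at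
  once.\<close>

lemma
  fixes F :: "'i \<times> 'a \<Rightarrow> 'b::{banach, second_countable_topology}"
  assumes A: "finite A" and \<nu>: "sigma_finite_measure \<nu>"
    and F: "F \<in> borel_measurable (count_space A \<Otimes>\<^sub>M \<nu>)"
  shows integrable_count_space_pair_iff:
      "integrable (count_space A \<Otimes>\<^sub>M \<nu>) F \<longleftrightarrow> (\<forall>w\<in>A. integrable \<nu> (\<lambda>s. F (w, s)))"
    and integral_count_space_pair: "integrable (count_space A \<Otimes>\<^sub>M \<nu>) F \<Longrightarrow>
      integral\<^sup>L (count_space A \<Otimes>\<^sub>M \<nu>) F = (\<Sum>w\<in>A. LINT s|\<nu>. F (w, s))"
proof -
  interpret \<nu>: sigma_finite_measure \<nu> by (rule \<nu>)
  interpret A: sigma_finite_measure "count_space A"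
    by (rule sigma_finite_measure_count_space_finite[OF A])
  interpret pair_sigma_finite "count_space A" \<nu> ..
  show "integrable (count_space A \<Otimes>\<^sub>M \<nu>) F \<longleftrightarrow> (\<forall>w\<in>A. integrable \<nu> (\<lambda>s. F (w, s)))"
  proof
    assume "integrable (count_space A \<Otimes>\<^sub>M \<nu>) F"
    from AE_integrable_fst'[OF this] show "\<forall>w\<in>A. integrable \<nu> (\<lambda>s. F (w, s))"
      by (simp add: AE_count_space)
  next
    assume "\<forall>w\<in>A. integrable \<nu> (\<lambda>s. F (w, s))"
    then show "integrable (count_space A \<Otimes>\<^sub>M \<nu>) F"
      by (intro Fubini_integrable[OF F] integrable_count_space A) (simp add: AE_count_space)
  qed
  show "integrable (count_space A \<Otimes>\<^sub>M \<nu>) F \<Longrightarrow>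
      integral\<^sup>L (count_space A \<Otimes>\<^sub>M \<nu>) F = (\<Sum>w\<in>A. LINT s|\<nu>. F (w, s))"
    using integral_fst'[of F] lebesgue_integral_count_space_finite[OF A, of "\<lambda>w. LINT s|\<nu>. F (w, s)"]
    by simp
qed

lemma emeasure_weighted:
  assumes "w \<in> borel_measurable borel" "I \<in> sets borel" "B \<in> sets borel" "B \<subseteq> I"
  shows "emeasure (weighted I w) B = (\<integral>\<^sup>+s. ennreal (w s) * indicator B s \<partial>lborel)"
proof -
  have m: "(\<lambda>s. ennreal (w s)) \<in> borel_measurable lborel" using assms(1) by simp
  have B: "B \<in> sets (restrict_space lborel I)"
    using assms by (subst sets_restrict_space_iff) auto
  have "emeasure (weighted I w) B = (\<integral>\<^sup>+s. ennreal (w s) * indicator B s \<partial>restrict_space lborel I)"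
    unfolding weighted_def by (rule emeasure_density[OF measurable_restrict_space1[OF m] B])
  also have "\<dots> = (\<integral>\<^sup>+s. ennreal (w s) * indicator B s * indicator I s \<partial>lborel)"
    using assms by (intro nn_integral_restrict_space) simp
  also have "\<dots> = (\<integral>\<^sup>+s. ennreal (w s) * indicator B s \<partial>lborel)"
    using assms(4) by (intro nn_integral_cong) (auto simp: indicator_def)
  finally show ?thesis .
qed

lemma sigma_finite_weighted:
  assumes "w \<in> borel_measurable borel" "I \<in> sets borel"
  shows "sigma_finite_measure (weighted I w)"
proof -
  have m: "(\<lambda>s. ennreal (w s)) \<in> borel_measurable lborel" using assms(1) by simp
  have "sigma_finite_measure (restrict_space lborel I)"
    using assms(2) by (intro sigma_finite_measure_restrict_space sigma_finite_lborel) simp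
  then interpret sigma_finite_measure "restrict_space lborel I" .
  show ?thesis
    unfolding weighted_def sigma_finite_iff_density_finite[OF measurable_restrict_space1[OF m]] by simp
qed

section \<open>The tree measure as an average over rays\<close>

context regular_metric_tree
begin

abbreviation "\<nu> \<equiv> weighted {0..} (reduced_weight T)"

lemma reduced_measure_eq: "reduced_measure T c = weighted {c..} (reduced_weight T)"
  by (simp add: reduced_measure_def)

definition tree_sets :: "('v, 'e) tree_point set set" where
  "tree_sets = {A. A \<subseteq> tree_points T \<and>
    (\<forall>e\<in>tree_edges T. {s \<in> edge_interval T e. edge_point T e s \<in> A} \<in> sets borel)}"

lemma segment_borel: "segment k \<in> sets borel"
  by (simp add: segment_def)

text \<open>A ray is a finite union of edges, cut along closed segments, and every edge lies on some
  ray; so Borel traces on edges and on rays amount to the same.\<close>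

lemma tree_sets_iff:
  "A \<in> tree_sets \<longleftrightarrow> A \<subseteq> tree_points T \<and> (\<forall>w\<in>words. {s \<in> {0..}. ray w s \<in> A} \<in> sets borel)"
proof -
  have seg: "{s \<in> edge_interval T (ray_edge w k). edge_point T (ray_edge w k) s \<in> A} =
      {s \<in> {0..}. ray w s \<in> A} \<inter> segment k" if "w \<in> words" "k \<le> N" for w k
    using segment_nonneg[OF that(2)] ray_segment[OF that] edge_interval_ray_edge[OF that] by auto
  have "(\<forall>e\<in>tree_edges T. {s \<in> edge_interval T e. edge_point T e s \<in> A} \<in> sets borel) \<longleftrightarrow>
      (\<forall>w\<in>words. \<forall>k\<in>{0..N}. {s \<in> {0..}. ray w s \<in> A} \<inter> segment k \<in> sets borel)"
    unfolding tree_edges_eq using seg by fastforce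
  also have "\<dots> \<longleftrightarrow> (\<forall>w\<in>words. {s \<in> {0..}. ray w s \<in> A} \<in> sets borel)"
  proof (intro ball_cong refl iffI ballI)
    fix w assume "\<forall>k\<in>{0..N}. {s \<in> {0..}. ray w s \<in> A} \<inter> segment k \<in> sets borel"
    then have "(\<Union>k\<in>{0..N}. {s \<in> {0..}. ray w s \<in> A} \<inter> segment k) \<in> sets borel"
      by (intro sets.finite_UN) auto
    moreover have "(\<Union>k\<in>{0..N}. {s \<in> {0..}. ray w s \<in> A} \<inter> segment k) = {s \<in> {0..}. ray w s \<in> A}"
      using Un_segments by blast
    ultimately show "{s \<in> {0..}. ray w s \<in> A} \<in> sets borel" by simp
  qed (intro sets.Int segment_borel)
  finally show ?thesis by (simp add: tree_sets_def)
qed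

lemma ray_tree_point: "w \<in> words \<Longrightarrow> 0 \<le> s \<Longrightarrow> ray w s \<in> tree_points T"
  by (auto simp: tree_points_eq)

lemma sigma_algebra_tree_sets: "sigma_algebra (tree_points T) tree_sets"
  unfolding sigma_algebra_iff2
proof (intro conjI ballI allI impI)
  show "tree_sets \<subseteq> Pow (tree_points T)" by (auto simp: tree_sets_def)
  show "{} \<in> tree_sets" by (simp add: tree_sets_def)
next
  fix A assume A: "A \<in> tree_sets"
  have "{s \<in> {0..}. ray w s \<in> tree_points T - A} = {0..} - {s \<in> {0..}. ray w s \<in> A}" if "w \<in> words" for w
    using ray_tree_point[OF that] by auto
  then show "tree_points T - A \<in> tree_sets"
    using A unfolding tree_sets_iff by (auto intro!: sets.Diff)
next
  fix A :: "nat \<Rightarrow> _" assume A: "range A \<subseteq> tree_sets"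
  have UN: "{s \<in> {0..}. ray w s \<in> (\<Union>i. A i)} = (\<Union>i. {s \<in> {0..}. ray w s \<in> A i})" for w by auto
  then show "(\<Union>i. A i) \<in> tree_sets"
    unfolding tree_sets_iff
  proof (intro conjI ballI)
    show "(\<Union>i. A i) \<subseteq> tree_points T" using A tree_sets_def by blast
    fix w assume w: "w \<in> words"
    have "{s \<in> {0..}. ray w s \<in> A i} \<in> sets borel" for i
      using A w tree_sets_iff[of "A i"] by auto
    then show "{s \<in> {0..}. ray w s \<in> (\<Union>i. A i)} \<in> sets borel"
      unfolding UN by (intro sets.countable_UN) auto
  qed
qed

text \<open>Provides the sigma-algebra alone, as the target of the ray map, before the measure
  itself is identified.\<close>

definition tree_sigma :: "('v, 'e) tree_point measure" where
  "tree_sigma = sigma (tree_points T) tree_sets"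

lemma tree_sets_subset: "tree_sets \<subseteq> Pow (tree_points T)"
  by (auto simp: tree_sets_def)

lemma space_tree_sigma: "space tree_sigma = tree_points T"
  and sets_tree_sigma: "sets tree_sigma = tree_sets"
  using tree_sets_subset sigma_algebra.sets_measure_of_eq[OF sigma_algebra_tree_sets]
  by (simp_all add: tree_sigma_def space_measure_of)

lemma sets_weighted: "I \<in> sets borel \<Longrightarrow> B \<in> sets borel \<Longrightarrow> B \<subseteq> I \<Longrightarrow> B \<in> sets (weighted I w)"
  unfolding weighted_def by (simp add: sets_restrict_space_iff)

lemma space_weighted: "space (weighted I w) = I"
  by (simp add: weighted_def space_restrict_space)

lemma ray_measurable:
  assumes "w \<in> words"
  shows "ray w \<in> \<nu> \<rightarrow>\<^sub>M tree_sigma"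
proof (rule measurableI)
  fix A assume "A \<in> sets tree_sigma"
  then have "{s \<in> {0..}. ray w s \<in> A} \<in> sets borel"
    using assms unfolding sets_tree_sigma tree_sets_iff by blast
  moreover have "ray w -` A \<inter> space \<nu> = {s \<in> {0..}. ray w s \<in> A}" by (auto simp: space_weighted)
  ultimately show "ray w -` A \<inter> space \<nu> \<in> sets \<nu>" by (auto intro: sets_weighted)
qed (use assms in \<open>simp add: space_weighted space_tree_sigma ray_tree_point\<close>)

abbreviation "ray_space \<equiv> count_space words \<Otimes>\<^sub>M \<nu>"

lemma ray_pair_measurable: "(\<lambda>(w, s). ray w s) \<in> ray_space \<rightarrow>\<^sub>M tree_sigma"
proof -
  have "countable words" using finite_words by (rule countable_finite)
  then show ?thesis
    by (rule measurable_pair_measure_countable1) (simp add: ray_measurable)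
qed

text \<open>An edge of generation \<open>k\<close> fixes the letters from 0 to \<open>k\<close> and
  leaves the later ones free.\<close>

lemma card_ray_edge_fiber:
  assumes "w \<in> words" "k \<le> N"
  shows "card {w' \<in> words. ray_edge w' k = ray_edge w k} * generation_size b (Suc k) = total"
proof -
  have "{w' \<in> words. ray_edge w' k = ray_edge w k} = {w' \<in> words. \<forall>i\<in>{..<Suc k}. w' i = w i}"
    using ray_edge_eq_iff[OF _ assms(1) assms(2)] by (auto simp: less_Suc_eq_le)
  then show ?thesis
    using card_words_fiber[OF assms(1), of "{..<Suc k}"] assms(2)
    by (simp add: generation_size_def subset_iff del: prod.lessThan_Suc)
qed

definition edge_mass :: "('v, 'e) tree_point set \<Rightarrow> ('v, 'e) tree_edge \<Rightarrow> ennreal" where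
  "edge_mass A e = emeasure (weighted (edge_interval T e) gauss) {s \<in> edge_interval T e. edge_point T e s \<in> A}"

text \<open>On the interior of segment \<open>k\<close> the density of \<nu> is the constant
  \<open>generation_size b (Suc k)\<close> times the Gaussian, so a ray sees the mass of each of its
  edges with this multiplicity.\<close>

lemma emeasure_ray:
  assumes A: "A \<in> tree_sets" and w: "w \<in> words"
  shows "emeasure \<nu> {s \<in> {0..}. ray w s \<in> A} =
    (\<Sum>k\<in>{0..N}. of_nat (generation_size b (Suc k)) * edge_mass A (ray_edge w k))"
proof -
  let ?B = "{s \<in> {0..}. ray w s \<in> A}"
  have B: "?B \<in> sets borel" using A w by (simp add: tree_sets_iff)
  let ?f = "\<lambda>k s. of_nat (generation_size b (Suc k)) * (ennreal (gauss s) * indicator (?B \<inter> segment k) s)"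
  have "emeasure \<nu> ?B = (\<integral>\<^sup>+s. ennreal (reduced_weight T s) * indicator ?B s \<partial>lborel)"
    by (rule emeasure_weighted) (use B weight_measurable in auto)
  also have "\<dots> = (\<integral>\<^sup>+s. (\<Sum>k\<in>{0..N}. ?f k s) \<partial>lborel)"
  proof (rule nn_integral_cong_AE)
    \<comment> \<open>At the levels the segments overlap and the branching function jumps; being
      finitely many points, they are discarded.\<close>
    have "AE s in lborel. s \<notin> t ` {0..N}"
      by (rule AE_not_in[OF finite_imp_null_set_lborel]) simp
    then show "AE s in lborel. ennreal (reduced_weight T s) * indicator ?B s = (\<Sum>k\<in>{0..N}. ?f k s)"
    proof eventually_elim
      case (elim s)
      show ?case
      proof (cases "s \<in> ?B")
        case True
        define j where "j = generation s"
        have j: "j \<le> N" "t j \<le> s" "j < N \<Longrightarrow> s < t (Suc j)"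
          using generation[of s] True by (simp_all add: j_def)
        have sj: "s \<in> interior (segment j)"
          using j elim by (auto simp: interior_segment)
        have other: "s \<notin> segment k" if "k \<le> N" "k \<noteq> j" for k
        proof
          assume "s \<in> segment k"
          moreover have "s \<noteq> t (Suc k)" if "k < N" using elim that by auto
          ultimately have "generation s = k"
            using \<open>k \<le> N\<close> by (intro generation_eqI) (auto simp: segment_def split: if_splits)
          then show False using that by (simp add: j_def)
        qed
        have "(\<Sum>k\<in>{0..N}. ?f k s) = (\<Sum>k\<in>{0..N}. if k = j then of_nat (generation_size b (Suc j)) * ennreal (gauss s) else 0)"
          using True other sj interior_subset[of "segment j"] by (intro sum.cong) (auto simp: indicator_def)
        also have "\<dots> = of_nat (generation_size b (Suc j)) * ennreal (gauss s)"
          using j by simp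
        also have "\<dots> = ennreal (reduced_weight T s)"
          using branching_function_segment[OF j(1) sj] gauss_pos[of s]
          by (simp add: reduced_weight_def ennreal_of_nat_eq_real_of_nat ennreal_mult')
        finally show ?thesis using True by simp
      next
        case False
        then have "(\<Sum>k\<in>{0..N}. ?f k s) = 0" by (intro sum.neutral) auto
        then show ?thesis using False by simp
      qed
    qed
  qed
  also have "\<dots> = (\<Sum>k\<in>{0..N}. \<integral>\<^sup>+s. ?f k s \<partial>lborel)"
  proof (rule nn_integral_sum)
    fix k
    have "(\<lambda>s. ennreal (gauss s)) \<in> borel_measurable lborel"
      using measurable_compose[OF gauss_measurable measurable_ennreal] by simp
    moreover have "(indicator (?B \<inter> segment k) :: real \<Rightarrow> ennreal) \<in> borel_measurable lborel"
      using sets.Int[OF B segment_borel] by (intro borel_measurable_indicator) simp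
    ultimately show "?f k \<in> borel_measurable lborel"
      by (intro borel_measurable_times_ennreal borel_measurable_const)
  qed
  also have "\<dots> = (\<Sum>k\<in>{0..N}. of_nat (generation_size b (Suc k)) * edge_mass A (ray_edge w k))"
  proof (intro sum.cong refl)
    fix k assume "k \<in> {0..N}"
    then have k: "k \<le> N" by simp
    have eq: "{s \<in> edge_interval T (ray_edge w k). edge_point T (ray_edge w k) s \<in> A} = ?B \<inter> segment k"
      using segment_nonneg[OF k] ray_segment[OF w k] edge_interval_ray_edge[OF w k] by auto
    have "(\<integral>\<^sup>+s. ?f k s \<partial>lborel) = of_nat (generation_size b (Suc k)) *
        (\<integral>\<^sup>+s. ennreal (gauss s) * indicator (?B \<inter> segment k) s \<partial>lborel)"
      using B segment_borel by (intro nn_integral_cmult) simp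
    also have "(\<integral>\<^sup>+s. ennreal (gauss s) * indicator (?B \<inter> segment k) s \<partial>lborel) = edge_mass A (ray_edge w k)"
      unfolding edge_mass_def eq unfolding edge_interval_ray_edge[OF w k]
      by (rule emeasure_weighted[symmetric]) (use B segment_borel gauss_measurable in auto)
    finally show "(\<integral>\<^sup>+s. ?f k s \<partial>lborel) = of_nat (generation_size b (Suc k)) * edge_mass A (ray_edge w k)" .
  qed
  finally show ?thesis .
qed

text \<open>By \<open>card_ray_edge_fiber\<close>, the number of words through an edge of generation
  \<open>k\<close> times the weight of that generation is always \<open>total\<close>. No edge is
  counted in two generations by \<open>ray_edge_generation\<close>.\<close>

lemma sum_rays_edge_mass:
  "(\<Sum>w\<in>words. \<Sum>k\<in>{0..N}. of_nat (generation_size b (Suc k)) * h (ray_edge w k)) =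
    of_nat total * (\<Sum>e\<in>tree_edges T. h e :: ennreal)"
proof -
  let ?E = "\<lambda>k. (\<lambda>w. ray_edge w k) ` words"
  have "(\<Sum>w\<in>words. of_nat (generation_size b (Suc k)) * h (ray_edge w k)) = of_nat total * (\<Sum>e\<in>?E k. h e)"
    if k: "k \<le> N" for k
  proof -
    have "(\<Sum>w\<in>words. of_nat (generation_size b (Suc k)) * h (ray_edge w k)) =
        (\<Sum>e\<in>?E k. \<Sum>w\<in>{w \<in> words. ray_edge w k = e}. of_nat (generation_size b (Suc k)) * h (ray_edge w k))"
      by (rule sum.image_gen[OF finite_words])
    also have "\<dots> = (\<Sum>e\<in>?E k. of_nat total * h e)"
    proof (intro sum.cong refl)
      fix e assume "e \<in> ?E k"
      then obtain w where w: "w \<in> words" "e = ray_edge w k" by blast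
      have "(\<Sum>w\<in>{w \<in> words. ray_edge w k = e}. of_nat (generation_size b (Suc k)) * h (ray_edge w k)) =
          (\<Sum>w\<in>{w \<in> words. ray_edge w k = e}. of_nat (generation_size b (Suc k)) * h e)"
        by (intro sum.cong) auto
      also have "\<dots> = of_nat (card {w \<in> words. ray_edge w k = e} * generation_size b (Suc k)) * h e"
        by (simp add: mult.assoc)
      finally show "(\<Sum>w\<in>{w \<in> words. ray_edge w k = e}. of_nat (generation_size b (Suc k)) * h (ray_edge w k)) =
          of_nat total * h e"
        unfolding w(2) card_ray_edge_fiber[OF w(1) k] .
    qed
    finally show ?thesis by (simp add: sum_distrib_left)
  qed
  then have "(\<Sum>k\<in>{0..N}. \<Sum>w\<in>words. of_nat (generation_size b (Suc k)) * h (ray_edge w k)) =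
      (\<Sum>k\<in>{0..N}. of_nat total * (\<Sum>e\<in>?E k. h e))"
    by (intro sum.cong) auto
  also have "\<dots> = of_nat total * (\<Sum>k\<in>{0..N}. \<Sum>e\<in>?E k. h e)" by (simp add: sum_distrib_left)
  also have "(\<Sum>k\<in>{0..N}. \<Sum>e\<in>?E k. h e) = (\<Sum>e\<in>tree_edges T. h e)"
    unfolding tree_edges_eq
    by (rule sum.UNION_disjoint[symmetric]) (use finite_words ray_edge_generation in auto)
  finally show ?thesis by (subst sum.swap)
qed

text \<open>Summing \<open>emeasure_ray\<close> over the words gives \<open>total\<close> times the
  sum over edges, so the two set functions agree on \<open>tree_sets\<close>; this suffices because
  \<open>tree_sets\<close> is already a sigma-algebra.\<close>

lemma tree_measure_eq:
  "tree_measure T = density (distr ray_space tree_sigma (\<lambda>(w, s). ray w s)) (\<lambda>_. ennreal (1 / total))"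
    (is "_ = ?D")
proof -
  have space: "space ?D = tree_points T" and sets: "sets ?D = tree_sets"
    by (simp_all add: space_tree_sigma sets_tree_sigma)
  interpret \<nu>: sigma_finite_measure \<nu> by (rule sigma_finite_weighted) (use weight_measurable in auto)
  have em: "emeasure ?D A = (\<Sum>e\<in>tree_edges T. edge_mass A e)" if A: "A \<in> tree_sets" for A
  proof -
    let ?P = "(\<lambda>(w, s). ray w s) -` A \<inter> space ray_space"
    have P: "?P \<in> sets ray_space"
      by (rule measurable_sets[OF ray_pair_measurable]) (simp add: sets_tree_sigma A)
    have "emeasure ?D A = ennreal (1 / total) * emeasure (distr ray_space tree_sigma (\<lambda>(w, s). ray w s)) A"
      by (rule emeasure_density_const) (simp add: sets_tree_sigma A)
    also have "emeasure (distr ray_space tree_sigma (\<lambda>(w, s). ray w s)) A = emeasure ray_space ?P"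
      by (rule emeasure_distr[OF ray_pair_measurable]) (simp add: sets_tree_sigma A)
    also have "\<dots> = (\<integral>\<^sup>+w. emeasure \<nu> (Pair w -` ?P) \<partial>count_space words)"
      by (rule \<nu>.emeasure_pair_measure_alt[OF P])
    also have "\<dots> = (\<Sum>w\<in>words. emeasure \<nu> (Pair w -` ?P))"
      by (rule nn_integral_count_space_finite[OF finite_words])
    also have "\<dots> = (\<Sum>w\<in>words. \<Sum>k\<in>{0..N}. of_nat (generation_size b (Suc k)) * edge_mass A (ray_edge w k))"
    proof (intro sum.cong refl)
      fix w assume w: "w \<in> words"
      have "Pair w -` ?P = {s \<in> {0..}. ray w s \<in> A}" using w by (auto simp: space_pair_measure space_weighted)
      then show "emeasure \<nu> (Pair w -` ?P) = (\<Sum>k\<in>{0..N}. of_nat (generation_size b (Suc k)) * edge_mass A (ray_edge w k))"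
        using emeasure_ray[OF A w] by simp
    qed
    also have "\<dots> = of_nat total * (\<Sum>e\<in>tree_edges T. edge_mass A e)" by (rule sum_rays_edge_mass)
    finally have "emeasure ?D A = (ennreal (1 / total) * of_nat total) * (\<Sum>e\<in>tree_edges T. edge_mass A e)"
      by (simp add: mult.assoc)
    also have "ennreal (1 / total) * of_nat total = 1"
      using total_pos by (simp add: ennreal_of_nat_eq_real_of_nat ennreal_mult'[symmetric])
    finally show ?thesis by simp
  qed
  have "tree_measure T = measure_of (tree_points T) tree_sets (\<lambda>A. \<Sum>e\<in>tree_edges T. edge_mass A e)"
    unfolding tree_measure_def tree_sets_def edge_mass_def ..
  also have "\<dots> = measure_of (tree_points T) tree_sets (emeasure ?D)"
    by (rule measure_of_eq[OF tree_sets_subset])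
      (simp add: em sigma_algebra.sigma_sets_eq[OF sigma_algebra_tree_sets])
  also have "\<dots> = ?D" using measure_of_of_measure[of ?D] by (simp only: space sets)
  finally show ?thesis .
qed

lemma sets_tree_measure: "sets (tree_measure T) = sets tree_sigma"
  by (simp add: tree_measure_eq)

lemma space_tree_measure: "space (tree_measure T) = tree_points T"
  by (simp add: tree_measure_eq space_tree_sigma)

lemma borel_measurable_tree_iff:
  fixes f :: "('v, 'e) tree_point \<Rightarrow> complex"
  shows "f \<in> borel_measurable (tree_measure T) \<longleftrightarrow> (\<forall>w\<in>words. (\<lambda>s. f (ray w s)) \<in> borel_measurable \<nu>)"
proof
  assume "f \<in> borel_measurable (tree_measure T)"
  then have "f \<in> borel_measurable tree_sigma" by (simp add: measurable_cong_sets[OF sets_tree_measure refl])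
  then show "\<forall>w\<in>words. (\<lambda>s. f (ray w s)) \<in> borel_measurable \<nu>"
    using measurable_compose[OF ray_measurable] by blast
next
  assume m: "\<forall>w\<in>words. (\<lambda>s. f (ray w s)) \<in> borel_measurable \<nu>"
  show "f \<in> borel_measurable (tree_measure T)"
  proof (rule measurableI)
    fix B :: "complex set" assume B: "B \<in> sets borel"
    have "{s \<in> {0..}. ray w s \<in> f -` B \<inter> tree_points T} \<in> sets borel" if w: "w \<in> words" for w
    proof -
      have "(\<lambda>s. f (ray w s)) -` B \<inter> space \<nu> \<in> sets \<nu>"
        using m w B measurable_sets by blast
      then have "(\<lambda>s. f (ray w s)) -` B \<inter> {0..} \<in> sets borel"
        unfolding space_weighted by (simp add: weighted_def sets_restrict_space_iff)
      moreover have "{s \<in> {0..}. ray w s \<in> f -` B \<inter> tree_points T} = (\<lambda>s. f (ray w s)) -` B \<inter> {0..}"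
        using ray_tree_point[OF w] by auto
      ultimately show ?thesis by simp
    qed
    then show "f -` B \<inter> space (tree_measure T) \<in> sets (tree_measure T)"
      unfolding sets_tree_measure sets_tree_sigma space_tree_measure tree_sets_iff by auto
  qed simp
qed

lemma ray_pair_borel_measurable:
  fixes f :: "('v, 'e) tree_point \<Rightarrow> 'b::{banach, second_countable_topology}"
  assumes f: "f \<in> borel_measurable (tree_measure T)"
  shows "(\<lambda>(w, s). f (ray w s)) \<in> borel_measurable ray_space"
proof -
  have "f \<in> borel_measurable tree_sigma"
    using f by (simp add: measurable_cong_sets[OF sets_tree_measure refl])
  from measurable_compose[OF ray_pair_measurable this] show ?thesis by (simp add: case_prod_beta)
qed

lemma
  fixes f :: "('v, 'e) tree_point \<Rightarrow> 'b::{banach, second_countable_topology}"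
  assumes f: "f \<in> borel_measurable (tree_measure T)"
  shows integrable_tree_iff:
      "integrable (tree_measure T) f \<longleftrightarrow> (\<forall>w\<in>words. integrable \<nu> (\<lambda>s. f (ray w s)))"
    and integral_tree: "integrable (tree_measure T) f \<Longrightarrow>
      (LINT x|tree_measure T. f x) = (1 / total) *\<^sub>R (\<Sum>w\<in>words. LINT s|\<nu>. f (ray w s))"
proof -
  let ?R = "distr ray_space tree_sigma (\<lambda>(w, s). ray w s)"
  have fm: "f \<in> borel_measurable tree_sigma"
    using f by (simp add: measurable_cong_sets[OF sets_tree_measure refl])
  then have fR: "f \<in> borel_measurable ?R" by simp
  have c: "(\<lambda>_. 1 / real total) \<in> borel_measurable ?R" "AE x in ?R. 0 \<le> 1 / real total" by simp_all
  have \<nu>: "sigma_finite_measure \<nu>" by (rule sigma_finite_weighted) (use weight_measurable in auto)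
  note pair = integrable_count_space_pair_iff[OF finite_words \<nu> ray_pair_borel_measurable[OF f]]
    integral_count_space_pair[OF finite_words \<nu> ray_pair_borel_measurable[OF f]]
  have i1: "integrable (tree_measure T) f \<longleftrightarrow> integrable ?R (\<lambda>x. (1 / total) *\<^sub>R f x)"
    unfolding tree_measure_eq by (rule integrable_density[OF fR c])
  have i2: "integrable ?R (\<lambda>x. (1 / total) *\<^sub>R f x) \<longleftrightarrow> integrable ?R f"
  proof
    assume "integrable ?R (\<lambda>x. (1 / total) *\<^sub>R f x)"
    from integrable_scaleR_right[OF this, of "real total"] show "integrable ?R f"
      using total_pos by simp
  qed (rule integrable_scaleR_right)
  have pair_eq: "(\<lambda>(w, s). f (ray w s)) = (\<lambda>p. f (case p of (w, s) \<Rightarrow> ray w s))"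
    by (auto simp: fun_eq_iff)
  have i3: "integrable ?R f \<longleftrightarrow> integrable ray_space (\<lambda>(w, s). f (ray w s))"
    unfolding pair_eq by (rule integrable_distr_eq[OF ray_pair_measurable fm])
  show "integrable (tree_measure T) f \<longleftrightarrow> (\<forall>w\<in>words. integrable \<nu> (\<lambda>s. f (ray w s)))"
    unfolding i1 i2 i3 using pair(1) by simp
  assume int: "integrable (tree_measure T) f"
  have "(LINT x|tree_measure T. f x) = (LINT x|?R. (1 / total) *\<^sub>R f x)"
    unfolding tree_measure_eq by (rule integral_density[OF fR c])
  also have "\<dots> = (1 / total) *\<^sub>R (LINT x|?R. f x)" by (rule integral_scaleR_right)
  also have "(LINT x|?R. f x) = integral\<^sup>L ray_space (\<lambda>(w, s). f (ray w s))"
    unfolding pair_eq by (rule integral_distr[OF ray_pair_measurable fm])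
  also have "\<dots> = (\<Sum>w\<in>words. LINT s|\<nu>. f (ray w s))"
    using pair(2) int i1 i2 i3 by simp
  finally show "(LINT x|tree_measure T. f x) = (1 / total) *\<^sub>R (\<Sum>w\<in>words. LINT s|\<nu>. f (ray w s))" .
qed

lemma L2_tree_iff:
  "f \<in> L2_functions (tree_measure T) \<longleftrightarrow> (\<forall>w\<in>words. (\<lambda>s. f (ray w s)) \<in> L2_functions \<nu>)"
proof (cases "f \<in> borel_measurable (tree_measure T)")
  case True
  then have "(\<lambda>x. (cmod (f x))\<^sup>2) \<in> borel_measurable (tree_measure T)" by measurable
  from integrable_tree_iff[OF this] show ?thesis
    using True borel_measurable_tree_iff[of f] by (auto simp: L2_functions_def)
next
  case False
  then show ?thesis using borel_measurable_tree_iff[of f] by (auto simp: L2_functions_def)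
qed

text \<open>Every single ray enters the average with the positive weight \<open>1 / total\<close>,
  so a null set of the tree meets it in a null set.\<close>

lemma AE_tree_ray:
  assumes ae: "AE x in tree_measure T. P x" and w: "w \<in> words"
  shows "AE s in \<nu>. P (ray w s)"
proof -
  have \<nu>: "sigma_finite_measure \<nu>" by (rule sigma_finite_weighted) (use weight_measurable in auto)
  interpret \<nu>: sigma_finite_measure \<nu> by (rule \<nu>)
  interpret A: sigma_finite_measure "count_space words"
    by (rule sigma_finite_measure_count_space_finite[OF finite_words])
  interpret pair_sigma_finite "count_space words" \<nu> ..
  have "AE x in distr ray_space tree_sigma (\<lambda>(w, s). ray w s). 0 < ennreal (1 / total) \<longrightarrow> P x"
    using ae unfolding tree_measure_eq by (subst (asm) AE_density) auto
  then have "AE x in distr ray_space tree_sigma (\<lambda>(w, s). ray w s). P x"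
    using total_pos by simp
  from AE_distrD[OF ray_pair_measurable this]
  have "AE p in ray_space. P (ray (fst p) (snd p))" by (simp add: case_prod_beta)
  from AE_pair[OF this] show ?thesis using w by (simp add: AE_count_space)
qed

end


section \<open>Decomposition of functions on the tree\<close>

lemma primitive_on_add:
  assumes "primitive_on I f g" "primitive_on I f' g'"
  shows "primitive_on I (\<lambda>s. f s + f' s) (\<lambda>s. g s + g' s)"
  unfolding primitive_on_def
proof (intro ballI impI)
  fix x y assume xy: "x \<in> I" "y \<in> I" "x \<le> y"
  have g: "set_integrable lborel {x..y} g" "f y - f x = (LINT s:{x..y}|lborel. g s)"
    and g': "set_integrable lborel {x..y} g'" "f' y - f' x = (LINT s:{x..y}|lborel. g' s)"
    using assms xy unfolding primitive_on_def by blast+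
  have "f y + f' y - (f x + f' x) = (f y - f x) + (f' y - f' x)" by simp
  then show "set_integrable lborel {x..y} (\<lambda>s. g s + g' s) \<and>
      f y + f' y - (f x + f' x) = (LINT s:{x..y}|lborel. g s + g' s)"
    unfolding set_integral_add(2)[OF g(1) g'(1)] g(2) g'(2)
    using set_integral_add(1)[OF g(1) g'(1)] by blast
qed

lemma primitive_on_mult:
  assumes "primitive_on I f g"
  shows "primitive_on I (\<lambda>s. c * f s) (\<lambda>s. c * g s)"
  using assms unfolding primitive_on_def by (simp add: right_diff_distrib[symmetric])

lemma primitive_on_sum:
  assumes "\<And>i. i \<in> A \<Longrightarrow> primitive_on I (f i) (g i)"
  shows "primitive_on I (\<lambda>s. \<Sum>i\<in>A. f i s) (\<lambda>s. \<Sum>i\<in>A. g i s)"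
  using assms
proof (induction A rule: infinite_finite_induct)
  case (insert x F)
  then show ?case by (simp add: primitive_on_add)
qed (simp_all add: primitive_on_def set_integrable_def)

text \<open>The function must agree everywhere, the density only almost everywhere; measurability of
  the new density is a separate condition because Borel measurability does not pass through null
  sets.\<close>

lemma primitive_on_cong:
  assumes I: "is_interval I" "I \<in> sets borel" and P: "primitive_on I f g"
    and f: "\<And>s. s \<in> I \<Longrightarrow> f s = f' s" and g: "AE s in lborel. s \<in> I \<longrightarrow> g s = g' s"
    and m: "(\<lambda>s. indicator I s *\<^sub>R g' s) \<in> borel_measurable borel"
  shows "primitive_on I f' g'"
  unfolding primitive_on_def
proof (intro ballI impI)
  fix x y assume xy: "x \<in> I" "y \<in> I" "x \<le> y"
  have sub: "{x..y} \<subseteq> I" by (rule is_interval_Icc_subset[OF I(1) xy(1,2)])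
  have gi: "integrable lborel (\<lambda>s. indicator {x..y} s *\<^sub>R g s)"
    using primitive_onD(1)[OF P xy] by (simp add: set_integrable_def)
  have m': "(\<lambda>s. indicator {x..y} s *\<^sub>R g' s) \<in> borel_measurable lborel"
    using indicator_mult_measurable[OF m _ sub] by simp
  have ae: "AE s in lborel. indicator {x..y} s *\<^sub>R g s = indicator {x..y} s *\<^sub>R g' s"
    using g by eventually_elim (use sub in \<open>auto simp: indicator_def\<close>)
  have "set_integrable lborel {x..y} g'"
    unfolding set_integrable_def
    using integrable_cong_AE[OF borel_measurable_integrable[OF gi] m' ae] gi by simp
  moreover have "(LINT s:{x..y}|lborel. g s) = (LINT s:{x..y}|lborel. g' s)"
    unfolding set_lebesgue_integral_def
    by (rule integral_cong_AE[OF borel_measurable_integrable[OF gi] m' ae])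
  moreover have "f y - f x = (LINT s:{x..y}|lborel. g s)"
    using P xy unfolding primitive_on_def by blast
  ultimately show "set_integrable lborel {x..y} g' \<and> f' y - f' x = (LINT s:{x..y}|lborel. g' s)"
    using f[OF xy(1)] f[OF xy(2)] by simp
qed

text \<open>The single value \<open>f c\<close> is both the end value on the left and the initial
  value on the right, so the increments add. Applied along rays, this uses continuity at a vertex;
  no matching of derivatives is involved.\<close>

lemma primitive_on_Un:
  assumes P: "primitive_on I f g" "primitive_on J f g" and c: "c \<in> I" "c \<in> J"
    and le: "\<And>x. x \<in> I \<Longrightarrow> x \<le> c" "\<And>y. y \<in> J \<Longrightarrow> c \<le> y"
  shows "primitive_on (I \<union> J) f g"
  unfolding primitive_on_def
proof (intro ballI impI)
  fix x y assume xy: "x \<in> I \<union> J" "y \<in> I \<union> J" "x \<le> y"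
  consider "x \<in> I" "y \<in> I" | "x \<in> J" "y \<in> J" | "x \<in> I" "y \<in> J" | "x = c" "y = c"
    using xy le by fastforce
  then show "set_integrable lborel {x..y} g \<and> f y - f x = (LINT s:{x..y}|lborel. g s)"
  proof cases
    case 1
    then show ?thesis using P(1) xy(3) unfolding primitive_on_def by blast
  next
    case 2
    then show ?thesis using P(2) xy(3) unfolding primitive_on_def by blast
  next
    case 4
    then show ?thesis using P(1) c(1) unfolding primitive_on_def by blast
  next
    case 3
    have xc: "set_integrable lborel {x..c} g" "f c - f x = (LINT s:{x..c}|lborel. g s)"
      using P(1) 3 c le unfolding primitive_on_def by blast+
    have cy: "set_integrable lborel {c..y} g" "f y - f c = (LINT s:{c..y}|lborel. g s)"
      using P(2) 3 c le unfolding primitive_on_def by blast+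
    have i: "set_integrable lborel {x..y} g"
      by (rule set_integrable_combine_Icc[OF xc(1) cy(1) le(1)[OF 3(1)] le(2)[OF 3(2)]])
    have "(LINT s:{x..y}|lborel. g s) = (LINT s:{x..c}|lborel. g s) + (LINT s:{c..y}|lborel. g s)"
      by (rule set_integral_combine_Icc[OF i le(1)[OF 3(1)] le(2)[OF 3(2)]])
    moreover have "f y - f x = (f c - f x) + (f y - f c)" by simp
    ultimately show ?thesis using i unfolding xc(2) cy(2) by metis
  qed
qed

interpretation gw: gauss_weight gauss 1
  by unfold_locales simp_all

context regular_metric_tree
begin

lemma L2_gauss_iff:
  assumes "I \<in> sets borel" "I \<subseteq> {0..}"
  shows "f \<in> L2_functions (weighted I (reduced_weight T)) \<longleftrightarrow> f \<in> L2_functions (weighted I gauss)"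
  unfolding L2_weighted_iff[OF assms] gw.L2_weighted_iff[OF assms] ..

lemma segment_boundary:
  assumes "k \<le> N" "s \<in> segment k - interior (segment k)"
  shows "s = t k \<or> k < N \<and> s = t (Suc k)"
proof (cases "k < N")
  case True
  then show ?thesis using assms(2) by (auto simp: interior_segment) (auto simp: segment_def)
next
  case False
  then have "k = N" using assms(1) by simp
  then show ?thesis using assms(2) by (auto simp: interior_segment) (auto simp: segment_def)
qed

lemma segment_interval:
  assumes "k \<le> N"
  shows "is_interval (segment k)" "segment k \<in> sets borel" "segment k \<subseteq> {0..}"
    "finite (segment k - interior (segment k))" "segment k \<subseteq> closure (interior (segment k))"
proof -
  show "is_interval (segment k)" by (simp add: segment_def is_interval_1)
  have "segment k - interior (segment k) \<subseteq> {t k, t (Suc k)}"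
    using segment_boundary[OF assms] by blast
  then show "finite (segment k - interior (segment k))" by (rule finite_subset) simp
  show "segment k \<subseteq> closure (interior (segment k))"
    using t_Suc[of k] by (simp add: interior_segment segment_def)
qed (use segment_borel segment_nonneg assms in auto)

text \<open>On each segment this is the absolute continuity of continuous Sobolev functions on the
  corresponding edge. Consecutive segments share the value at their common vertex, so the primitives
  glue to one on the whole half-line.\<close>

lemma ray_primitive:
  assumes f: "f \<in> H1_tree T" and w: "w \<in> words"
  shows "(\<lambda>s. f (ray w s)) \<in> L2_functions \<nu>"
    and "(\<lambda>s. tree_deriv T f (ray w s)) \<in> L2_functions \<nu>"
    and "primitive_on {0..} (\<lambda>s. f (ray w s)) (\<lambda>s. tree_deriv T f (ray w s))"
proof -
  let ?F = "\<lambda>s. f (ray w s)" and ?D = "\<lambda>s. tree_deriv T f (ray w s)"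
  have seg: "?F \<in> L2_functions (weighted (segment k) (reduced_weight T)) \<and>
      ?D \<in> L2_functions (weighted (segment k) (reduced_weight T)) \<and> primitive_on (segment k) ?F ?D"
    if k: "k \<le> N" for k
  proof -
    let ?I = "segment k" and ?e = "ray_edge w k"
    let ?f = "edge_function T f ?e" and ?g = "weak_deriv (interior ?I) (edge_function T f ?e)"
    note I = segment_interval[OF k]
    have "continuous_on (edge_interval T ?e) ?f" "?f \<in> H1 (edge_interval T ?e) gauss"
      using f ray_edge_tree_edge[OF w k] by (auto simp: H1_tree_def)
    then have fH: "continuous_on ?I ?f" "?f \<in> H1 ?I gauss"
      by (simp_all add: edge_interval_ray_edge[OF w k])
    have P: "primitive_on ?I ?f ?g" by (rule gw.H1_primitive[OF I fH(2,1)])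
    have gL: "?g \<in> L2_functions (weighted ?I gauss)" by (rule gw.H1_weak_deriv(2)[OF I(1-4) fH(2)])
    have F: "?f s = ?F s" if "s \<in> ?I" for s
      using ray_segment[OF w k that] by (simp add: edge_function_def)
    have Dint: "?D s = ?g s" if "s \<in> interior ?I" for s
    proof -
      have s: "s \<in> ?I" using that interior_subset by blast
      have "ray w s = Inner ?e s"
        using that w k by (auto simp: ray_segment[OF w k s] edge_point_ray_edge interior_segment split: if_splits)
      then show ?thesis by (simp add: edge_interval_ray_edge[OF w k])
    qed
    \<comment> \<open>The end points are treated separately since \<open>tree_deriv\<close> is 0 at
      vertices, while \<open>weak_deriv\<close> may have any value there.\<close>
    have Dbd: "?D s = 0" if "s \<in> ?I - interior ?I" for s
    proof -
      have s: "s \<in> ?I" using that by blast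
      have "s = t k \<or> k < N \<and> s = t (Suc k)"
        by (rule segment_boundary[OF k that])
      then have "\<exists>v. ray w s = Vertex v"
        using w k by (auto simp: ray_segment[OF w k s] edge_point_ray_edge simp del: ray_vertex.simps)
      then show ?thesis by auto
    qed
    have int: "interior ?I \<in> sets borel" by (rule borel_open) simp
    have "?g \<in> L2_functions (weighted (interior ?I) gauss)"
      by (rule gw.L2_weighted_subset[OF I(2,3) int interior_subset gL])
    then have "(\<lambda>s. if s \<in> interior ?I then ?g s else 0) \<in> L2_functions (weighted ?I gauss)"
      by (rule gw.L2_weighted_zero_extension[OF I(2,3) int interior_subset])
    moreover have "(if s \<in> interior ?I then ?g s else 0) = ?D s" if "s \<in> ?I" for s
      using Dint[of s] Dbd[of s] that by (cases "s \<in> interior ?I") simp_all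
    ultimately have DL: "?D \<in> L2_functions (weighted ?I gauss)"
      using gw.L2_weighted_cong[OF I(2,3), of "\<lambda>s. if s \<in> interior ?I then ?g s else 0" ?D] by blast
    have "?f \<in> L2_functions (weighted ?I gauss)" using fH by (simp add: H1_def)
    then have FL: "?F \<in> L2_functions (weighted ?I gauss)"
      using gw.L2_weighted_cong[OF I(2,3), of ?f ?F] F by blast
    have ae: "AE s in lborel. s \<in> ?I \<longrightarrow> ?g s = ?D s"
      by (rule AE_interior[OF I(4)], rule AE_I2) (simp add: Dint)
    have m: "(\<lambda>s. indicator ?I s *\<^sub>R ?D s) \<in> borel_measurable borel"
      by (rule gw.L2_weighted_measurable[OF I(2,3) DL])
    have "primitive_on ?I ?F ?D" by (rule primitive_on_cong[OF I(1,2) P F ae m])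
    with DL FL show ?thesis unfolding L2_gauss_iff[OF I(2,3)] by blast
  qed
  have A: "segment k \<in> sets borel \<and> segment k \<subseteq> {0..}" if "k \<in> {0..N}" for k
    using that segment_borel segment_nonneg by simp
  have FA: "?F \<in> L2_functions (weighted (segment k) (reduced_weight T))" if "k \<in> {0..N}" for k
    using seg[of k] that by simp
  have DA: "?D \<in> L2_functions (weighted (segment k) (reduced_weight T))" if "k \<in> {0..N}" for k
    using seg[of k] that by simp
  have "?F \<in> L2_functions (weighted (\<Union>k\<in>{0..N}. segment k) (reduced_weight T))"
    by (rule L2_weighted_UN[OF finite_atLeastAtMost A FA])
  then show "?F \<in> L2_functions \<nu>" unfolding Un_segments .
  have "?D \<in> L2_functions (weighted (\<Union>k\<in>{0..N}. segment k) (reduced_weight T))"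
    by (rule L2_weighted_UN[OF finite_atLeastAtMost A DA])
  then show "?D \<in> L2_functions \<nu>" unfolding Un_segments .
  \<comment> \<open>The bounded segments are attached one at a time; the unbounded segment follows
    at the end.\<close>
  have "primitive_on {0..t n} ?F ?D" if "n \<le> N" for n
    using that
  proof (induction n)
    case 0
    have "{0..t 0} \<subseteq> segment 0" using t_0 t_segment[of 0] by simp
    then show ?case using seg[of 0] primitive_on_subset by blast
  next
    case (Suc n)
    then have n: "n < N" "n \<le> N" by simp_all
    have "primitive_on ({0..t n} \<union> segment n) ?F ?D"
    proof (rule primitive_on_Un)
      show "primitive_on {0..t n} ?F ?D" by (rule Suc.IH[OF n(2)])
      show "primitive_on (segment n) ?F ?D" using seg[OF n(2)] by blast
      show "t n \<in> {0..t n}" using t_nonneg[OF n(2)] by simp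
      show "t n \<in> segment n" by (rule t_segment[OF n(2)])
      show "t n \<le> y" if "y \<in> segment n" for y using that n(1) by (simp add: segment_def)
    qed simp
    moreover have "{0..t n} \<union> segment n = {0..t (Suc n)}"
      using n t_nonneg[OF n(2)] t_Suc[OF n(1)] by (auto simp: segment_def)
    ultimately show ?case by (simp only:)
  qed
  note initial = this[OF order_refl]
  have "primitive_on ({0..t N} \<union> segment N) ?F ?D"
  proof (rule primitive_on_Un[OF initial])
    show "primitive_on (segment N) ?F ?D" using seg[OF order_refl] by blast
    show "t N \<in> {0..t N}" using t_nonneg[of N] by simp
    show "t N \<in> segment N" by (rule t_segment[OF order_refl])
    show "t N \<le> y" if "y \<in> segment N" for y using that by (simp add: segment_def)
  qed simp
  moreover have "{0..t N} \<union> segment N = {0..}"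
    using t_nonneg[of N] by (auto simp: segment_def)
  ultimately show "primitive_on {0..} ?F ?D" by (simp only:)
qed

text \<open>The converse of \<open>ray_primitive\<close>: every edge lies on some ray and inherits
  the primitive from it. Different rays may bring different densities on a common edge, since any
  one of them certifies membership.\<close>

lemma H1_treeI:
  assumes f: "\<And>w. w \<in> words \<Longrightarrow> (\<lambda>s. f (ray w s)) \<in> L2_functions \<nu>"
    and g: "\<And>w. w \<in> words \<Longrightarrow> g w \<in> L2_functions \<nu>"
    and P: "\<And>w. w \<in> words \<Longrightarrow> primitive_on {0..} (\<lambda>s. f (ray w s)) (g w)"
  shows "f \<in> H1_tree T"
  unfolding H1_tree_def mem_Collect_eq
proof
  fix e assume "e \<in> tree_edges T"
  then obtain k w where k: "k \<le> N" and w: "w \<in> words" and e: "e = ray_edge w k"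
    unfolding tree_edges_eq by auto
  let ?I = "segment k"
  note I = segment_interval[OF k]
  have H: "{0::real..} \<in> sets borel" "{0..} \<subseteq> {0::real..}" by simp_all
  have F: "f (ray w s) = edge_function T f e s" if "s \<in> ?I" for s
    using ray_segment[OF w k that] by (simp add: edge_function_def e)
  have gL: "g w \<in> L2_functions (weighted ?I gauss)"
    using L2_weighted_subset[OF H I(2,3) g[OF w]] unfolding L2_gauss_iff[OF I(2,3)] .
  have "(\<lambda>s. f (ray w s)) \<in> L2_functions (weighted ?I gauss)"
    using L2_weighted_subset[OF H I(2,3) f[OF w]] unfolding L2_gauss_iff[OF I(2,3)] .
  then have fL: "edge_function T f e \<in> L2_functions (weighted ?I gauss)"
    using gw.L2_weighted_cong[OF I(2,3), of "\<lambda>s. f (ray w s)" "edge_function T f e"] F by blast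
  have m: "(\<lambda>s. indicator ?I s *\<^sub>R g w s) \<in> borel_measurable borel"
    using gL gw.L2_weighted_iff[OF I(2,3)] by blast
  have "primitive_on ?I (edge_function T f e) (g w)"
    by (rule primitive_on_cong[OF I(1,2) primitive_on_subset[OF P[OF w] I(3)] F _ m]) simp_all
  from gw.primitive_H1[OF I(1-3) fL gL this]
  show "continuous_on (edge_interval T e) (edge_function T f e) \<and>
      edge_function T f e \<in> H1 (edge_interval T e) gauss"
    by (simp add: e edge_interval_ray_edge[OF w k])
qed

section \<open>Coefficients of functions on the tree\<close>

definition mean_part :: "(('v, 'e) tree_point \<Rightarrow> complex) \<Rightarrow> real \<Rightarrow> complex" where
  "mean_part f s = (\<Sum>w\<in>words. f (ray w s)) / of_nat total"

text \<open>For fixed \<open>s\<close>, the inner product with the basis function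
  \<open>coeff k i\<close> with respect to the uniform probability on words.\<close>

definition part :: "nat \<Rightarrow> nat \<Rightarrow> (('v, 'e) tree_point \<Rightarrow> complex) \<Rightarrow> real \<Rightarrow> complex" where
  "part k i f s = (\<Sum>w\<in>words. cnj (coeff k i w) * f (ray w s)) / of_nat total"

lemma mean_part_lin: "mean_part (\<lambda>x. c * f x + g x) = (\<lambda>s. c * mean_part f s + mean_part g s)"
  by (simp add: mean_part_def fun_eq_iff sum.distrib sum_distrib_left add_divide_distrib)

lemma part_lin: "part k i (\<lambda>x. c * f x + g x) = (\<lambda>s. c * part k i f s + part k i g s)"
  by (simp add: part_def fun_eq_iff sum.distrib sum_distrib_left add_divide_distrib distrib_left mult_ac)

lemma ray_cong:
  assumes "w \<in> words" "w' \<in> words" "k \<le> N" "0 \<le> s" "s \<le> t k" "\<And>i. i < k \<Longrightarrow> w i = w' i"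
  shows "ray w s = ray w' s"
proof -
  have "w i = w' i" if "i \<le> N" "t i < s" for i
    using t_less_iff[OF that(1) assms(3)] that assms(5,6) by auto
  then show ?thesis using ray_eq_iff[OF assms(1,2,4)] by blast
qed

lemma part_eq_0:
  assumes "k \<le> N" "i < mult_of k" "0 \<le> s" "s \<le> t k"
  shows "part k i f s = 0"
proof -
  have "(\<Sum>w\<in>words. cnj (coeff k i w) * f (ray w s)) = 0"
  proof (rule coeff_orthogonal[OF assms(1,2)])
    fix w w' assume "w \<in> words" "w' \<in> words" "\<And>i. i < k \<Longrightarrow> w i = w' i"
    then have "ray w s = ray w' s" using assms by (intro ray_cong[of w w' k]) auto
    then show "f (ray w s) = f (ray w' s)" by (rule arg_cong)
  qed
  then show ?thesis by (simp add: part_def)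
qed

lemma mean_part_as_sum: "mean_part f = (\<lambda>s. \<Sum>w\<in>words. (1 / of_nat total) * f (ray w s))"
  by (simp add: mean_part_def fun_eq_iff sum_divide_distrib)

lemma part_as_sum: "part k i f = (\<lambda>s. \<Sum>w\<in>words. (cnj (coeff k i w) / of_nat total) * f (ray w s))"
  by (simp add: part_def fun_eq_iff sum_divide_distrib)

lemma L2_parts:
  assumes "f \<in> L2_functions (tree_measure T)"
  shows "mean_part f \<in> L2_functions \<nu>" "part k i f \<in> L2_functions \<nu>"
  using assms unfolding L2_tree_iff mean_part_as_sum part_as_sum
  by - (rule L2_functions_sum, rule L2_functions_scale, blast)+

lemma nonneg_half_line: "{0::real..} \<in> sets borel" "{0..} \<subseteq> {0::real..}"
  by simp_all

lemma L2_half_line: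
  assumes "k \<le> N" "f \<in> L2_functions \<nu>"
  shows "f \<in> L2_functions (weighted {t k..} (reduced_weight T))"
  using half_line[OF t_nonneg[OF assms(1)]]
  by (intro L2_weighted_subset[OF nonneg_half_line _ _ assms(2)])

lemma integral_half_line:
  assumes k: "k \<le> N" and f: "f \<in> L2_functions \<nu>" "g \<in> L2_functions \<nu>"
    and 0: "\<And>s. 0 \<le> s \<Longrightarrow> s \<le> t k \<Longrightarrow> f s = 0"
  shows "(LINT s|\<nu>. f s * cnj (g s)) = (LINT s|weighted {t k..} (reduced_weight T). f s * cnj (g s))"
proof -
  note H = half_line[OF t_nonneg[OF k]]
  have "(\<lambda>s. f s * cnj (g s)) \<in> borel_measurable \<nu>"
    by (rule borel_measurable_integrable[OF L2_functions_mult_integrable[OF f]])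
  then have m: "(\<lambda>s. indicator {0..} s *\<^sub>R (f s * cnj (g s))) \<in> borel_measurable borel"
    unfolding borel_measurable_weighted_iff[OF nonneg_half_line(1)] .
  have eq: "indicator {0..} s *\<^sub>R (reduced_weight T s *\<^sub>R (f s * cnj (g s))) =
      indicator {t k..} s *\<^sub>R (reduced_weight T s *\<^sub>R (f s * cnj (g s)))" for s
    using 0[of s] t_nonneg[OF k] by (cases "s \<le> t k") (auto simp: indicator_def)
  show ?thesis
    unfolding integral_weighted[OF nonneg_half_line m]
      integral_weighted[OF H(2,3) indicator_mult_measurable[OF m H(2,3)]] eq ..
qed

text \<open>Parseval on the words for each fixed \<open>s\<close>, integrated against \<nu>. The
  coefficients of generation \<open>k\<close> vanish up to \<open>t k\<close>, so their integrals
  shrink to the half-line from \<open>t k\<close>. The identity serves both for the inner product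
  and, applied to derivatives, for the form.\<close>

lemma tree_inner_eq:
  assumes f: "f \<in> L2_functions (tree_measure T)" and g: "g \<in> L2_functions (tree_measure T)"
  shows "(LINT x|tree_measure T. f x * cnj (g x)) = (LINT s|\<nu>. mean_part f s * cnj (mean_part g s)) +
    (\<Sum>k\<in>{0..N}. \<Sum>i<mult_of k. LINT s|weighted {t k..} (reduced_weight T). part k i f s * cnj (part k i g s))"
proof -
  have int: "integrable (tree_measure T) (\<lambda>x. f x * cnj (g x))" by (rule L2_functions_mult_integrable[OF f g])
  have fw: "(\<lambda>s. f (ray w s)) \<in> L2_functions \<nu>" "(\<lambda>s. g (ray w s)) \<in> L2_functions \<nu>" if "w \<in> words" for w
    using f g that unfolding L2_tree_iff by blast+
  note mean = L2_functions_mult_integrable[OF L2_parts(1)[OF f] L2_parts(1)[OF g]]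
  note parts = L2_functions_mult_integrable[OF L2_parts(2)[OF f] L2_parts(2)[OF g]]
  have "(LINT x|tree_measure T. f x * cnj (g x)) =
      (1 / total) *\<^sub>R (\<Sum>w\<in>words. LINT s|\<nu>. f (ray w s) * cnj (g (ray w s)))"
    by (rule integral_tree[OF borel_measurable_integrable[OF int] int])
  also have "(\<Sum>w\<in>words. LINT s|\<nu>. f (ray w s) * cnj (g (ray w s))) =
      (LINT s|\<nu>. (\<Sum>w\<in>words. f (ray w s) * cnj (g (ray w s))))"
    by (rule Bochner_Integration.integral_sum[symmetric]) (rule L2_functions_mult_integrable[OF fw])
  also have "(1 / total) *\<^sub>R \<dots> = (LINT s|\<nu>. (1 / total) *\<^sub>R (\<Sum>w\<in>words. f (ray w s) * cnj (g (ray w s))))"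
    by (rule integral_scaleR_right[symmetric])
  also have "\<dots> = (LINT s|\<nu>. mean_part f s * cnj (mean_part g s) +
      (\<Sum>k\<in>{0..N}. \<Sum>i<mult_of k. part k i f s * cnj (part k i g s)))"
  proof (rule Bochner_Integration.integral_cong[OF refl])
    fix s
    have "(1 / total) *\<^sub>R (\<Sum>w\<in>words. f (ray w s) * cnj (g (ray w s))) =
        (\<Sum>w\<in>words. f (ray w s) * cnj (g (ray w s))) / of_nat total"
      by (simp add: scaleR_conv_of_real)
    then show "(1 / total) *\<^sub>R (\<Sum>w\<in>words. f (ray w s) * cnj (g (ray w s))) =
        mean_part f s * cnj (mean_part g s) + (\<Sum>k\<in>{0..N}. \<Sum>i<mult_of k. part k i f s * cnj (part k i g s))"
      unfolding mean_part_def part_def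
      using coeff_parseval[of "\<lambda>w. f (ray w s)" "\<lambda>w. g (ray w s)"] by (simp only:)
  qed
  also have "\<dots> = (LINT s|\<nu>. mean_part f s * cnj (mean_part g s)) +
      (LINT s|\<nu>. (\<Sum>k\<in>{0..N}. \<Sum>i<mult_of k. part k i f s * cnj (part k i g s)))"
    by (intro Bochner_Integration.integral_add mean Bochner_Integration.integrable_sum parts)
  also have "(LINT s|\<nu>. (\<Sum>k\<in>{0..N}. \<Sum>i<mult_of k. part k i f s * cnj (part k i g s))) =
      (\<Sum>k\<in>{0..N}. LINT s|\<nu>. (\<Sum>i<mult_of k. part k i f s * cnj (part k i g s)))"
    by (intro Bochner_Integration.integral_sum Bochner_Integration.integrable_sum parts)
  also have "\<dots> = (\<Sum>k\<in>{0..N}. \<Sum>i<mult_of k. LINT s|\<nu>. part k i f s * cnj (part k i g s))"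
    by (intro sum.cong refl Bochner_Integration.integral_sum parts)
  also have "\<dots> = (\<Sum>k\<in>{0..N}. \<Sum>i<mult_of k.
      LINT s|weighted {t k..} (reduced_weight T). part k i f s * cnj (part k i g s))"
    by (intro sum.cong refl integral_half_line L2_parts f g part_eq_0) auto
  finally show ?thesis .
qed

text \<open>The inverse of the expansion. A point at distance \<open>s\<close> determines only the
  letters of levels below \<open>s\<close>, and the word picked by \<open>SOME\<close> is arbitrary
  in the others. Cutting off at \<open>s \<le> t k\<close> makes the result independent of that
  choice, since \<open>coeff k i\<close> depends on the letters up to \<open>k\<close>, all known
  once \<open>t k < s\<close>.\<close>

definition tree_function ::
  "(real \<Rightarrow> complex) \<Rightarrow> (nat \<Rightarrow> nat \<Rightarrow> real \<Rightarrow> complex) \<Rightarrow> ('v, 'e) tree_point \<Rightarrow> complex" where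
  "tree_function \<phi>0 \<phi> x =
     (let s = dist_root T x; w = (SOME w. w \<in> words \<and> ray w s = x) in
       \<phi>0 s + (\<Sum>k\<in>{0..N}. \<Sum>i<mult_of k. coeff k i w * (if s \<le> t k then 0 else \<phi> k i s)))"

lemma tree_function_ray:
  assumes w: "w \<in> words" and s: "0 \<le> s"
  shows "tree_function \<phi>0 \<phi> (ray w s) =
    \<phi>0 s + (\<Sum>k\<in>{0..N}. \<Sum>i<mult_of k. coeff k i w * (if s \<le> t k then 0 else \<phi> k i s))"
proof -
  define w' where "w' = (SOME w'. w' \<in> words \<and> ray w' s = ray w s)"
  have "w' \<in> words \<and> ray w' s = ray w s"
    unfolding w'_def by (rule someI[of _ w]) (use w in simp)
  then have w': "w' \<in> words" "\<forall>i\<le>N. t i < s \<longrightarrow> w' i = w i" using ray_eq_iff[OF _ w s] by blast+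
  have "coeff k i w' * (if s \<le> t k then 0 else \<phi> k i s) = coeff k i w * (if s \<le> t k then 0 else \<phi> k i s)"
    if "k \<le> N" for k i
  proof (cases "s \<le> t k")
    case False
    have "w' j = w j" if "j \<le> k" for j
    proof -
      have "t j \<le> t k" using t_less[of j k] that \<open>k \<le> N\<close> by (cases "j = k") auto
      then show ?thesis using w'(2) that \<open>k \<le> N\<close> False by auto
    qed
    then have "coeff k i w' = coeff k i w" by (rule coeff_cong)
    then show ?thesis by simp
  qed simp
  then have "(\<Sum>k\<in>{0..N}. \<Sum>i<mult_of k. coeff k i w' * (if s \<le> t k then 0 else \<phi> k i s)) =
      (\<Sum>k\<in>{0..N}. \<Sum>i<mult_of k. coeff k i w * (if s \<le> t k then 0 else \<phi> k i s))"
    by (intro sum.cong refl) auto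
  then show ?thesis
    unfolding tree_function_def dist_root_ray[OF w s] Let_def w'_def[symmetric] by simp
qed

lemma sum_words_swap:
  "(\<Sum>w\<in>words. \<Sum>k\<in>{0..N}. \<Sum>i<mult_of k. h w k i) = (\<Sum>k\<in>{0..N}. \<Sum>i<mult_of k. \<Sum>w\<in>words. h w k i :: complex)"
proof -
  have "(\<Sum>w\<in>words. \<Sum>k\<in>{0..N}. \<Sum>i<mult_of k. h w k i) = (\<Sum>k\<in>{0..N}. \<Sum>w\<in>words. \<Sum>i<mult_of k. h w k i)"
    by (rule sum.swap)
  also have "\<dots> = (\<Sum>k\<in>{0..N}. \<Sum>i<mult_of k. \<Sum>w\<in>words. h w k i)"
    by (intro sum.cong refl sum.swap)
  finally show ?thesis .
qed

lemma mean_part_tree_function: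
  assumes s: "0 \<le> s"
  shows "mean_part (tree_function \<phi>0 \<phi>) s = \<phi>0 s"
proof -
  have 0: "(\<Sum>w\<in>words. coeff k i w * z) = 0" if "k \<le> N" "i < mult_of k" for k i z
  proof -
    have "cnj (\<Sum>w\<in>words. cnj (coeff k i w)) = 0" by (simp only: coeff_sum[OF that] complex_cnj_zero)
    then show ?thesis by (simp flip: sum_distrib_right)
  qed
  have "(\<Sum>w\<in>words. tree_function \<phi>0 \<phi> (ray w s)) = (\<Sum>w\<in>words. \<phi>0 s) +
      (\<Sum>w\<in>words. \<Sum>k\<in>{0..N}. \<Sum>i<mult_of k. coeff k i w * (if s \<le> t k then 0 else \<phi> k i s))"
    unfolding sum.distrib[symmetric] by (intro sum.cong refl tree_function_ray s)
  also have "(\<Sum>w\<in>words. \<Sum>k\<in>{0..N}. \<Sum>i<mult_of k. coeff k i w * (if s \<le> t k then 0 else \<phi> k i s)) = 0"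
    unfolding sum_words_swap by (intro sum.neutral ballI 0) auto
  finally show ?thesis using total_pos by (simp add: mean_part_def card_words)
qed

lemma part_tree_function:
  assumes s: "0 \<le> s" and k: "k \<le> N" and i: "i < mult_of k"
  shows "part k i (tree_function \<phi>0 \<phi>) s = (if s \<le> t k then 0 else \<phi> k i s)"
proof -
  let ?\<psi> = "\<lambda>k i. if s \<le> t k then 0 else \<phi> k i s"
  have "(\<Sum>w\<in>words. cnj (coeff k i w) * tree_function \<phi>0 \<phi> (ray w s)) =
      (\<Sum>w\<in>words. cnj (coeff k i w) * \<phi>0 s + (\<Sum>k'\<in>{0..N}. \<Sum>i'<mult_of k'. cnj (coeff k i w) * coeff k' i' w * ?\<psi> k' i'))"
    by (intro sum.cong refl) (simp only: tree_function_ray[OF _ s] distrib_left sum_distrib_left mult.assoc)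
  also have "\<dots> = (\<Sum>w\<in>words. cnj (coeff k i w)) * \<phi>0 s +
      (\<Sum>k'\<in>{0..N}. \<Sum>i'<mult_of k'. (\<Sum>w\<in>words. cnj (coeff k i w) * coeff k' i' w) * ?\<psi> k' i')"
    unfolding sum.distrib sum_words_swap sum_distrib_right ..
  also have "\<dots> = (\<Sum>k'\<in>{0..N}. \<Sum>i'<mult_of k'. if k' = k then if i' = i then of_nat total * ?\<psi> k i else 0 else 0)"
    unfolding coeff_sum[OF k i] mult_zero_left add_0_left
    by (intro sum.cong refl) (simp add: coeff_orthonormal[OF k i])
  also have "\<dots> = (\<Sum>k'\<in>{0..N}. if k' = k then of_nat total * ?\<psi> k i else 0)"
  proof (intro sum.cong refl)
    fix k' :: nat
    show "(\<Sum>i'<mult_of k'. if k' = k then if i' = i then of_nat total * ?\<psi> k i else 0 else 0) =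
        (if k' = k then of_nat total * ?\<psi> k i else 0)"
    proof (cases "k' = k")
      case True
      have "(\<Sum>i'<mult_of k. if i' = i then of_nat total * ?\<psi> k i else 0) =
          (if i \<in> {..<mult_of k} then of_nat total * ?\<psi> k i else 0)"
        by (rule sum.delta[OF finite_lessThan])
      also have "\<dots> = of_nat total * ?\<psi> k i" using i by (simp only: lessThan_iff if_True)
      finally show ?thesis unfolding True by (simp only: refl if_True)
    qed simp
  qed
  also have "\<dots> = of_nat total * ?\<psi> k i" using k by (subst sum.delta) simp_all
  finally show ?thesis unfolding part_def using total_pos by simp
qed

lemma L2_extension:
  assumes k: "k \<le> N" and \<phi>: "\<phi> \<in> L2_functions (weighted {t k..} (reduced_weight T))"
  shows "(\<lambda>s. if s \<le> t k then 0 else \<phi> s) \<in> L2_functions \<nu>"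
proof -
  note H = half_line[OF t_nonneg[OF k]]
  have J: "{t k<..} \<in> sets borel" "{t k<..} \<subseteq> {t k..}" "{t k<..} \<subseteq> {0..}" using t_nonneg[OF k] by auto
  have "\<phi> \<in> L2_functions (weighted {t k<..} (reduced_weight T))"
    by (rule L2_weighted_subset[OF H(2,3) J(1,2) \<phi>])
  then have "(\<lambda>s. if s \<in> {t k<..} then \<phi> s else 0) \<in> L2_functions \<nu>"
    by (rule L2_weighted_zero_extension[OF nonneg_half_line J(1,3)])
  moreover have "(\<lambda>s. if s \<in> {t k<..} then \<phi> s else 0) = (\<lambda>s. if s \<le> t k then 0 else \<phi> s)" by auto
  ultimately show ?thesis by simp
qed

lemma tree_function_L2:
  assumes \<phi>0: "\<phi>0 \<in> L2_functions \<nu>"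
    and \<phi>: "\<And>k i. k \<le> N \<Longrightarrow> i < mult_of k \<Longrightarrow> \<phi> k i \<in> L2_functions (weighted {t k..} (reduced_weight T))"
  shows "tree_function \<phi>0 \<phi> \<in> L2_functions (tree_measure T)"
  unfolding L2_tree_iff
proof
  fix w assume w: "w \<in> words"
  have "(\<lambda>s. \<phi>0 s + (\<Sum>k\<in>{0..N}. \<Sum>i<mult_of k. coeff k i w * (if s \<le> t k then 0 else \<phi> k i s))) \<in> L2_functions \<nu>"
    by (intro L2_functions_add \<phi>0 L2_functions_sum L2_functions_scale L2_extension \<phi>) auto
  then show "(\<lambda>s. tree_function \<phi>0 \<phi> (ray w s)) \<in> L2_functions \<nu>"
    by (subst L2_weighted_cong[OF nonneg_half_line]) (auto simp: tree_function_ray[OF w])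
qed

text \<open>In the second claim the exceptional point is \<open>t k\<close>, where the tree function
  uses 0 instead of the given value.\<close>

lemma AE_parts_tree_function:
  "AE s in \<nu>. mean_part (tree_function \<phi>0 \<phi>) s = \<phi>0 s"
  "k \<le> N \<Longrightarrow> i < mult_of k \<Longrightarrow>
    AE s in weighted {t k..} (reduced_weight T). part k i (tree_function \<phi>0 \<phi>) s = \<phi> k i s"
proof -
  show "AE s in \<nu>. mean_part (tree_function \<phi>0 \<phi>) s = \<phi>0 s"
    unfolding AE_weighted_iff[OF nonneg_half_line] by (intro AE_I2) (simp add: mean_part_tree_function)
  assume k: "k \<le> N" "i < mult_of k"
  note H = half_line[OF t_nonneg[OF k(1)]]
  show "AE s in weighted {t k..} (reduced_weight T). part k i (tree_function \<phi>0 \<phi>) s = \<phi> k i s"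
    unfolding AE_weighted_iff[OF H(2,3)] using AE_lborel_singleton[of "t k"]
  proof eventually_elim
    case (elim s)
    show ?case
    proof
      assume "s \<in> {t k..}"
      then have "0 \<le> s" "\<not> s \<le> t k" using elim t_nonneg[OF k(1)] by auto
      then show "part k i (tree_function \<phi>0 \<phi>) s = \<phi> k i s" using k by (simp add: part_tree_function)
    qed
  qed
qed

text \<open>The Dirichlet condition at \<open>t k\<close> is what allows gluing with the zero
  function on \<open>{0..t k}\<close>.\<close>

lemma primitive_extension:
  assumes k: "k \<le> N" and \<phi>: "\<phi> \<in> H1_0_half_line (t k) (reduced_weight T)"
  shows "\<exists>g\<in>L2_functions \<nu>. primitive_on {0..} (\<lambda>s. if s \<le> t k then 0 else \<phi> s) g"
proof -
  note H = half_line[OF t_nonneg[OF k]]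
  let ?d = "weak_deriv (interior {t k..}) \<phi>"
  let ?\<psi> = "\<lambda>s. if s \<le> t k then 0 else \<phi> s" and ?g = "\<lambda>s. if s \<le> t k then 0 else ?d s"
  have \<phi>H: "\<phi> \<in> H1 {t k..} (reduced_weight T)" "continuous_on {t k..} \<phi>" "\<phi> (t k) = 0"
    using \<phi> by (auto simp: H1_0_half_line_def)
  have P: "primitive_on {t k..} \<phi> ?d" by (rule H1_primitive[OF H \<phi>H(1,2)])
  have gL: "?g \<in> L2_functions \<nu>" by (rule L2_extension[OF k H1_weak_deriv(2)[OF H(1-4) \<phi>H(1)]])
  have m: "(\<lambda>s. indicator {t k..} s *\<^sub>R ?g s) \<in> borel_measurable borel"
    by (rule L2_weighted_measurable[OF H(2,3) L2_half_line[OF k gL]])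
  have "primitive_on {t k..} ?\<psi> ?g"
  proof (rule primitive_on_cong[OF H(1,2) P _ _ m])
    show "AE s in lborel. s \<in> {t k..} \<longrightarrow> ?d s = ?g s"
      using AE_lborel_singleton[of "t k"] by eventually_elim auto
  qed (use \<phi>H(3) in auto)
  moreover have "primitive_on {0..t k} ?\<psi> ?g"
  proof (rule primitive_on_cong[OF _ _ zero_primitive])
    have "(\<lambda>s. indicator {0..t k} s *\<^sub>R ?g s) = (\<lambda>s. 0)" by (auto simp: indicator_def)
    then show "(\<lambda>s. indicator {0..t k} s *\<^sub>R ?g s) \<in> borel_measurable borel" by simp
  qed (auto simp: is_interval_1)
  ultimately have "primitive_on ({0..t k} \<union> {t k..}) ?\<psi> ?g"
    by (intro primitive_on_Un[of _ _ _ _ "t k"]) (use t_nonneg[OF k] in auto)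
  moreover have "{0..t k} \<union> {t k..} = {0..}" using t_nonneg[OF k] by auto
  ultimately show ?thesis using gL by auto
qed

lemma tree_function_H1:
  assumes \<phi>0: "\<phi>0 \<in> H1 {0..} (reduced_weight T)" "continuous_on {0..} \<phi>0"
    and \<phi>: "\<And>k i. k \<le> N \<Longrightarrow> i < mult_of k \<Longrightarrow> \<phi> k i \<in> H1_0_half_line (t k) (reduced_weight T)"
  shows "tree_function \<phi>0 \<phi> \<in> H1_tree T"
proof -
  note H = half_line[OF order_refl]
  let ?g0 = "weak_deriv (interior {0..}) \<phi>0"
  have P0: "primitive_on {0..} \<phi>0 ?g0" by (rule H1_primitive[OF H \<phi>0])
  have g0: "?g0 \<in> L2_functions \<nu>" by (rule H1_weak_deriv(2)[OF H(1-4) \<phi>0(1)])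
  define g where "g k i = (SOME g. g \<in> L2_functions \<nu> \<and>
      primitive_on {0..} (\<lambda>s. if s \<le> t k then 0 else \<phi> k i s) g)" for k i
  have gP: "g k i \<in> L2_functions \<nu> \<and> primitive_on {0..} (\<lambda>s. if s \<le> t k then 0 else \<phi> k i s) (g k i)"
    if "k \<le> N" "i < mult_of k" for k i
  proof -
    have "\<exists>g. g \<in> L2_functions \<nu> \<and> primitive_on {0..} (\<lambda>s. if s \<le> t k then 0 else \<phi> k i s) g"
      using primitive_extension[OF that(1) \<phi>[OF that]] unfolding Bex_def .
    then show ?thesis unfolding g_def by (rule someI_ex)
  qed
  note g = conjunct1[OF gP] conjunct2[OF gP]
  let ?G = "\<lambda>w s. ?g0 s + (\<Sum>k\<in>{0..N}. \<Sum>i<mult_of k. coeff k i w * g k i s)"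
  show ?thesis
  proof (rule H1_treeI[where g="?G"])
    fix w assume w: "w \<in> words"
    have "tree_function \<phi>0 \<phi> \<in> L2_functions (tree_measure T)"
      using \<phi>0 \<phi> by (intro tree_function_L2) (auto simp: H1_def H1_0_half_line_def)
    then show "(\<lambda>s. tree_function \<phi>0 \<phi> (ray w s)) \<in> L2_functions \<nu>"
      using w unfolding L2_tree_iff by blast
    show GL: "?G w \<in> L2_functions \<nu>"
      by (intro L2_functions_add g0 L2_functions_sum L2_functions_scale g) auto
    have "primitive_on {0..} (\<lambda>s. \<phi>0 s + (\<Sum>k\<in>{0..N}. \<Sum>i<mult_of k. coeff k i w * (if s \<le> t k then 0 else \<phi> k i s))) (?G w)"
      by (intro primitive_on_add P0 primitive_on_sum primitive_on_mult g) auto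
    then show "primitive_on {0..} (\<lambda>s. tree_function \<phi>0 \<phi> (ray w s)) (?G w)"
    proof (rule primitive_on_cong[OF H(1,2)])
      show "(\<lambda>s. indicator {0..} s *\<^sub>R ?G w s) \<in> borel_measurable borel"
        by (rule L2_weighted_measurable[OF nonneg_half_line GL])
    qed (simp_all add: tree_function_ray[OF w])
  qed
qed

lemma H1_parts:
  assumes f: "f \<in> H1_tree T"
  shows "f \<in> L2_functions (tree_measure T)" "tree_deriv T f \<in> L2_functions (tree_measure T)"
    and "primitive_on {0..} (mean_part f) (mean_part (tree_deriv T f))"
    and "primitive_on {0..} (part k i f) (part k i (tree_deriv T f))"
  using ray_primitive[OF f] unfolding L2_tree_iff mean_part_as_sum part_as_sum
  by (auto intro!: primitive_on_sum primitive_on_mult simp del: times_divide_eq_left)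

lemma mean_part_H1:
  assumes f: "f \<in> H1_tree T"
  shows "mean_part f \<in> H1 {0..} (reduced_weight T)" "continuous_on {0..} (mean_part f)"
    "has_weak_derivative {0<..} (mean_part f) (mean_part (tree_deriv T f))"
  using primitive_H1[OF half_line(1-3)[OF order_refl] L2_parts(1)[OF H1_parts(1)[OF f]]
      L2_parts(1)[OF H1_parts(2)[OF f]] H1_parts(3)[OF f]]
  by (simp_all add: interior_real_atLeast)

lemma part_H1:
  assumes f: "f \<in> H1_tree T" and k: "k \<le> N" "i < mult_of k"
  shows "part k i f \<in> H1_0_half_line (t k) (reduced_weight T)"
    "has_weak_derivative {t k<..} (part k i f) (part k i (tree_deriv T f))"
proof -
  note H = half_line[OF t_nonneg[OF k(1)]]
  note L = L2_half_line[OF k(1) L2_parts(2)[OF H1_parts(1)[OF f]]]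
    L2_half_line[OF k(1) L2_parts(2)[OF H1_parts(2)[OF f]]]
  note P = primitive_H1[OF H(1-3) L primitive_on_subset[OF H1_parts(4)[OF f] H(3)]]
  show "part k i f \<in> H1_0_half_line (t k) (reduced_weight T)"
    using P(1,2) part_eq_0[OF k t_nonneg[OF k(1)] order_refl] by (simp add: H1_0_half_line_def)
  show "has_weak_derivative {t k<..} (part k i f) (part k i (tree_deriv T f))"
    using P(3) by (simp add: interior_real_atLeast)
qed

lemma reduced_form_eq: "reduced_form T c = half_line_form c"
  by (simp add: fun_eq_iff reduced_form_def half_line_form_def reduced_measure_eq)

text \<open>Taking coefficients commutes with differentiation, so the coefficients of
  \<open>tree_deriv T f\<close> are weak derivatives of those of \<open>f\<close>; then
  \<open>tree_inner_eq\<close> is applied to the derivatives.\<close>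

lemma tree_form_eq:
  assumes f: "f \<in> H1_tree T" and h: "h \<in> H1_tree T"
  shows "tree_form T f h = half_line_form 0 (mean_part f) (mean_part h) +
    (\<Sum>k\<in>{0..N}. \<Sum>i<mult_of k. half_line_form (t k) (part k i f) (part k i h))"
proof -
  note Lf = H1_parts(2)[OF f] and Lh = H1_parts(2)[OF h]
  have "half_line_form 0 (mean_part f) (mean_part h) =
      1/2 * (LINT s|\<nu>. mean_part (tree_deriv T f) s * cnj (mean_part (tree_deriv T h) s))"
    by (rule half_line_form_eq[OF order_refl mean_part_H1(1)[OF f] mean_part_H1(1)[OF h]
          mean_part_H1(3)[OF f] L2_parts(1)[OF Lf] mean_part_H1(3)[OF h] L2_parts(1)[OF Lh]])
  moreover have "half_line_form (t k) (part k i f) (part k i h) = 1/2 * (LINT s|weighted {t k..} (reduced_weight T).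
      part k i (tree_deriv T f) s * cnj (part k i (tree_deriv T h) s))" if "k \<le> N" "i < mult_of k" for k i
    using part_H1[OF f that] part_H1[OF h that]
    by (intro half_line_form_eq t_nonneg that L2_half_line L2_parts Lf Lh) (auto simp: H1_0_half_line_def)
  then have "(\<Sum>k\<in>{0..N}. \<Sum>i<mult_of k. half_line_form (t k) (part k i f) (part k i h)) =
      (\<Sum>k\<in>{0..N}. \<Sum>i<mult_of k. 1/2 * (LINT s|weighted {t k..} (reduced_weight T).
        part k i (tree_deriv T f) s * cnj (part k i (tree_deriv T h) s)))"
    by (intro sum.cong refl) simp
  ultimately show ?thesis
    unfolding tree_form_def tree_inner_eq[OF Lf Lh] by (simp only: distrib_left sum_distrib_left)
qed

section \<open>Compatibility with classes, and the two realisations\<close>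

lemma AE_parts:
  assumes "AE x in tree_measure T. f x = g x"
  shows "AE s in \<nu>. mean_part f s = mean_part g s"
    and "k \<le> N \<Longrightarrow> AE s in weighted {t k..} (reduced_weight T). part k i f s = part k i g s"
proof -
  have "AE s in \<nu>. \<forall>w\<in>words. f (ray w s) = g (ray w s)"
    using AE_tree_ray[OF assms] by (intro AE_finite_allI finite_words)
  then have ae: "AE s in \<nu>. mean_part f s = mean_part g s \<and> part k i f s = part k i g s" for k i
    by eventually_elim (simp add: mean_part_def part_def)
  from ae[of 0 0] show "AE s in \<nu>. mean_part f s = mean_part g s" by (rule eventually_mono) simp
  assume k: "k \<le> N"
  note H = half_line[OF t_nonneg[OF k]]
  show "AE s in weighted {t k..} (reduced_weight T). part k i f s = part k i g s"
    using ae[of k i] H(3) unfolding AE_weighted_iff[OF H(2,3)] AE_weighted_iff[OF nonneg_half_line]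
    by (auto elim!: eventually_mono)
qed

lemma zero_H1_0_half_line: "0 \<le> c \<Longrightarrow> (\<lambda>s. 0) \<in> H1_0_half_line c (reduced_weight T)"
  using primitive_H1[OF half_line(1-3) L2_functions_0 L2_functions_0 zero_primitive, of c]
  by (simp add: H1_0_half_line_def)

lemma zero_H1_tree: "(\<lambda>x. 0) \<in> H1_tree T"
  by (rule H1_treeI[where g="\<lambda>w s. 0"]) (auto simp: L2_functions_0 zero_primitive)

lemma parts_0: "mean_part (\<lambda>x. 0) = (\<lambda>s. 0)" "part k i (\<lambda>x. 0) = (\<lambda>s. 0)"
  by (simp_all add: mean_part_def part_def fun_eq_iff)

lemma ae_form_reduced:
  assumes "k \<le> N"
  shows "ae_form (reduced_measure T (t k)) (H1_0_half_line (t k) (reduced_weight T)) (reduced_form T (t k))"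
  unfolding reduced_measure_eq reduced_form_eq
  using t_nonneg[OF assms] by (intro ae_form_half_line zero_H1_0_half_line) (auto simp: H1_0_half_line_def)

text \<open>The Dirichlet and Neumann cases differ only in \<open>D\<close> and \<open>D0\<close>,
  i.e. in the behaviour of the mean part at the root. Surjectivity allows \<open>\<phi>0\<close> to
  be replaced by an almost everywhere equal function, because \<open>D0\<close> may contain
  discontinuous functions.\<close>

lemma unitarily_equivalent_tree:
  assumes D: "D \<subseteq> H1_tree T" "(\<lambda>x. 0) \<in> D"
    and D0: "D0 \<subseteq> H1 {0..} (reduced_weight T)" "\<And>f. f \<in> D \<Longrightarrow> mean_part f \<in> D0"
    and surj: "\<And>\<phi>0 \<phi>. \<phi>0 \<in> D0 \<Longrightarrow>
      (\<And>k i. k \<le> N \<Longrightarrow> i < mult_of k \<Longrightarrow> \<phi> k i \<in> H1_0_half_line (t k) (reduced_weight T)) \<Longrightarrow>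
      \<exists>\<phi>0'. (AE s in \<nu>. \<phi>0' s = \<phi>0 s) \<and> tree_function \<phi>0' \<phi> \<in> D"
  shows "unitarily_equivalent (form_operator (tree_measure T) D (tree_form T))
    (op_sum (form_operator (reduced_measure T (t 0)) D0 (reduced_form T (t 0)))
      (op_dsum {0..N} (\<lambda>k. op_copies (reduced_Dirichlet T (t k)) (mult_of k))))"
proof -
  have z0: "(\<lambda>s. 0) \<in> D0" using D0(2)[OF D(2)] by (simp add: parts_0)
  have a0: "ae_form (reduced_measure T (t 0)) D0 (reduced_form T (t 0))"
    unfolding reduced_measure_eq reduced_form_eq t_0 by (rule ae_form_half_line[OF order_refl D0(1) z0])
  have form: "tree_form T f g = reduced_form T (t 0) (mean_part f) (mean_part g) +
      (\<Sum>k\<in>{0..N}. \<Sum>i<mult_of k. reduced_form T (t k) (part k i f) (part k i g))"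
    if "f \<in> D" "g \<in> D" for f g
    unfolding reduced_form_eq t_0 using that D(1) by (intro tree_form_eq) auto
  \<comment> \<open>Independence of representatives is inherited from the reduced forms through the
    decomposition \<open>form\<close>, which avoids a separate uniqueness argument on the
    tree.\<close>
  have a: "ae_form (tree_measure T) D (tree_form T)"
    unfolding ae_form_def
  proof (intro conjI ballI impI)
    show "D \<subseteq> L2_functions (tree_measure T)" using D(1) H1_parts(1) by blast
    show "(\<lambda>x. 0) \<in> D" by (rule D(2))
    fix u assume u: "u \<in> D"
    {
      fix u' h h' assume *: "u' \<in> D" "h \<in> D" "h' \<in> D"
        and ae: "AE x in tree_measure T. u x = u' x" "AE x in tree_measure T. h x = h' x"
      have "reduced_form T (t 0) (mean_part u) (mean_part h) = reduced_form T (t 0) (mean_part u') (mean_part h')"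
        using a0 D0(2)[OF u] D0(2)[OF *(1)] D0(2)[OF *(2)] D0(2)[OF *(3)] AE_parts(1)[OF ae(1)] AE_parts(1)[OF ae(2)]
        unfolding ae_form_def reduced_measure_eq t_0 by blast
      moreover have "reduced_form T (t k) (part k i u) (part k i h) = reduced_form T (t k) (part k i u') (part k i h')"
        if k: "k \<le> N" "i < mult_of k" for k i
      proof -
        have "part k i v \<in> H1_0_half_line (t k) (reduced_weight T)" if "v \<in> D" for v
          using part_H1(1)[OF _ k] that D(1) by blast
        then show ?thesis
          using ae_form_reduced[OF k(1)] u * AE_parts(2)[OF ae(1) k(1)] AE_parts(2)[OF ae(2) k(1)]
          unfolding ae_form_def reduced_measure_eq by blast
      qed
      ultimately show "tree_form T u h = tree_form T u' h'"
        unfolding form[OF u *(2)] form[OF *(1,3)] by (auto intro!: sum.cong)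
    }
    have "reduced_form T (t k) (part k i u) (\<lambda>s. 0) = 0" if k: "k \<le> N" "i < mult_of k" for k i
    proof -
      have "part k i u \<in> H1_0_half_line (t k) (reduced_weight T)"
        using part_H1(1)[OF _ k] u D(1) by blast
      then show ?thesis using ae_form_reduced[OF k(1)] unfolding ae_form_def by blast
    qed
    moreover have "reduced_form T (t 0) (mean_part u) (\<lambda>s. 0) = 0"
      using a0 D0(2)[OF u] unfolding ae_form_def by blast
    ultimately show "tree_form T u (\<lambda>x. 0) = 0"
      unfolding form[OF u D(2)] parts_0 by (auto intro!: sum.neutral)
  qed
  show ?thesis
    unfolding reduced_Dirichlet_def
  proof (rule form_operator_unitarily_equivalent_sum[of "tree_measure T" D "tree_form T"
        "reduced_measure T (t 0)" D0 "reduced_form T (t 0)" N "\<lambda>k. reduced_measure T (t k)"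
        "\<lambda>k. H1_0_half_line (t k) (reduced_weight T)" "\<lambda>k. reduced_form T (t k)" mean_part part mult_of])
    show "\<exists>f\<in>D. (AE s in reduced_measure T (t 0). mean_part f s = \<phi>0 s) \<and>
        (\<forall>k\<le>N. \<forall>i<mult_of k. AE s in reduced_measure T (t k). part k i f s = \<phi> k i s)"
      if h: "\<phi>0 \<in> D0" "\<And>k i. k \<le> N \<Longrightarrow> i < mult_of k \<Longrightarrow> \<phi> k i \<in> H1_0_half_line (t k) (reduced_weight T)"
      for \<phi>0 and \<phi> :: "nat \<Rightarrow> nat \<Rightarrow> real \<Rightarrow> complex"
    proof -
      obtain \<phi>0' where \<phi>0': "AE s in \<nu>. \<phi>0' s = \<phi>0 s" "tree_function \<phi>0' \<phi> \<in> D"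
        using surj[of \<phi>0 \<phi>, OF h] by blast
      have "AE s in \<nu>. mean_part (tree_function \<phi>0' \<phi>) s = \<phi>0 s"
        using AE_parts_tree_function(1)[of \<phi>0' \<phi>] \<phi>0'(1) by eventually_elim simp
      then show ?thesis
        using \<phi>0'(2) AE_parts_tree_function(2) unfolding reduced_measure_eq t_0 by blast
    qed
    show "\<exists>f\<in>L2_functions (tree_measure T). (AE s in reduced_measure T (t 0). mean_part f s = \<phi>0 s) \<and>
        (\<forall>k\<le>N. \<forall>i<mult_of k. AE s in reduced_measure T (t k). part k i f s = \<phi> k i s)"
      if h: "\<phi>0 \<in> L2_functions (reduced_measure T (t 0))"
        "\<And>k i. k \<le> N \<Longrightarrow> i < mult_of k \<Longrightarrow> \<phi> k i \<in> L2_functions (reduced_measure T (t k))"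
      for \<phi>0 and \<phi> :: "nat \<Rightarrow> nat \<Rightarrow> real \<Rightarrow> complex"
    proof (intro bexI[of _ "tree_function \<phi>0 \<phi>"] conjI allI impI)
      show "AE s in reduced_measure T (t 0). mean_part (tree_function \<phi>0 \<phi>) s = \<phi>0 s"
        unfolding reduced_measure_eq t_0 by (rule AE_parts_tree_function)
      show "AE s in reduced_measure T (t k). part k i (tree_function \<phi>0 \<phi>) s = \<phi> k i s"
        if "k \<le> N" "i < mult_of k" for k i
        unfolding reduced_measure_eq by (rule AE_parts_tree_function(2)[OF that])
      show "tree_function \<phi>0 \<phi> \<in> L2_functions (tree_measure T)"
        by (rule tree_function_L2) (use h in \<open>simp_all add: reduced_measure_eq t_0\<close>)
    qed
    show "part k i f \<in> L2_functions (reduced_measure T (t k))"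
      if "f \<in> L2_functions (tree_measure T)" "k \<le> N" for f k i
      unfolding reduced_measure_eq by (rule L2_half_line[OF that(2) L2_parts(2)[OF that(1)]])
    show "mean_part f \<in> L2_functions (reduced_measure T (t 0))" if "f \<in> L2_functions (tree_measure T)" for f
      unfolding reduced_measure_eq t_0 by (rule L2_parts(1)[OF that])
    show "(LINT x|tree_measure T. f x * cnj (g x)) = (LINT s|reduced_measure T (t 0). mean_part f s * cnj (mean_part g s)) +
        (\<Sum>k\<in>{0..N}. \<Sum>i<mult_of k. LINT s|reduced_measure T (t k). part k i f s * cnj (part k i g s))"
      if "f \<in> L2_functions (tree_measure T)" "g \<in> L2_functions (tree_measure T)" for f g
      unfolding reduced_measure_eq t_0 by (rule tree_inner_eq[OF that])
    show "part k i f \<in> H1_0_half_line (t k) (reduced_weight T)" if "f \<in> D" "k \<le> N" "i < mult_of k" for f k i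
      using part_H1(1)[OF _ that(2,3)] that(1) D(1) by blast
  qed (fact a a0 ae_form_reduced mean_part_lin part_lin D0(2) form)+
qed

lemma vertex_base: "w \<in> words \<Longrightarrow> f (Vertex base) = f (ray w 0)"
  by (simp add: ray_0)

lemma unitarily_equivalent_Dirichlet:
  "unitarily_equivalent (OU_Dirichlet T) (op_sum (reduced_Dirichlet T (t 0))
    (op_dsum {0..N} (\<lambda>k. op_copies (reduced_Dirichlet T (t k)) (mult_of k))))"
proof -
  have "unitarily_equivalent (form_operator (tree_measure T) (H1_0_tree T) (tree_form T))
    (op_sum (form_operator (reduced_measure T (t 0)) (H1_0_half_line 0 (reduced_weight T)) (reduced_form T (t 0)))
      (op_dsum {0..N} (\<lambda>k. op_copies (reduced_Dirichlet T (t k)) (mult_of k))))"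
  proof (rule unitarily_equivalent_tree)
    show "H1_0_tree T \<subseteq> H1_tree T" by (auto simp: H1_0_tree_def)
    show "(\<lambda>x. 0) \<in> H1_0_tree T" using zero_H1_tree by (simp add: H1_0_tree_def)
    show "H1_0_half_line 0 (reduced_weight T) \<subseteq> H1 {0..} (reduced_weight T)"
      by (auto simp: H1_0_half_line_def)
    show "mean_part f \<in> H1_0_half_line 0 (reduced_weight T)" if "f \<in> H1_0_tree T" for f
    proof -
      have "f \<in> H1_tree T" "f (Vertex base) = 0" using that by (auto simp: H1_0_tree_def)
      then show ?thesis
        using mean_part_H1 by (simp add: H1_0_half_line_def mean_part_def[of f 0] ray_0)
    qed
    show "\<exists>\<phi>0'. (AE s in \<nu>. \<phi>0' s = \<phi>0 s) \<and> tree_function \<phi>0' \<phi> \<in> H1_0_tree T"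
      if h: "\<phi>0 \<in> H1_0_half_line 0 (reduced_weight T)"
        "\<And>k i. k \<le> N \<Longrightarrow> i < mult_of k \<Longrightarrow> \<phi> k i \<in> H1_0_half_line (t k) (reduced_weight T)" for \<phi>0 \<phi>
    proof (intro exI conjI)
      have \<phi>0: "\<phi>0 \<in> H1 {0..} (reduced_weight T)" "continuous_on {0..} \<phi>0" "\<phi>0 0 = 0"
        using h(1) by (auto simp: H1_0_half_line_def)
      obtain w where w: "w \<in> words" using words_nonempty by blast
      \<comment> \<open>At the root every coefficient is cut off, those of generation 0 included
        since \<open>t 0 = 0\<close>; only \<open>\<phi>0 0\<close> could contribute.\<close>
      have "(\<Sum>k\<in>{0..N}. \<Sum>i<mult_of k. coeff k i w * (if 0 \<le> t k then 0 else \<phi> k i 0)) = 0"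
        by (intro sum.neutral ballI) (simp add: t_nonneg)
      then have "tree_function \<phi>0 \<phi> (Vertex base) = 0"
        unfolding vertex_base[OF w] tree_function_ray[OF w order_refl] using \<phi>0(3) by simp
      then show "tree_function \<phi>0 \<phi> \<in> H1_0_tree T"
        using tree_function_H1[OF \<phi>0(1,2) h(2)] by (simp add: H1_0_tree_def)
    qed simp
  qed
  then show ?thesis
    unfolding t_0 OU_Dirichlet_def reduced_Dirichlet_def[of T 0] .
qed

lemma unitarily_equivalent_Neumann:
  "unitarily_equivalent (OU_Neumann T) (op_sum (reduced_Neumann T (t 0))
    (op_dsum {0..N} (\<lambda>k. op_copies (reduced_Dirichlet T (t k)) (mult_of k))))"
proof -
  have "unitarily_equivalent (form_operator (tree_measure T) (H1_tree T) (tree_form T))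
    (op_sum (form_operator (reduced_measure T (t 0)) (H1 {0..} (reduced_weight T)) (reduced_form T (t 0)))
      (op_dsum {0..N} (\<lambda>k. op_copies (reduced_Dirichlet T (t k)) (mult_of k))))"
  proof (rule unitarily_equivalent_tree)
    show "(\<lambda>x. 0) \<in> H1_tree T" by (rule zero_H1_tree)
    show "mean_part f \<in> H1 {0..} (reduced_weight T)" if "f \<in> H1_tree T" for f
      by (rule mean_part_H1(1)[OF that])
    show "\<exists>\<phi>0'. (AE s in \<nu>. \<phi>0' s = \<phi>0 s) \<and> tree_function \<phi>0' \<phi> \<in> H1_tree T"
      if h: "\<phi>0 \<in> H1 {0..} (reduced_weight T)"
        "\<And>k i. k \<le> N \<Longrightarrow> i < mult_of k \<Longrightarrow> \<phi> k i \<in> H1_0_half_line (t k) (reduced_weight T)" for \<phi>0 \<phi>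
    proof -
      \<comment> \<open>The given element of the Neumann domain may be discontinuous; the function
        on the tree is built from its continuous representative.\<close>
      obtain F where F: "F \<in> H1 {0..} (reduced_weight T)" "continuous_on {0..} F" "AE s in \<nu>. \<phi>0 s = F s"
        using H1_half_line_continuous_representative[OF order_refl h(1)] by blast
      have "AE s in \<nu>. F s = \<phi>0 s" using F(3) by eventually_elim simp
      then show ?thesis using tree_function_H1[OF F(1,2) h(2)] by (intro exI[of _ F] conjI)
    qed
  qed simp_all
  then show ?thesis unfolding t_0 OU_Neumann_def reduced_Neumann_def .
qed

end

theorem theorem4p6:
  fixes T :: "('v, 'e) metric_tree" and N :: nat and t :: "nat \<Rightarrow> real" and b :: "nat \<Rightarrow> nat"
  assumes "regular_tree T N t b"
  shows "unitarily_equivalent (OU_Dirichlet T)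
           (op_sum (reduced_Dirichlet T (t 0))
             (op_dsum {0..N} (\<lambda>k.
               op_copies (reduced_Dirichlet T (t k)) (generation_size b k * (b k - 1)))))
       \<and> unitarily_equivalent (OU_Neumann T)
           (op_sum (reduced_Neumann T (t 0))
             (op_dsum {0..N} (\<lambda>k.
               op_copies (reduced_Dirichlet T (t k)) (generation_size b k * (b k - 1)))))"
proof -
  interpret regular_metric_tree T N t b by unfold_locales (rule assms)
  show ?thesis using unitarily_equivalent_Dirichlet unitarily_equivalent_Neumann ..
qed

end
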